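(* Let $n\geq 1$ be an integer, let $p\geq 5$ be a prime, and let $q$ be any prime power. Let $S$ be a Sylow $p$-subgroup of the unitary group $\mathrm{U}_n(\mathbb{F}_q)$. Then $J(S)\leq \mathfrak{X}(S)$.
   Context: For a prime power $q$, $\mathbb{F}_{q^2}$ has the field automorphism $x\mapsto \overline{x}=x^q$ of order $2$; for a matrix $A=(a_{ij})$ write $\overline{A}=(\overline{a_{ij}})$. The unitary group is $\mathrm{U}_n(\mathbb{F}_q)=\{A\in \mathrm{GL}_n(\mathbb{F}_{q^2}) : \overline{A}^{T}A=I_n\}$ (equivalently, up to isomorphism, $\{A : \overline{A}^T Q_n A=Q_n\}$, where $Q_n$ is the $n\times n$ matrix with $1$ on the skew-diagonal and $0$ elsewhere). For a finite $p$-group $S$: the Thompson subgroup $J(S)$ is the subgroup generated by all elementary abelian $p$-subgroups of $S$ whose rank equals the $p$-rank of $S$. Commutators: $[x,y]=x^{-1}y^{-1}xy$, $[X,Y;1]=[X,Y]$, $[X,Y;k]=[[X,Y;k-1],Y]$. $\Omega_1(H)$ is the subgroup generated by elements of order $p$ in $H$. The Oliver subgroup $\mathfrak{X}(S)$ is the unique largest normal subgroup $K$ of $S$ admitting a chain $1=Q_0\leq Q_1\leq\cdots\leq Q_k=K$ of normal subgroups of $S$ such that $[\Omega_1(C_S(Q_{i-1})),Q_i;p-1]=1$ for each $1\leq i\leq k$ (such a chain is called a $Q$-series). *)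

theory Defs
  imports "Jordan_Normal_Form.Matrix" "HOL-Algebra.Algebra" "HOL-Computational_Algebra.Primes"
begin

text \<open>The field F_{q^2} is a finite field type 'a with CARD('a) = q^2; the
 involution is x \<mapsto> x^q.\<close>

definition bar_mat :: "nat \<Rightarrow> 'a::field mat \<Rightarrow> 'a mat" where
  "bar_mat q A = map_mat (\<lambda>x. x ^ q) A"

definition unitary_mats :: "nat \<Rightarrow> nat \<Rightarrow> 'a::field mat set" where
  "unitary_mats q n = {A \<in> carrier_mat n n. transpose_mat (bar_mat q A) * A = 1\<^sub>m n}"

definition unitary_group :: "nat \<Rightarrow> nat \<Rightarrow> 'a::field mat monoid" where
  "unitary_group q n = \<lparr> carrier = unitary_mats q n, monoid.mult = (\<lambda>A B. A * B), one = 1\<^sub>m n \<rparr>"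

definition prime_power :: "nat \<Rightarrow> bool" where
  "prime_power q \<longleftrightarrow> (\<exists>r e. Factorial_Ring.prime (r::nat) \<and> e \<ge> 1 \<and> q = r ^ e)"

definition sylow_subgroup :: "('a, 'b) monoid_scheme \<Rightarrow> nat \<Rightarrow> 'a set \<Rightarrow> bool" where
  "sylow_subgroup G p S \<longleftrightarrow> subgroup S G \<and> card S = p ^ multiplicity p (order G)"

definition elem_abelian_sub :: "('a, 'b) monoid_scheme \<Rightarrow> nat \<Rightarrow> 'a set \<Rightarrow> 'a set \<Rightarrow> bool" where
  "elem_abelian_sub G p S E \<longleftrightarrow> subgroup E G \<and> E \<subseteq> S \<and>
     (\<forall>x\<in>E. \<forall>y\<in>E. x \<otimes>\<^bsub>G\<^esub> y = y \<otimes>\<^bsub>G\<^esub> x) \<and>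
     (\<forall>x\<in>E. x [^]\<^bsub>G\<^esub> p = \<one>\<^bsub>G\<^esub>)"

definition elab_rank :: "nat \<Rightarrow> 'a set \<Rightarrow> nat" where
  "elab_rank p E = multiplicity p (card E)"

definition p_rank :: "('a, 'b) monoid_scheme \<Rightarrow> nat \<Rightarrow> 'a set \<Rightarrow> nat" where
  "p_rank G p S = Max {elab_rank p E | E. elem_abelian_sub G p S E}"

definition thompson_subgroup :: "('a, 'b) monoid_scheme \<Rightarrow> nat \<Rightarrow> 'a set \<Rightarrow> 'a set" where
  "thompson_subgroup G p S = generate G
     (\<Union>{E. elem_abelian_sub G p S E \<and> elab_rank p E = p_rank G p S})"

definition commutator :: "('a, 'b) monoid_scheme \<Rightarrow> 'a \<Rightarrow> 'a \<Rightarrow> 'a" where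
  "commutator G x y = ((m_inv G x \<otimes>\<^bsub>G\<^esub> m_inv G y) \<otimes>\<^bsub>G\<^esub> x) \<otimes>\<^bsub>G\<^esub> y"

definition comm_sub :: "('a, 'b) monoid_scheme \<Rightarrow> 'a set \<Rightarrow> 'a set \<Rightarrow> 'a set" where
  "comm_sub G A B = generate G {c. \<exists>a\<in>A. \<exists>b\<in>B. c = commutator G a b}"

primrec iter_comm :: "('a, 'b) monoid_scheme \<Rightarrow> 'a set \<Rightarrow> 'a set \<Rightarrow> nat \<Rightarrow> 'a set" where
  "iter_comm G A B 0 = A"
| "iter_comm G A B (Suc k) = comm_sub G (iter_comm G A B k) B"

definition Omega1 :: "('a, 'b) monoid_scheme \<Rightarrow> nat \<Rightarrow> 'a set \<Rightarrow> 'a set" where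
  "Omega1 G p H = generate G {x \<in> H. group.ord G x = p}"

definition centralizer_in :: "('a, 'b) monoid_scheme \<Rightarrow> 'a set \<Rightarrow> 'a set \<Rightarrow> 'a set" where
  "centralizer_in G S Q = {x \<in> S. \<forall>y\<in>Q. x \<otimes>\<^bsub>G\<^esub> y = y \<otimes>\<^bsub>G\<^esub> x}"

definition has_Q_series :: "('a, 'b) monoid_scheme \<Rightarrow> nat \<Rightarrow> 'a set \<Rightarrow> 'a set \<Rightarrow> bool" where
  "has_Q_series G p S K \<longleftrightarrow> (\<exists>(Q :: nat \<Rightarrow> 'a set) k.
     Q 0 = {\<one>\<^bsub>G\<^esub>} \<and> Q k = K \<and>
     (\<forall>i\<le>k. Q i \<lhd> (G\<lparr>carrier := S\<rparr>)) \<and>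
     (\<forall>i<k. Q i \<subseteq> Q (Suc i)) \<and>
     (\<forall>i. 1 \<le> i \<and> i \<le> k \<longrightarrow>
        iter_comm G (Omega1 G p (centralizer_in G S (Q (i - 1)))) (Q i) (p - 1) = {\<one>\<^bsub>G\<^esub>}))"

definition oliver_subgroup :: "('a, 'b) monoid_scheme \<Rightarrow> nat \<Rightarrow> 'a set \<Rightarrow> 'a set" where
  "oliver_subgroup G p S = (THE K. K \<lhd> (G\<lparr>carrier := S\<rparr>) \<and> has_Q_series G p S K \<and>
     (\<forall>K'. K' \<lhd> (G\<lparr>carrier := S\<rparr>) \<and> has_Q_series G p S K' \<longrightarrow> K' \<subseteq> K))"

end

theory Submission
  imports Defs "HOL-Library.Function_Algebras" "HOL-Number_Theory.Residues"
    "Jordan_Normal_Form.Determinant"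
begin

text \<open>
  By Thompson's replacement theorem, if a normal elementary abelian subgroup \<open>A\<close> of \<open>S\<close> is such that
  every \<open>g\<close> in \<open>S\<close> with \<open>[A, g, g] = 1\<close> centralises \<open>A\<close>, then \<open>J(S)\<close> centralises \<open>A\<close>. It
  therefore suffices to find such an \<open>A\<close> whose centraliser in \<open>S\<close> lies in the Oliver subgroup.

  If \<open>p\<close> divides \<open>q\<close>, let \<open>U\<close> be a maximal \<open>S\<close>-invariant totally isotropic subspace and \<open>A\<close> the
  group of isometries that are trivial on \<open>U\<^sup>\<bottom>\<close> and move vectors only by elements of \<open>U\<close>. Testing
  \<open>[A, g, g] = 1\<close> on the transvections \<open>x \<mapsto> x + c h(u, x) u\<close> with \<open>c\<^sup>q = -c\<close> shows that a quadratic \<open>g\<close>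
  is trivial on \<open>U\<close>. The centraliser of \<open>A\<close> is the pointwise stabiliser of \<open>U\<close>; it is trivial on
  the quotients of \<open>0 \<le> U \<le> U\<^sup>\<bottom> \<le> W\<close>, so it has class at most 2, and \<open>p - 1 \<ge> 3\<close>.

  If \<open>p\<close> does not divide \<open>q\<close>, let \<open>V\<close> consist of the elements of exponent \<open>p\<close> in the centre of the
  Oliver subgroup, whose centraliser is the Oliver subgroup. The unitary elements of exponent \<open>p\<close> in
  the double commutant of \<open>V\<close> form a \<open>p\<close>-group normalised by the Sylow group \<open>S\<close>, and so they
  already lie in \<open>V\<close>. If \<open>g\<close> acts quadratically on \<open>V\<close> and \<open>z = [v, g] \<noteq> 1\<close>, the projections onto the
  spaces where \<open>v z\<^sup>i = 1\<close> and \<open>z\<close> has no eigenvalue 1 are permuted cyclically by \<open>g\<close>, and the element acting as \<open>z\<close>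
  on just one of them belongs to \<open>V\<close> but violates quadratic action.
\<close>

text \<open>The structure of \<open>S\<close> is never computed. Nontrivial elements are found by
  one principle: a \<open>p\<close>-group that acts on another \<open>p\<close>-group and preserves
  a proper subgroup fixes a further coset of it. In defining characteristic the group acted on may
  consist of vectors, because the order of the space is then a power of \<open>p\<close>.

  The projections are averages over cyclic groups instead: polynomials in \<open>v\<close> and
  \<open>z\<close> with coefficients in the prime field. This form makes them lie in the double
  commutant of \<open>V\<close> and makes them self-adjoint, which is why \<open>V\<close> is
  compared with its double commutant.

  The size of \<open>p\<close> enters as follows: the projections with indices 0, 1, 2 must be
  distinct; the test with transvections produces a factor 2 that has to be cancelled; and the
  stabiliser of \<open>U\<close> is reached by three commutators, which the definition permits when
  \<open>p - 1\<close> is at least 3.\<close>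

hide_const (open) Polynomial.order
hide_fact (open) Polynomial.order_def

section \<open>Fixed points of p-groups and products of subgroups\<close>

text \<open>Orbit sizes divide \<open>p ^ k\<close>, so an orbit is a point or has size divisible by
  \<open>p\<close>. If \<open>x\<close> were the only fixed point, \<open>card E\<close> would be
  congruent to 1 modulo \<open>p\<close>.\<close>

lemma p_group_action_fixed_point:
  fixes p :: nat
  assumes act: "group_action P E \<phi>" and P: "order P = p ^ k" and p: "Factorial_Ring.prime p"
    and E: "finite E" "p dvd card E"
    and x: "x \<in> E" "\<And>g. g \<in> carrier P \<Longrightarrow> \<phi> g x = x"
  shows "\<exists>y\<in>E. y \<noteq> x \<and> (\<forall>g\<in>carrier P. \<phi> g y = y)"
proof (rule ccontr)
  assume no: "\<not> ?thesis"
  interpret group_action P E \<phi> by fact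
  interpret group P using group_hom group_hom.axioms(1) by blast
  have fin: "finite (orbits P E \<phi>)"
    unfolding orbits_def using E(1) by simp
  have ox: "orbit P \<phi> x = {x}"
    unfolding orbit_def using x(2) one_closed by force
  have oxin: "{x} \<in> orbits P E \<phi>"
    unfolding orbits_def using ox x(1) by auto
  have "card E = (\<Sum>orb\<in>orbits P E \<phi>. card orb)"
    using disjoint_sum[OF E(1), of "\<lambda>_. 1::nat"] by simp
  also have "\<dots> = card {x} + (\<Sum>orb\<in>orbits P E \<phi> - {{x}}. card orb)"
    using sum.remove[OF fin oxin] by metis
  finally have ce: "card E = 1 + (\<Sum>orb\<in>orbits P E \<phi> - {{x}}. card orb)" by simp
  have "p dvd card orb" if orb: "orb \<in> orbits P E \<phi> - {{x}}" for orb
  proof -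
    obtain y where y: "y \<in> E" "orb = orbit P \<phi> y" using orb unfolding orbits_def by auto
    have "card orb dvd p ^ k"
      using orbit_stabilizer_theorem[OF y(1)] y(2) P by (metis dvd_triv_left)
    then obtain i where i: "card orb = p ^ i" using p divides_primepow_nat by blast
    have "i \<noteq> 0"
    proof
      assume "i = 0"
      then obtain w where w: "orb = {w}" using i card_1_singletonE by (metis power_0)
      have "y \<in> orb" using orbit_refl[OF y(1)] y(2) by simp
      then have oy: "orb = {y}" using w by auto
      have "\<phi> g y = y" if "g \<in> carrier P" for g
        using that oy y(2) unfolding orbit_def by blast
      then have "y = x" using no y(1) by blast
      then show False using oy orb by simp
    qed
    then show ?thesis using i by simp
  qed
  then have "p dvd (\<Sum>orb\<in>orbits P E \<phi> - {{x}}. card orb)" by (rule dvd_sum)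
  then have "p dvd 1" using ce E(2) by (metis dvd_add_left_iff)
  then show False using p by (simp add: prime_nat_iff)
qed

text \<open>\<open>P\<close> permutes the right cosets of \<open>H\<close>, whose number is a power
  of \<open>p\<close> greater than 1. As \<open>H\<close> itself is fixed, so is another coset. The
  action is a bare function with equations on the carriers, so that conjugation and matrices acting
  on vectors both fit.\<close>

lemma p_group_fixed_coset:
  fixes p :: nat and P (structure) and M (structure)
  assumes P: "group P" "order P = p ^ k" and p: "Factorial_Ring.prime p"
    and M: "group M" "order M = p ^ m" and H: "subgroup H M" "H \<noteq> carrier M"
    and closed: "\<And>s x. s \<in> carrier P \<Longrightarrow> x \<in> carrier M \<Longrightarrow> act s x \<in> carrier M"
    and hom: "\<And>s x y. s \<in> carrier P \<Longrightarrow> x \<in> carrier M \<Longrightarrow> y \<in> carrier M \<Longrightarrow>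
                act s (x \<otimes>\<^bsub>M\<^esub> y) = act s x \<otimes>\<^bsub>M\<^esub> act s y"
    and one: "\<And>x. x \<in> carrier M \<Longrightarrow> act \<one>\<^bsub>P\<^esub> x = x"
    and mult: "\<And>s t x. s \<in> carrier P \<Longrightarrow> t \<in> carrier P \<Longrightarrow> x \<in> carrier M \<Longrightarrow>
                act (s \<otimes>\<^bsub>P\<^esub> t) x = act s (act t x)"
    and inv: "\<And>s h. s \<in> carrier P \<Longrightarrow> h \<in> H \<Longrightarrow> act s h \<in> H"
  shows "\<exists>x\<in>carrier M - H. \<forall>s\<in>carrier P. act s x \<in> H #>\<^bsub>M\<^esub> x"
proof -
  interpret P: group P by fact
  interpret M: group M by fact
  let ?E = "rcosets\<^bsub>M\<^esub> H"
  let ?\<phi> = "\<lambda>s. \<lambda>C\<in>?E. act s ` C"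
  have Hsub: "H \<subseteq> carrier M" using H(1) subgroup.subset by blast
  have finM: "finite (carrier M)"
    using M(2) p by (metis card.infinite order_def power_eq_0_iff not_prime_0)
  have im: "act s ` (H #>\<^bsub>M\<^esub> x) = H #>\<^bsub>M\<^esub> act s x" if s: "s \<in> carrier P" and x: "x \<in> carrier M" for s x
  proof
    show "act s ` (H #>\<^bsub>M\<^esub> x) \<subseteq> H #>\<^bsub>M\<^esub> act s x"
      using s x hom inv Hsub unfolding r_coset_def by (auto simp: subset_iff)
    show "H #>\<^bsub>M\<^esub> act s x \<subseteq> act s ` (H #>\<^bsub>M\<^esub> x)"
    proof
      fix y assume "y \<in> H #>\<^bsub>M\<^esub> act s x"
      then obtain h where h: "h \<in> H" "y = h \<otimes>\<^bsub>M\<^esub> act s x" unfolding r_coset_def by auto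
      let ?h = "act (inv\<^bsub>P\<^esub> s) h"
      have h': "?h \<in> H" using inv h s by simp
      have "act s ?h = h" using mult[of s "inv\<^bsub>P\<^esub> s" h] s h Hsub one by auto
      then have "act s (?h \<otimes>\<^bsub>M\<^esub> x) = y" using hom[of s ?h x] s x h h' Hsub by auto
      then show "y \<in> act s ` (H #>\<^bsub>M\<^esub> x)" using h' unfolding r_coset_def by blast
    qed
  qed
  have imE: "act s ` C \<in> ?E" if sC: "s \<in> carrier P" "C \<in> ?E" for s C
  proof -
    obtain x where "x \<in> carrier M" "C = H #>\<^bsub>M\<^esub> x" using sC(2) unfolding RCOSETS_def by auto
    then show ?thesis using sC(1) im closed M.rcosetsI[OF Hsub] by simp
  qed
  have EM: "x \<in> carrier M" if "C \<in> ?E" "x \<in> C" for x C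
    using that M.rcosets_part_G[OF H(1)] by blast
  have imm: "act (s \<otimes>\<^bsub>P\<^esub> t) ` C = act s ` act t ` C" if "s \<in> carrier P" "t \<in> carrier P" "C \<in> ?E" for s t C
    unfolding image_image by (rule image_cong) (use that mult EM in simp_all)
  have im1: "act \<one>\<^bsub>P\<^esub> ` C = C" if "C \<in> ?E" for C
    using image_cong[of C C "act \<one>\<^bsub>P\<^esub>" "\<lambda>x. x"] that one EM by simp
  have bij: "bij_betw (?\<phi> s) ?E ?E" if s: "s \<in> carrier P" for s
    by (rule bij_betw_byWitness[where f' = "?\<phi> (inv\<^bsub>P\<^esub> s)"])
       (use s imE imm[symmetric] im1 in auto)
  have "group_action P ?E ?\<phi>"
    unfolding group_action_def group_hom_def group_hom_axioms_def
  proof (intro conjI)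
    show "group P" by fact
    show "group (BijGroup ?E)" by (rule group_BijGroup)
    show "?\<phi> \<in> hom P (BijGroup ?E)"
    proof (rule homI)
      fix s assume "s \<in> carrier P"
      then show "?\<phi> s \<in> carrier (BijGroup ?E)"
        using bij by (auto simp: BijGroup_def Bij_def)
    next
      fix s t assume st: "s \<in> carrier P" "t \<in> carrier P"
      have B: "?\<phi> s \<in> Bij ?E" "?\<phi> t \<in> Bij ?E" using st bij by (auto simp: Bij_def)
      show "?\<phi> (s \<otimes>\<^bsub>P\<^esub> t) = ?\<phi> s \<otimes>\<^bsub>BijGroup ?E\<^esub> ?\<phi> t"
        using B st imE imm unfolding BijGroup_def by (auto simp: compose_def intro!: ext)
    qed
  qed
  moreover have "finite ?E" using finM M.rcosets_part_G[OF H(1)] by (metis finite_UnionD)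
  moreover have "p dvd card ?E"
  proof -
    have lag: "card ?E * card H = p ^ m" using M.lagrange[OF H(1)] M(2) by simp
    then obtain i where i: "card ?E = p ^ i" using p divides_primepow_nat by (metis dvd_triv_left)
    have "i \<noteq> 0"
    proof
      assume "i = 0"
      then have "card H = card (carrier M)" using lag i M(2) by (simp add: order_def)
      then show False using H(2) Hsub finM card_subset_eq by blast
    qed
    then show ?thesis using i by simp
  qed
  moreover have HE: "H \<in> ?E" using M.rcosetsI[OF Hsub M.one_closed] Hsub by (simp add: M.coset_mult_one)
  moreover have "?\<phi> s H = H" if s: "s \<in> carrier P" for s
  proof -
    have a1: "act s \<one>\<^bsub>M\<^esub> = \<one>\<^bsub>M\<^esub>"
      using hom[OF s M.one_closed M.one_closed] closed[OF s M.one_closed] by (simp add: M.r_cancel_one')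
    have "act s ` H = H"
      using im[OF s M.one_closed] a1 Hsub by (simp add: M.coset_mult_one)
    then show ?thesis using HE by simp
  qed
  ultimately have "\<exists>C\<in>?E. C \<noteq> H \<and> (\<forall>s\<in>carrier P. ?\<phi> s C = C)"
    using p_group_action_fixed_point[OF _ P(2) p, of ?E ?\<phi> H] by blast
  then obtain C where C: "C \<in> ?E" "C \<noteq> H" "\<And>s. s \<in> carrier P \<Longrightarrow> ?\<phi> s C = C"
    by blast
  then obtain x where x: "x \<in> carrier M" "C = H #>\<^bsub>M\<^esub> x" unfolding RCOSETS_def by auto
  have "x \<notin> H" using C(2) x H(1) M.coset_join2 by blast
  moreover have "x \<in> C" using x H(1) M.rcos_self by blast
  then have "act s x \<in> C" if "s \<in> carrier P" for s
    using C(1) C(3)[OF that] by (metis imageI restrict_apply')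
  ultimately show ?thesis using x by blast
qed

context group
begin

text \<open>Each fibre of the multiplication map on \<open>H \<times> K\<close> is a torsor under
  \<open>H \<inter> K\<close>, which shifts a factor from one side to the other.\<close>

lemma card_set_mult_subgroups:
  assumes H: "subgroup H G" "finite H" and K: "subgroup K G" "finite K"
  shows "card (H <#> K) * card (H \<inter> K) = card H * card K"
proof -
  let ?f = "\<lambda>(h, k). h \<otimes> k"
  have sub: "H \<subseteq> carrier G" "K \<subseteq> carrier G" using H K subgroup.subset by auto
  have HK: "H <#> K = ?f ` (H \<times> K)" unfolding set_mult_def by auto
  have fib: "card {a \<in> H \<times> K. ?f a = x} = card (H \<inter> K)" if xHK: "x \<in> H <#> K" for x
  proof -
    obtain h k where hk: "h \<in> H" "k \<in> K" "x = h \<otimes> k" using xHK unfolding set_mult_def by blast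
    let ?g = "\<lambda>y. (h \<otimes> y, inv y \<otimes> k)"
    have "bij_betw ?g (H \<inter> K) {a \<in> H \<times> K. ?f a = x}"
      unfolding bij_betw_def
    proof
      show "inj_on ?g (H \<inter> K)" using hk sub by (auto simp: inj_on_def subset_iff)
      show "?g ` (H \<inter> K) = {a \<in> H \<times> K. ?f a = x}"
      proof (intro equalityI subsetI)
        fix a assume "a \<in> ?g ` (H \<inter> K)"
        then show "a \<in> {a \<in> H \<times> K. ?f a = x}"
          using hk sub H(1) K(1)
          by (auto simp: subgroup.m_closed subgroup.m_inv_closed m_assoc subset_iff)
             (simp add: m_assoc[symmetric])
      next
        fix a assume "a \<in> {a \<in> H \<times> K. ?f a = x}"
        then obtain h' k' where a: "a = (h', k')" "h' \<in> H" "k' \<in> K" "h' \<otimes> k' = h \<otimes> k"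
          using hk by auto
        have c: "h \<in> carrier G" "k \<in> carrier G" "h' \<in> carrier G" "k' \<in> carrier G" using a hk sub by auto
        let ?y = "inv h \<otimes> h'"
        have y: "?y = k \<otimes> inv k'" using c a(4) by (metis inv_closed inv_solve_left inv_solve_right m_assoc m_closed)
        have "?y \<in> H \<inter> K" using y a hk H(1) K(1) by (metis IntI subgroup.m_closed subgroup.m_inv_closed)
        moreover have "?g ?y = a"
          using y c a(1) by (simp add: inv_mult_group m_assoc) (simp add: m_assoc[symmetric] y[symmetric])
        ultimately show "a \<in> ?g ` (H \<inter> K)" by blast
      qed
    qed
    from bij_betw_same_card[OF this] show ?thesis by simp
  qed
  have "card H * card K = card (H \<times> K)" by (simp add: card_cartesian_product)
  also have "\<dots> = card (\<Union>x\<in>H <#> K. {a \<in> H \<times> K. ?f a = x})"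
    using HK by (intro arg_cong[where f = card]) auto
  also have "\<dots> = (\<Sum>x\<in>H <#> K. card {a \<in> H \<times> K. ?f a = x})"
    by (rule card_UN_disjoint) (use HK H K in auto)
  also have "\<dots> = card (H <#> K) * card (H \<inter> K)" using fib by simp
  finally show ?thesis by simp
qed

lemma set_mult_subgroup_of_normalizing:
  assumes H: "subgroup H G" and K: "subgroup K G"
    and norm: "\<And>k h. k \<in> K \<Longrightarrow> h \<in> H \<Longrightarrow> k \<otimes> h \<otimes> inv k \<in> H"
  shows "subgroup (H <#> K) G"
proof (rule subgroupI)
  have sub: "H \<subseteq> carrier G" "K \<subseteq> carrier G" using H K subgroup.subset by auto
  show "H <#> K \<subseteq> carrier G" using sub set_mult_closed by blast
  show "H <#> K \<noteq> {}" using H K subgroup.one_closed unfolding set_mult_def by blast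
  fix x assume "x \<in> H <#> K"
  then obtain h k where x: "h \<in> H" "k \<in> K" "x = h \<otimes> k" unfolding set_mult_def by auto
  have c: "h \<in> carrier G" "k \<in> carrier G" using x sub by auto
  have "inv x = (inv k \<otimes> inv h \<otimes> inv (inv k)) \<otimes> inv k"
    using c x(3) by (simp add: inv_mult_group m_assoc)
  moreover have "inv k \<otimes> inv h \<otimes> inv (inv k) \<in> H"
    using norm[of "inv k" "inv h"] x H K subgroup.m_inv_closed by metis
  ultimately show "inv x \<in> H <#> K"
    using x K subgroup.m_inv_closed[OF K] unfolding set_mult_def by auto
  fix y assume "y \<in> H <#> K"
  then obtain h' k' where y: "h' \<in> H" "k' \<in> K" "y = h' \<otimes> k'" unfolding set_mult_def by auto
  have c': "h' \<in> carrier G" "k' \<in> carrier G" using y sub by auto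
  have "x \<otimes> y = (h \<otimes> (k \<otimes> h' \<otimes> inv k)) \<otimes> (k \<otimes> k')"
    using c c' x y by (simp add: m_assoc) (simp add: m_assoc[symmetric])
  moreover have "h \<otimes> (k \<otimes> h' \<otimes> inv k) \<in> H" "k \<otimes> k' \<in> K"
    using norm x y H K subgroup.m_closed by metis+
  ultimately show "x \<otimes> y \<in> H <#> K" unfolding set_mult_def by blast
qed

lemma set_mult_memI: "h \<in> H \<Longrightarrow> k \<in> K \<Longrightarrow> h \<otimes> k \<in> H <#> K"
  unfolding set_mult_def by blast

lemma set_mult_memE:
  assumes "x \<in> H <#> K" obtains h k where "h \<in> H" "k \<in> K" "x = h \<otimes> k"
  using assms unfolding set_mult_def by blast

lemma subset_set_mult:
  assumes "subgroup H G" "subgroup K G"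
  shows "H \<subseteq> H <#> K" "K \<subseteq> H <#> K"
  using assms set_mult_memI[of _ H \<one> K] set_mult_memI[of \<one> H _ K]
  by (auto simp: subgroup.one_closed subgroup.mem_carrier)

text \<open>The form with all operations taken in \<open>G\<close>: the structure with restricted
  carrier has an inverse of its own, which must be identified with that of \<open>G\<close>.\<close>

lemma normal_in_subgroup_iff:
  assumes S: "subgroup S G"
  shows "K \<lhd> G\<lparr>carrier := S\<rparr> \<longleftrightarrow>
    subgroup K G \<and> K \<subseteq> S \<and> (\<forall>s\<in>S. \<forall>k\<in>K. s \<otimes> k \<otimes> inv s \<in> K)"
proof -
  interpret GS: group "G\<lparr>carrier := S\<rparr>" using S subgroup_imp_group by blast
  have "subgroup K (G\<lparr>carrier := S\<rparr>) \<longleftrightarrow> subgroup K G \<and> K \<subseteq> S"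
  proof
    assume K: "subgroup K (G\<lparr>carrier := S\<rparr>)"
    show "subgroup K G \<and> K \<subseteq> S"
      using incl_subgroup[OF S K] subgroup.subset[OF K] by simp
  next
    assume "subgroup K G \<and> K \<subseteq> S"
    then show "subgroup K (G\<lparr>carrier := S\<rparr>)" using subgroup_incl[OF _ S] by blast
  qed
  moreover have "inv\<^bsub>G\<lparr>carrier := S\<rparr>\<^esub> s = inv s" if "s \<in> S" for s
    using m_inv_consistent[OF S that] .
  ultimately show ?thesis unfolding GS.normal_inv_iff by auto
qed

text \<open>Cauchy's theorem, here Sylow existence with exponent 1: a prime \<open>r\<close>
  dividing the order yields a nontrivial element whose order divides both \<open>r\<close> and
  \<open>p\<close>, whence \<open>r = p\<close>.\<close>

lemma elem_p_group_card:
  fixes p :: nat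
  assumes p: "Factorial_Ring.prime p" and D: "subgroup D G" "finite D"
    and exp: "\<And>x. x \<in> D \<Longrightarrow> x [^] p = \<one>"
  shows "\<exists>k. card D = p ^ k"
proof -
  have "card D \<noteq> 0" using D subgroup.one_closed[OF D(1)] by auto
  moreover have "r = p" if r: "Factorial_Ring.prime r" "r dvd card D" for r
  proof -
    interpret D: group "G\<lparr>carrier := D\<rparr>" using D subgroup_imp_group by blast
    obtain m where "card D = r * m" using r(2) by auto
    then have "order (G\<lparr>carrier := D\<rparr>) = r ^ 1 * m" by (simp add: order_def)
    then obtain H where H: "subgroup H (G\<lparr>carrier := D\<rparr>)" "card H = r ^ 1"
      using sylow_thm[OF r(1) D.is_group, of 1 m] D(2) by auto
    have HG: "subgroup H G" "H \<subseteq> D"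
      using incl_subgroup[OF D(1) H(1)] subgroup.subset[OF H(1)] by simp_all
    have "H \<noteq> {\<one>}" using H(2) r(1) by (auto simp: prime_nat_iff)
    then obtain x where x: "x \<in> H" "x \<noteq> \<one>" using subgroup.one_closed[OF HG(1)] by blast
    interpret H: group "G\<lparr>carrier := H\<rparr>" using HG subgroup_imp_group by blast
    have xc: "x \<in> carrier G" using subgroup.mem_carrier[OF HG(1)] x by blast
    have "x [^]\<^bsub>G\<lparr>carrier := H\<rparr>\<^esub> order (G\<lparr>carrier := H\<rparr>) = \<one>"
      using H.pow_order_eq_1[of x] x by simp
    then have "x [^] r = \<one>" using H(2) by (simp add: order_def nat_pow_consistent[symmetric])
    then have "ord x dvd r" "ord x dvd p" using exp HG x xc pow_eq_id by auto
    moreover have "ord x \<noteq> 1" using x xc using ord_eq_1 by auto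
    ultimately show "r = p" using r(1) p by (metis prime_nat_iff)
  qed
  ultimately have D0: "card D \<noteq> 0" and Dr: "\<And>r. Factorial_Ring.prime r \<Longrightarrow> r dvd card D \<Longrightarrow> r = p"
    by blast+
  have np: "\<not> is_unit p" using p by (simp add: prime_nat_iff)
  obtain d where d: "card D = p ^ multiplicity p (card D) * d" "\<not> p dvd d"
    using multiplicity_decompose'[OF D0 np] by blast
  have "d = 1"
  proof (rule ccontr)
    assume "d \<noteq> 1"
    then obtain r where r: "Factorial_Ring.prime r" "r dvd d" using prime_factor_nat by blast
    then have "r = p" using Dr d(1) by (metis dvd_mult)
    then show False using r(2) d(2) by simp
  qed
  then show ?thesis using d(1) by auto
qed

text \<open>\<open>D <#> S\<close> is a \<open>p\<close>-group containing \<open>S\<close>, and the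
  order of \<open>S\<close> is already the full power of \<open>p\<close> in
  \<open>order G\<close>.\<close>

lemma sylow_contains_normalized_p_subgroup:
  fixes p :: nat
  assumes fin: "finite (carrier G)" and p: "Factorial_Ring.prime p"
    and S: "sylow_subgroup G p S" and D: "subgroup D G" "card D = p ^ k"
    and norm: "\<And>s d. s \<in> S \<Longrightarrow> d \<in> D \<Longrightarrow> s \<otimes> d \<otimes> inv s \<in> D"
  shows "D \<subseteq> S"
proof -
  have S': "subgroup S G" "card S = p ^ multiplicity p (order G)"
    using S unfolding sylow_subgroup_def by auto
  have DS: "subgroup (D <#> S) G" by (rule set_mult_subgroup_of_normalizing) (use D S' norm in auto)
  have finite: "finite D" "finite S" "finite (D <#> S)"
    using finite_subset[OF subgroup.subset fin] D(1) S'(1) DS by auto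
  have "card (D <#> S) * card (D \<inter> S) = p ^ k * p ^ multiplicity p (order G)"
    using card_set_mult_subgroups[OF D(1) finite(1) S'(1) finite(2)] D(2) S'(2) by simp
  then have "card (D <#> S) dvd p ^ (k + multiplicity p (order G))"
    by (metis dvd_triv_left power_add)
  then obtain i where i: "card (D <#> S) = p ^ i" using p divides_primepow_nat by blast
  have "p ^ i dvd order G" using i lagrange[OF DS] by (metis dvd_triv_right)
  moreover have "order G \<noteq> 0" using fin by (simp add: order_gt_0_iff_finite)
  ultimately have "i \<le> multiplicity p (order G)"
    using p by (intro multiplicity_geI) (auto simp: prime_nat_iff)
  then have "card (D <#> S) \<le> card S" using i S'(2) p by (simp add: prime_gt_0_nat power_increasing Suc_leI)
  then have "D <#> S = S" using subset_set_mult(2)[OF D(1) S'(1)] finite card_seteq by metis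
  then show ?thesis using subset_set_mult(1)[OF D(1) S'(1)] by simp
qed

end

section \<open>Thompson replacement\<close>

context group
begin

lemma inv_mult_cancel:
  assumes "x \<in> carrier G" "y \<in> carrier G"
  shows "inv x \<otimes> (x \<otimes> y) = y" "x \<otimes> (inv x \<otimes> y) = y"
  using assms by (simp_all add: m_assoc[symmetric])

text \<open>These bring words to right-nested form and cancel adjacent inverse pairs, which settles
  the identities that hold in free groups.\<close>

lemmas word_simps = m_assoc inv_mult_group inv_mult_cancel

lemma elem_abelian_subD:
  assumes "elem_abelian_sub G p S E"
  shows "subgroup E G" "E \<subseteq> S" "E \<subseteq> carrier G"
    "x \<in> E \<Longrightarrow> y \<in> E \<Longrightarrow> x \<otimes> y = y \<otimes> x" "x \<in> E \<Longrightarrow> x [^] p = \<one>"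
  using assms subgroup.subset unfolding elem_abelian_sub_def by auto

lemma elem_abelian_sub_mult:
  assumes S: "subgroup S G" and A: "elem_abelian_sub G p S A" and B: "elem_abelian_sub G p S B"
    and comm: "\<And>a b. a \<in> A \<Longrightarrow> b \<in> B \<Longrightarrow> a \<otimes> b = b \<otimes> a"
  shows "elem_abelian_sub G p S (A <#> B)"
  unfolding elem_abelian_sub_def
proof (intro conjI ballI)
  note A' = elem_abelian_subD[OF A] and B' = elem_abelian_subD[OF B]
  have Ac: "a \<in> carrier G" if "a \<in> A" for a using that A'(3) by blast
  have Bc: "b \<in> carrier G" if "b \<in> B" for b using that B'(3) by blast
  have "b \<otimes> a \<otimes> inv b = a" if "a \<in> A" "b \<in> B" for a b
    using comm[OF that] Ac[OF that(1)] Bc[OF that(2)] by (metis inv_closed m_assoc r_inv r_one)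
  then show "subgroup (A <#> B) G"
    using set_mult_subgroup_of_normalizing[OF A'(1) B'(1)] by simp
  show "A <#> B \<subseteq> S"
    using A'(2) B'(2) subgroup.m_closed[OF S] by (auto elim!: set_mult_memE)
  fix x assume "x \<in> A <#> B"
  then obtain a b where x: "a \<in> A" "b \<in> B" "x = a \<otimes> b" by (rule set_mult_memE)
  show "x [^] p = \<one>"
    using x pow_mult_distrib[OF comm[OF x(1,2)] Ac[OF x(1)] Bc[OF x(2)]] A'(5)[OF x(1)] B'(5)[OF x(2)]
    by simp
  fix y assume "y \<in> A <#> B"
  then obtain c d where y: "c \<in> A" "d \<in> B" "y = c \<otimes> d" by (rule set_mult_memE)
  note cs = Ac[OF x(1)] Bc[OF x(2)] Ac[OF y(1)] Bc[OF y(2)]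
  have "x \<otimes> y = a \<otimes> (b \<otimes> c) \<otimes> d" using x(3) y(3) cs by (simp add: m_assoc)
  also have "\<dots> = a \<otimes> (c \<otimes> b) \<otimes> d" using comm[OF y(1) x(2)] by simp
  also have "\<dots> = (a \<otimes> c) \<otimes> (b \<otimes> d)" using cs by (simp add: m_assoc)
  also have "\<dots> = (c \<otimes> a) \<otimes> (d \<otimes> b)" using A'(4)[OF x(1) y(1)] B'(4)[OF x(2) y(2)] by simp
  also have "\<dots> = c \<otimes> (a \<otimes> d) \<otimes> b" using cs by (simp add: m_assoc)
  also have "\<dots> = c \<otimes> (d \<otimes> a) \<otimes> b" using comm[OF x(1) y(2)] by simp
  also have "\<dots> = y \<otimes> x" using x(3) y(3) cs by (simp add: m_assoc)
  finally show "x \<otimes> y = y \<otimes> x" .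
qed

text \<open>Orders of elementary abelian subgroups divide the order of \<open>S\<close> and are
  powers of \<open>p\<close>, so comparing exponents compares orders. The set of ranks must be
  finite for \<open>Max\<close> to bound its members.\<close>

lemma p_rank_maximal:
  fixes p :: nat
  assumes fin: "finite (carrier G)" and p: "Factorial_Ring.prime p"
    and S: "subgroup S G" "card S = p ^ k"
    and E: "elem_abelian_sub G p S E" "elab_rank p E = p_rank G p S"
    and E': "elem_abelian_sub G p S E'"
  shows "card E' \<le> card E"
proof -
  have card: "card F = p ^ elab_rank p F" if F: "elem_abelian_sub G p S F" for F
  proof -
    interpret GS: group "G\<lparr>carrier := S\<rparr>" using S subgroup_imp_group by blast
    have "subgroup F (G\<lparr>carrier := S\<rparr>)"
      using elem_abelian_subD(1,2)[OF F] subgroup_incl[OF _ S(1)] by blast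
    from GS.lagrange[OF this] have "card (rcosets\<^bsub>G\<lparr>carrier := S\<rparr>\<^esub> F) * card F = card S" by (simp add: order_def)
    then have "card F dvd card S" by (metis dvd_triv_right)
    then obtain i where i: "card F = p ^ i" using S(2) p divides_primepow_nat by metis
    then show ?thesis using p by (simp add: elab_rank_def)
  qed
  let ?R = "{elab_rank p E | E. elem_abelian_sub G p S E}"
  have "?R \<subseteq> elab_rank p ` Pow (carrier G)" using elem_abelian_subD(3) by blast
  then have "finite ?R" using fin finite_subset by blast
  then have "elab_rank p E' \<le> p_rank G p S" unfolding p_rank_def using E' by (intro Max_ge) auto
  then show ?thesis
    using card[OF E(1)] card[OF E'] E(2) p by (simp add: power_increasing prime_gt_0_nat Suc_leI)
qed

text \<open>Thompson's replacement: if the normal subgroup \<open>A\<close> does not normalise \<open>E\<close>, choose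
  \<open>a\<close> in \<open>A\<close> outside \<open>N = N\<^sub>A(E)\<close> with \<open>[a, E] \<subseteq> N\<close>. With \<open>E' = a E a\<^sup>-\<^sup>1\<close> and \<open>H = E E'\<close>, the
  group \<open>(H \<inter> A)(E \<inter> E')\<close> replaces \<open>E\<close>.\<close>

lemma thompson_replacement:
  fixes p :: nat
  assumes fin: "finite (carrier G)" and p: "Factorial_Ring.prime p"
    and S: "subgroup S G" "card S = p ^ k"
    and A: "elem_abelian_sub G p S A"
    and An: "\<And>s a. s \<in> S \<Longrightarrow> a \<in> A \<Longrightarrow> s \<otimes> a \<otimes> inv s \<in> A"
    and E: "elem_abelian_sub G p S E"
    and max: "\<And>F. elem_abelian_sub G p S F \<Longrightarrow> card F \<le> card E"
    and nn: "a0 \<in> A" "e0 \<in> E" "inv a0 \<otimes> e0 \<otimes> a0 \<notin> E"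
  shows "\<exists>F. elem_abelian_sub G p S F \<and> card F = card E \<and> card (E \<inter> A) < card (F \<inter> A) \<and>
    \<not> F \<subseteq> centralizer_in G S A"
proof -
  note A' = elem_abelian_subD[OF A] and E' = elem_abelian_subD[OF E]
  have Ac [simp]: "x \<in> carrier G" if "x \<in> A" for x using that A'(3) by blast
  have Ec [simp]: "x \<in> carrier G" if "x \<in> E" for x using that E'(3) by blast
  have finE: "finite E" and finA: "finite A" using A'(3) E'(3) fin finite_subset by blast+
  \<comment> \<open>Membership in the normaliser of \<open>E\<close>. Both directions of conjugation
    are included, so closure under inverses is immediate.\<close>
  define nrm where "nrm x \<longleftrightarrow> x \<in> carrier G \<and> (\<forall>e\<in>E. x \<otimes> e \<otimes> inv x \<in> E \<and> inv x \<otimes> e \<otimes> x \<in> E)" for x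
  have nrm_mult: "nrm (x \<otimes> y)" if "nrm x" "nrm y" for x y
  proof -
    have c: "x \<in> carrier G" "y \<in> carrier G" using that unfolding nrm_def by auto
    have "x \<otimes> y \<otimes> e \<otimes> inv (x \<otimes> y) \<in> E" "inv (x \<otimes> y) \<otimes> e \<otimes> (x \<otimes> y) \<in> E" if e: "e \<in> E" for e
    proof -
      have "x \<otimes> y \<otimes> e \<otimes> inv (x \<otimes> y) = x \<otimes> (y \<otimes> e \<otimes> inv y) \<otimes> inv x"
        "inv (x \<otimes> y) \<otimes> e \<otimes> (x \<otimes> y) = inv y \<otimes> (inv x \<otimes> e \<otimes> x) \<otimes> y"
        using c e by (simp_all add: word_simps)
      then show "x \<otimes> y \<otimes> e \<otimes> inv (x \<otimes> y) \<in> E" "inv (x \<otimes> y) \<otimes> e \<otimes> (x \<otimes> y) \<in> E"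
        using \<open>nrm x\<close> \<open>nrm y\<close> e unfolding nrm_def by auto
    qed
    then show ?thesis using c unfolding nrm_def by auto
  qed
  have nrm_inv: "nrm (inv x)" if "nrm x" for x
    using that unfolding nrm_def by auto
  have nrm_E: "nrm e" if e: "e \<in> E" for e
    using e E'(1) subgroup.m_closed[OF E'(1)] subgroup.m_inv_closed[OF E'(1)] unfolding nrm_def by auto
  define N where "N = {a \<in> A. nrm a}"
  have Nsub: "subgroup N G"
  proof (rule subgroupI)
    show "N \<subseteq> carrier G" unfolding N_def by auto
    have "\<one> \<in> N" using subgroup.one_closed[OF A'(1)] nrm_E[OF subgroup.one_closed[OF E'(1)]] unfolding N_def by simp
    then show "N \<noteq> {}" by blast
    show "inv x \<in> N" if "x \<in> N" for x
      using that nrm_inv subgroup.m_inv_closed[OF A'(1)] unfolding N_def by auto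
    show "x \<otimes> y \<in> N" if "x \<in> N" "y \<in> N" for x y
      using that nrm_mult subgroup.m_closed[OF A'(1)] unfolding N_def by auto
  qed
  \<comment> \<open>\<open>E\<close> acts by conjugation on the \<open>p\<close>-group
    \<open>A\<close> and preserves \<open>N\<close>, a proper subgroup because of
    \<open>a0\<close>.\<close>
  have "\<exists>a\<in>A - N. \<forall>e\<in>E. e \<otimes> a \<otimes> inv e \<in> N #> a"
  proof -
    have gE: "group (G\<lparr>carrier := E\<rparr>)" and gA: "group (G\<lparr>carrier := A\<rparr>)"
      using A'(1) E'(1) subgroup_imp_group by auto
    have NA: "subgroup N (G\<lparr>carrier := A\<rparr>)"
      using subgroup_incl[OF Nsub A'(1)] unfolding N_def by auto
    have "a0 \<notin> N" using nn unfolding N_def nrm_def by auto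
    then have ne: "N \<noteq> carrier (G\<lparr>carrier := A\<rparr>)" using nn(1) by auto
    obtain i where i: "card E = p ^ i" using elem_p_group_card[OF p E'(1) finE E'(5)] by auto
    obtain j where j: "card A = p ^ j" using elem_p_group_card[OF p A'(1) finA A'(5)] by auto
    have "\<exists>x\<in>carrier (G\<lparr>carrier := A\<rparr>) - N. \<forall>s\<in>carrier (G\<lparr>carrier := E\<rparr>).
        s \<otimes> x \<otimes> inv s \<in> N #>\<^bsub>G\<lparr>carrier := A\<rparr>\<^esub> x"
    proof (rule p_group_fixed_coset[OF gE _ p gA _ NA ne])
      show "order (G\<lparr>carrier := E\<rparr>) = p ^ i" "order (G\<lparr>carrier := A\<rparr>) = p ^ j"
        using i j by (simp_all add: order_def)
      show "s \<otimes> x \<otimes> inv s \<in> carrier (G\<lparr>carrier := A\<rparr>)"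
        if "s \<in> carrier (G\<lparr>carrier := E\<rparr>)" "x \<in> carrier (G\<lparr>carrier := A\<rparr>)" for s x
        using that An E'(2) by auto
      show "s \<otimes> (x \<otimes>\<^bsub>G\<lparr>carrier := A\<rparr>\<^esub> y) \<otimes> inv s = (s \<otimes> x \<otimes> inv s) \<otimes>\<^bsub>G\<lparr>carrier := A\<rparr>\<^esub> (s \<otimes> y \<otimes> inv s)"
        if "s \<in> carrier (G\<lparr>carrier := E\<rparr>)" "x \<in> carrier (G\<lparr>carrier := A\<rparr>)" "y \<in> carrier (G\<lparr>carrier := A\<rparr>)" for s x y
        using that by (simp add: word_simps)
      show "\<one>\<^bsub>G\<lparr>carrier := E\<rparr>\<^esub> \<otimes> x \<otimes> inv \<one>\<^bsub>G\<lparr>carrier := E\<rparr>\<^esub> = x"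
        if "x \<in> carrier (G\<lparr>carrier := A\<rparr>)" for x using that by simp
      show "(s \<otimes>\<^bsub>G\<lparr>carrier := E\<rparr>\<^esub> t) \<otimes> x \<otimes> inv (s \<otimes>\<^bsub>G\<lparr>carrier := E\<rparr>\<^esub> t) = s \<otimes> (t \<otimes> x \<otimes> inv t) \<otimes> inv s"
        if "s \<in> carrier (G\<lparr>carrier := E\<rparr>)" "t \<in> carrier (G\<lparr>carrier := E\<rparr>)" "x \<in> carrier (G\<lparr>carrier := A\<rparr>)" for s t x
        using that by (simp add: word_simps)
      show "s \<otimes> h \<otimes> inv s \<in> N" if "s \<in> carrier (G\<lparr>carrier := E\<rparr>)" "h \<in> N" for s h
        using that nrm_mult nrm_E nrm_inv An E'(2) unfolding N_def by auto
    qed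
    then show ?thesis by (simp add: r_coset_def)
  qed
  then obtain a where a: "a \<in> A" "a \<notin> N" and acos: "\<And>e. e \<in> E \<Longrightarrow> e \<otimes> a \<otimes> inv e \<in> N #> a" by auto
  have cN: "e \<otimes> a \<otimes> inv e \<otimes> inv a \<in> N" if e: "e \<in> E" for e
  proof -
    obtain m where "m \<in> N" "e \<otimes> a \<otimes> inv e = m \<otimes> a" using acos[OF e] unfolding r_coset_def by auto
    moreover have "m \<in> carrier G" using \<open>m \<in> N\<close> unfolding N_def by auto
    ultimately show ?thesis using a(1) by (simp add: word_simps)
  qed
  define c where "c e = inv e \<otimes> a \<otimes> e \<otimes> inv a" for e
  have cN': "c e \<in> N" if e: "e \<in> E" for e
    using cN[of "inv e"] e subgroup.m_inv_closed[OF E'(1)] unfolding c_def by simp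
  \<comment> \<open>A conjugate of \<open>e\<close> under \<open>a\<close> differs from
    \<open>e\<close> by an element of \<open>N\<close>; hence all of \<open>E1\<close>, and then all
    of \<open>H\<close>, normalises \<open>E\<close>.\<close>
  have conj: "a \<otimes> e \<otimes> inv a = e \<otimes> c e" if "e \<in> E" for e
    using that a(1) unfolding c_def by (simp add: word_simps)
  define E1 where "E1 = (\<lambda>e. a \<otimes> e \<otimes> inv a) ` E"
  have E1sub: "subgroup E1 G"
  proof (rule subgroupI)
    show "E1 \<subseteq> carrier G" "E1 \<noteq> {}" using a(1) subgroup.one_closed[OF E'(1)] unfolding E1_def by auto
    show "inv x \<in> E1" if x: "x \<in> E1" for x
    proof -
      obtain e where e: "e \<in> E" "x = a \<otimes> e \<otimes> inv a" using x unfolding E1_def by auto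
      have "inv x = a \<otimes> inv e \<otimes> inv a" using e a(1) by (simp add: word_simps)
      then show ?thesis using e subgroup.m_inv_closed[OF E'(1)] unfolding E1_def by blast
    qed
    show "x \<otimes> y \<in> E1" if xy: "x \<in> E1" "y \<in> E1" for x y
    proof -
      obtain e f where e: "e \<in> E" "x = a \<otimes> e \<otimes> inv a" "f \<in> E" "y = a \<otimes> f \<otimes> inv a"
        using xy unfolding E1_def by auto
      have "x \<otimes> y = a \<otimes> (e \<otimes> f) \<otimes> inv a" using e a(1) by (simp add: word_simps)
      then show ?thesis using e subgroup.m_closed[OF E'(1)] unfolding E1_def by blast
    qed
  qed
  have E1card: "card E1 = card E"
    unfolding E1_def by (rule card_image) (use a(1) in \<open>auto simp: inj_on_def\<close>)
  have E1comm: "x \<otimes> y = y \<otimes> x" if xy: "x \<in> E1" "y \<in> E1" for x y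
  proof -
    obtain e f where e: "e \<in> E" "x = a \<otimes> e \<otimes> inv a" "f \<in> E" "y = a \<otimes> f \<otimes> inv a"
      using xy unfolding E1_def by auto
    have "x \<otimes> y = a \<otimes> (e \<otimes> f) \<otimes> inv a" using e a(1) by (simp add: word_simps)
    also have "\<dots> = a \<otimes> (f \<otimes> e) \<otimes> inv a" using E'(4) e by simp
    also have "\<dots> = y \<otimes> x" using e a(1) by (simp add: word_simps)
    finally show ?thesis .
  qed
  have nrm_E1: "nrm x" if x: "x \<in> E1" for x
  proof -
    obtain e where e: "e \<in> E" "x = e \<otimes> c e" using x conj unfolding E1_def by auto
    then show ?thesis using nrm_mult nrm_E cN' unfolding N_def by auto
  qed
  have finE1: "finite E1" using finE unfolding E1_def by simp
  define H where "H = E <#> E1"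
  have Hsub: "subgroup H G"
    unfolding H_def using set_mult_subgroup_of_normalizing[OF E'(1) E1sub] nrm_E1 unfolding nrm_def by blast
  have Hc [simp]: "x \<in> carrier G" if "x \<in> H" for x using that subgroup.mem_carrier[OF Hsub] by blast
  have nrm_H: "nrm x" if "x \<in> H" for x
    using that nrm_mult nrm_E nrm_E1 unfolding H_def by (auto elim!: set_mult_memE)
  have EH: "E \<subseteq> H" "E1 \<subseteq> H" unfolding H_def using subset_set_mult[OF E'(1) E1sub] by auto
  define Z where "Z = E \<inter> E1"
  have Zsub: "subgroup Z G" unfolding Z_def using subgroups_Inter_pair[OF E'(1) E1sub] .
  define B where "B = H \<inter> A"
  have Bsub: "subgroup B G" unfolding B_def using subgroups_Inter_pair[OF Hsub A'(1)] .
  have finB: "finite B" and finZ: "finite Z" unfolding B_def Z_def using finA finE by auto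
  \<comment> \<open>In \<open>x \<otimes> y\<close> with \<open>y = e \<otimes> c e\<close> the last
    factor lies in \<open>A\<close>, and also in \<open>H\<close> since the rest of the product
    does.\<close>
  have HEB: "H = E <#> B"
  proof
    show "H \<subseteq> E <#> B"
    proof
      fix h assume h: "h \<in> H"
      then obtain x y where xy: "x \<in> E" "y \<in> E1" "h = x \<otimes> y" unfolding H_def by (rule set_mult_memE)
      then obtain e where e: "e \<in> E" "y = e \<otimes> c e" using conj unfolding E1_def by auto
      have ceN: "c e \<in> N" using cN'[OF e(1)] .
      then have ce: "c e \<in> A" "c e \<in> carrier G" unfolding N_def by auto
      have hh: "h = (x \<otimes> e) \<otimes> c e" using xy e ce by (simp add: m_assoc)
      have xe: "x \<otimes> e \<in> E" using xy e subgroup.m_closed[OF E'(1)] by simp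
      have "c e = inv (x \<otimes> e) \<otimes> h" using hh xe ce by (simp add: word_simps)
      then have "c e \<in> H" using h xe EH subgroup.m_closed[OF Hsub] subgroup.m_inv_closed[OF Hsub] by auto
      then show "h \<in> E <#> B" using hh xe ce set_mult_memI unfolding B_def by auto
    qed
    show "E <#> B \<subseteq> H"
      using EH subgroup.m_closed[OF Hsub] unfolding B_def by (auto elim!: set_mult_memE)
  qed
  have EB: "E \<inter> B = E \<inter> A" unfolding B_def using EH by auto
  \<comment> \<open>As \<open>A\<close> is abelian, conjugation by \<open>a\<close> fixes
    \<open>E \<inter> A\<close>, which therefore lies in \<open>E1\<close> as well.\<close>
  have BZ: "B \<inter> Z = E \<inter> A"
  proof
    show "B \<inter> Z \<subseteq> E \<inter> A" unfolding B_def Z_def by auto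
    show "E \<inter> A \<subseteq> B \<inter> Z"
    proof
      fix z assume z: "z \<in> E \<inter> A"
      have "a \<otimes> z = z \<otimes> a" using z a(1) A'(4) by auto
      then have "a \<otimes> z \<otimes> inv a = z" using z a(1) by (simp add: word_simps)
      then have "z \<in> E1" using z unfolding E1_def by force
      then show "z \<in> B \<inter> Z" using z EH unfolding B_def Z_def by auto
    qed
  qed
  define F where "F = B <#> Z"
  have elB: "elem_abelian_sub G p S B"
    using Bsub A'(2,4,5) unfolding elem_abelian_sub_def B_def by auto
  have elZ: "elem_abelian_sub G p S Z"
    using Zsub E'(2,4,5) unfolding elem_abelian_sub_def Z_def by auto
  \<comment> \<open>\<open>Z\<close> is contained in both of the abelian groups \<open>E\<close> and
    \<open>E1\<close>, so it is central in their product \<open>H\<close>.\<close>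
  have BZcomm: "b \<otimes> z = z \<otimes> b" if b: "b \<in> B" and z: "z \<in> Z" for b z
  proof -
    obtain x y where xy: "x \<in> E" "y \<in> E1" "b = x \<otimes> y"
      using b unfolding B_def H_def by (auto elim!: set_mult_memE)
    have zc: "z \<in> E" "z \<in> E1" using z unfolding Z_def by auto
    have yc: "y \<in> carrier G" using xy EH by auto
    have "b \<otimes> z = x \<otimes> (y \<otimes> z)" using xy zc yc by (simp add: m_assoc)
    also have "\<dots> = (x \<otimes> z) \<otimes> y" using E1comm[OF xy(2) zc(2)] xy zc yc by (simp add: m_assoc)
    also have "\<dots> = z \<otimes> b" using E'(4)[OF xy(1) zc(1)] xy zc yc by (simp add: m_assoc)
    finally show ?thesis .
  qed
  have elF: "elem_abelian_sub G p S F"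
    unfolding F_def using elem_abelian_sub_mult[OF S(1) elB elZ BZcomm] .
  \<comment> \<open>The product formula is applied to \<open>E <#> E1\<close>, to
    \<open>E <#> B\<close>, which is the same group, and to \<open>B <#> Z\<close>.\<close>
  have cF: "card F = card E"
  proof -
    have c1: "card H * card Z = card E * card E"
      using card_set_mult_subgroups[OF E'(1) finE E1sub finE1] E1card unfolding H_def Z_def by simp
    have c2: "card H * card (E \<inter> A) = card E * card B"
      using card_set_mult_subgroups[OF E'(1) finE Bsub finB] HEB EB by simp
    have c3: "card F * card (E \<inter> A) = card B * card Z"
      using card_set_mult_subgroups[OF Bsub finB Zsub finZ] BZ unfolding F_def by simp
    have pos: "card E > 0" "card (E \<inter> A) > 0"
      using finE subgroup.one_closed[OF E'(1)] subgroup.one_closed[OF A'(1)] by (auto simp: card_gt_0_iff)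
    have "card F * (card (E \<inter> A) * card E) = card E * card B * card Z" using c3 by simp
    also have "\<dots> = card H * card Z * card (E \<inter> A)" using c2 by simp
    also have "\<dots> = card E * (card (E \<inter> A) * card E)" using c1 by simp
    finally show ?thesis using pos by simp
  qed
  have BF: "B \<subseteq> F \<inter> A" and ZF: "Z \<subseteq> F"
    unfolding F_def using subset_set_mult[OF Bsub Zsub] B_def by auto
  have "a \<notin> H" using a nrm_H unfolding N_def by auto
  \<comment> \<open>Equality would give \<open>H = E\<close>, hence \<open>E1 = E\<close>, and
    \<open>a\<close> would normalise \<open>E\<close>.\<close>
  have "E \<inter> A \<noteq> B"
  proof
    assume "E \<inter> A = B"
    then have "B \<subseteq> E" by auto
    then have "H \<subseteq> E" using HEB subgroup.m_closed[OF E'(1)] by (auto elim!: set_mult_memE)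
    then have E1E: "E1 = E" using EH(2) card_subset_eq[OF finE _ E1card] by simp
    have "nrm a" unfolding nrm_def
    proof (intro conjI ballI)
      show "a \<in> carrier G" using a(1) by simp
      fix e assume e: "e \<in> E"
      show "a \<otimes> e \<otimes> inv a \<in> E" using e E1E unfolding E1_def by blast
      have "e \<in> E1" using e E1E by simp
      then obtain f where f: "f \<in> E" "e = a \<otimes> f \<otimes> inv a" unfolding E1_def by auto
      then show "inv a \<otimes> e \<otimes> a \<in> E" using a(1) by (simp add: word_simps)
    qed
    then show False using a unfolding N_def by simp
  qed
  then have "E \<inter> A \<subset> F \<inter> A" using BF EB by blast
  then have lt: "card (E \<inter> A) < card (F \<inter> A)" using finA psubset_card_mono[of "F \<inter> A"] by blast
  \<comment> \<open>Otherwise \<open>A <#> F\<close> would be elementary abelian, and maximality of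
    the order would force \<open>a\<close> into \<open>F\<close>, which lies in
    \<open>H\<close>.\<close>
  have "\<not> F \<subseteq> centralizer_in G S A"
  proof
    assume FC: "F \<subseteq> centralizer_in G S A"
    have comm: "x \<otimes> f = f \<otimes> x" if "x \<in> A" "f \<in> F" for x f
      using FC that unfolding centralizer_in_def by force
    have "card (A <#> F) \<le> card F"
      using max[OF elem_abelian_sub_mult[OF S(1) A elF comm]] cF by simp
    moreover note AF = subset_set_mult[OF A'(1) elem_abelian_subD(1)[OF elF]]
    moreover have "finite (A <#> F)"
      using finite_subset[OF elem_abelian_subD(3)[OF elem_abelian_sub_mult[OF S(1) A elF comm]] fin] .
    ultimately have "F = A <#> F" using card_seteq by blast
    then have "a \<in> F" using AF(1) a(1) by auto
    then obtain b z where bz: "b \<in> B" "z \<in> Z" "a = b \<otimes> z" unfolding F_def by (rule set_mult_memE)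
    then have "a \<in> H" using EH subgroup.m_closed[OF Hsub] unfolding B_def Z_def by auto
    then show False using \<open>a \<notin> H\<close> by simp
  qed
  then show ?thesis using elF cF lt by blast
qed

lemma centralizer_in_subgroup:
  assumes S: "subgroup S G" and A: "A \<subseteq> carrier G"
  shows "subgroup (centralizer_in G S A) G"
proof (rule subgroupI)
  show "centralizer_in G S A \<subseteq> carrier G"
    using subgroup.subset[OF S] unfolding centralizer_in_def by auto
  have "\<one> \<in> centralizer_in G S A"
    using subgroup.one_closed[OF S] A unfolding centralizer_in_def by auto
  then show "centralizer_in G S A \<noteq> {}" by blast
  fix x assume x: "x \<in> centralizer_in G S A"
  then have xS: "x \<in> S" "x \<in> carrier G" and xc: "\<And>y. y \<in> A \<Longrightarrow> x \<otimes> y = y \<otimes> x"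
    using subgroup.subset[OF S] unfolding centralizer_in_def by auto
  have "inv x \<otimes> y = y \<otimes> inv x" if "y \<in> A" for y
  proof -
    have yc: "y \<in> carrier G" using that A by blast
    have "inv x \<otimes> (x \<otimes> y) \<otimes> inv x = inv x \<otimes> (y \<otimes> x) \<otimes> inv x" using xc[OF that] by simp
    then show ?thesis using xS yc by (simp add: word_simps)
  qed
  then show "inv x \<in> centralizer_in G S A"
    using xS subgroup.m_inv_closed[OF S] unfolding centralizer_in_def by auto
  fix z assume z: "z \<in> centralizer_in G S A"
  then have zS: "z \<in> S" "z \<in> carrier G" and zc: "\<And>y. y \<in> A \<Longrightarrow> z \<otimes> y = y \<otimes> z"
    using subgroup.subset[OF S] unfolding centralizer_in_def by auto
  have "x \<otimes> z \<otimes> y = y \<otimes> (x \<otimes> z)" if y: "y \<in> A" for y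
  proof -
    have yc: "y \<in> carrier G" using y A by blast
    have "x \<otimes> z \<otimes> y = x \<otimes> y \<otimes> z" using zc[OF y] xS zS yc by (simp add: m_assoc)
    then show ?thesis using xc[OF y] xS zS yc by (simp add: m_assoc)
  qed
  then show "x \<otimes> z \<in> centralizer_in G S A"
    using xS zS subgroup.m_closed[OF S] unfolding centralizer_in_def by auto
qed

text \<open>Among the elementary abelian subgroups of largest order that do not centralise
  \<open>A\<close>, take one whose intersection with \<open>A\<close> is largest. Replacement cannot
  improve it, so \<open>A\<close> normalises it, and then its elements commute with their own
  commutators with \<open>A\<close>. The inner premise of \<open>noquad\<close> is
  \<open>[A, g, g] = 1\<close>, stated as commutation.\<close>

lemma thompson_subgroup_le_centralizer:
  fixes p :: nat
  assumes fin: "finite (carrier G)" and p: "Factorial_Ring.prime p"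
    and S: "subgroup S G" "card S = p ^ k"
    and A: "elem_abelian_sub G p S A"
    and An: "\<And>s a. s \<in> S \<Longrightarrow> a \<in> A \<Longrightarrow> s \<otimes> a \<otimes> inv s \<in> A"
    and noquad: "\<And>g. g \<in> S \<Longrightarrow>
      (\<And>a. a \<in> A \<Longrightarrow> g \<otimes> (inv a \<otimes> (g \<otimes> a \<otimes> inv g)) = (inv a \<otimes> (g \<otimes> a \<otimes> inv g)) \<otimes> g) \<Longrightarrow>
      g \<in> centralizer_in G S A"
  shows "thompson_subgroup G p S \<subseteq> centralizer_in G S A"
proof -
  note A' = elem_abelian_subD[OF A]
  define \<A> where "\<A> = {E. elem_abelian_sub G p S E \<and> (\<forall>F. elem_abelian_sub G p S F \<longrightarrow> card F \<le> card E)}"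
  have main: "E \<subseteq> centralizer_in G S A" if "E \<in> \<A>" for E
  proof (rule ccontr)
    assume "\<not> E \<subseteq> centralizer_in G S A"
    define \<B> where "\<B> = {E \<in> \<A>. \<not> E \<subseteq> centralizer_in G S A}"
    have "\<B> \<subseteq> Pow (carrier G)" unfolding \<B>_def \<A>_def using elem_abelian_subD(3) by blast
    then have "finite \<B>" using fin finite_subset by blast
    moreover have "\<B> \<noteq> {}" using that \<open>\<not> E \<subseteq> _\<close> unfolding \<B>_def by auto
    ultimately have "\<exists>D\<in>\<B>. \<forall>F\<in>\<B>. card (F \<inter> A) \<le> card (D \<inter> A)"
      using Max_in[of "(\<lambda>F. card (F \<inter> A)) ` \<B>"] Max_ge[of "(\<lambda>F. card (F \<inter> A)) ` \<B>"] by fastforce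
    then obtain D where D: "D \<in> \<B>" "\<And>F. F \<in> \<B> \<Longrightarrow> card (F \<inter> A) \<le> card (D \<inter> A)"
      by blast
    have Del: "elem_abelian_sub G p S D" and Dmax: "\<And>F. elem_abelian_sub G p S F \<Longrightarrow> card F \<le> card D"
      and DC: "\<not> D \<subseteq> centralizer_in G S A"
      using D(1) unfolding \<B>_def \<A>_def by auto
    note D' = elem_abelian_subD[OF Del]
    show False
    proof (cases "\<forall>a\<in>A. \<forall>e\<in>D. inv a \<otimes> e \<otimes> a \<in> D")
      case True
      have "D \<subseteq> centralizer_in G S A"
      proof
        fix g assume g: "g \<in> D"
        show "g \<in> centralizer_in G S A"
        proof (rule noquad)
          show "g \<in> S" using g D'(2) by blast
          fix a assume a: "a \<in> A"
          have c: "a \<in> carrier G" "g \<in> carrier G" using a g A'(3) D'(3) by auto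
          have "(inv a \<otimes> g \<otimes> a) \<otimes> inv g \<in> D"
            using True a g subgroup.m_closed[OF D'(1)] subgroup.m_inv_closed[OF D'(1)] by blast
          moreover have "(inv a \<otimes> g \<otimes> a) \<otimes> inv g = inv a \<otimes> (g \<otimes> a \<otimes> inv g)"
            using c by (simp add: m_assoc)
          ultimately show "g \<otimes> (inv a \<otimes> (g \<otimes> a \<otimes> inv g)) = (inv a \<otimes> (g \<otimes> a \<otimes> inv g)) \<otimes> g"
            using D'(4) g by simp
        qed
      qed
      then show False using DC by simp
    next
      case False
      then obtain a e where "a \<in> A" "e \<in> D" "inv a \<otimes> e \<otimes> a \<notin> D" by blast
      then obtain F where F: "elem_abelian_sub G p S F" "card F = card D"
        "card (D \<inter> A) < card (F \<inter> A)" "\<not> F \<subseteq> centralizer_in G S A"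
        using thompson_replacement[OF fin p S A An Del Dmax] by blast
      then have "F \<in> \<B>" using Dmax unfolding \<B>_def \<A>_def by auto
      then show False using D(2) F(3) by fastforce
    qed
  qed
  have "subgroup (centralizer_in G S A) G" using centralizer_in_subgroup[OF S(1) A'(3)] .
  moreover have "\<Union>{E. elem_abelian_sub G p S E \<and> elab_rank p E = p_rank G p S} \<subseteq> centralizer_in G S A"
    using main p_rank_maximal[OF fin p S] unfolding \<A>_def by blast
  ultimately show ?thesis unfolding thompson_subgroup_def using generate_subgroup_incl by blast
qed

end

section \<open>The Oliver subgroup\<close>

context group
begin

lemma centralizer_in_normalized:
  assumes S: "subgroup S G" and Q: "subgroup Q G"
    and norm: "\<And>s k. s \<in> S \<Longrightarrow> k \<in> Q \<Longrightarrow> s \<otimes> k \<otimes> inv s \<in> Q"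
    and s: "s \<in> S" and x: "x \<in> centralizer_in G S Q"
  shows "s \<otimes> x \<otimes> inv s \<in> centralizer_in G S Q"
proof -
  have xS: "x \<in> S" and xc: "\<And>y. y \<in> Q \<Longrightarrow> x \<otimes> y = y \<otimes> x"
    using x unfolding centralizer_in_def by auto
  have c: "s \<in> carrier G" "x \<in> carrier G" using s xS subgroup.mem_carrier[OF S] by auto
  have "s \<otimes> x \<otimes> inv s \<otimes> y = y \<otimes> (s \<otimes> x \<otimes> inv s)" if y: "y \<in> Q" for y
  proof -
    have yc: "y \<in> carrier G" using y subgroup.mem_carrier[OF Q] by auto
    have "inv s \<otimes> y \<otimes> inv (inv s) \<in> Q" using norm subgroup.m_inv_closed[OF S s] y by blast
    then have "x \<otimes> (inv s \<otimes> y \<otimes> s) = (inv s \<otimes> y \<otimes> s) \<otimes> x" using xc c by simp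
    then have "s \<otimes> (x \<otimes> (inv s \<otimes> y \<otimes> s)) \<otimes> inv s = s \<otimes> ((inv s \<otimes> y \<otimes> s) \<otimes> x) \<otimes> inv s" by simp
    then show ?thesis using c yc by (simp add: word_simps)
  qed
  then show ?thesis
    using s xS subgroup.m_closed[OF S] subgroup.m_inv_closed[OF S] unfolding centralizer_in_def by auto
qed

lemma comm_sub_subset:
  assumes "subgroup H G" "\<And>a b. a \<in> A \<Longrightarrow> b \<in> B \<Longrightarrow> commutator G a b \<in> H"
  shows "comm_sub G A B \<subseteq> H"
  unfolding comm_sub_def using assms by (intro generate_subgroup_incl) auto

lemma comm_sub_mono:
  assumes "A \<subseteq> A'" "B \<subseteq> B'"
  shows "comm_sub G A B \<subseteq> comm_sub G A' B'"
  unfolding comm_sub_def using assms by (intro mono_generate) auto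

lemma iter_comm_mono:
  assumes "A \<subseteq> A'" "B \<subseteq> B'"
  shows "iter_comm G A B k \<subseteq> iter_comm G A' B' k"
  using assms by (induction k) (simp_all add: comm_sub_mono)

lemma iter_comm_Suc_eq_one:
  assumes "iter_comm G A B (Suc k) \<subseteq> {\<one>}"
  shows "iter_comm G A B (Suc k) = {\<one>}"
  using assms generate.one[of G] unfolding iter_comm.simps comm_sub_def by blast

lemma iter_comm_trivial_mono:
  assumes B: "B \<subseteq> carrier G" and k: "iter_comm G A B k \<subseteq> {\<one>}" "k \<le> l"
  shows "iter_comm G A B l \<subseteq> {\<one>}"
  using k(2)
proof (induction l rule: dec_induct)
  case base
  then show ?case using k(1) .
next
  case (step l)
  have "commutator G a b \<in> {\<one>}" if "a \<in> iter_comm G A B l" "b \<in> B" for a b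
  proof -
    have "a = \<one>" "b \<in> carrier G" using that step.IH B by auto
    then show ?thesis unfolding commutator_def by simp
  qed
  then show ?case using comm_sub_subset[OF triv_subgroup] by simp
qed

lemma Omega1_subset:
  assumes "subgroup H G"
  shows "Omega1 G p H \<subseteq> H"
  unfolding Omega1_def using assms by (intro generate_subgroup_incl) auto

lemma Omega1_mono: "H \<subseteq> K \<Longrightarrow> Omega1 G p H \<subseteq> Omega1 G p K"
  unfolding Omega1_def by (intro mono_generate) auto

lemma commutator_in_normalized:
  assumes S: "subgroup S G" and N: "subgroup N G" "N \<subseteq> S"
    and norm: "\<And>s k. s \<in> S \<Longrightarrow> k \<in> N \<Longrightarrow> s \<otimes> k \<otimes> inv s \<in> N"
    and x: "x \<in> S" and y: "y \<in> N"
  shows "commutator G x y \<in> N" "commutator G y x \<in> N"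
proof -
  have c: "x \<in> carrier G" "y \<in> carrier G" using x y N(2) subgroup.mem_carrier[OF S] by auto
  have xi: "inv x \<in> S" using x subgroup.m_inv_closed[OF S] by blast
  have yi: "inv y \<in> N" using y subgroup.m_inv_closed[OF N(1)] by blast
  have "(inv x \<otimes> inv y \<otimes> inv (inv x)) \<otimes> y \<in> N" "inv y \<otimes> (inv x \<otimes> y \<otimes> inv (inv x)) \<in> N"
    using norm[OF xi yi] norm[OF xi y] y yi subgroup.m_closed[OF N(1)] by blast+
  then show "commutator G x y \<in> N" "commutator G y x \<in> N"
    using c unfolding commutator_def by (simp_all add: word_simps)
qed

section \<open>Construction of Q-series and existence of the largest one\<close>

lemma has_Q_series_normal:
  assumes "has_Q_series G p S K"
  shows "K \<lhd> G\<lparr>carrier := S\<rparr>"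
  using assms[unfolded has_Q_series_def] by (elim exE) auto

lemma has_Q_series_one:
  assumes S: "subgroup S G"
  shows "has_Q_series G p S {\<one>}"
proof -
  have "{\<one>} \<lhd> G\<lparr>carrier := S\<rparr>"
    unfolding normal_in_subgroup_iff[OF S]
    using triv_subgroup subgroup.one_closed[OF S] subgroup.mem_carrier[OF S] by auto
  then show ?thesis
    unfolding has_Q_series_def by (intro exI[of _ "\<lambda>_. {\<one>}"] exI[of _ "0::nat"]) simp
qed

lemma has_Q_series_extend:
  assumes p: "p \<ge> 2" and K: "has_Q_series G p S K" and Y: "Y \<lhd> G\<lparr>carrier := S\<rparr>" "K \<subseteq> Y"
    and step: "iter_comm G (Omega1 G p (centralizer_in G S K)) Y (p - 1) \<subseteq> {\<one>}"
  shows "has_Q_series G p S Y"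
proof -
  from K[unfolded has_Q_series_def] obtain Q k where
    Q0: "Q 0 = {\<one>} \<and> Q k = K \<and> (\<forall>i\<le>k. Q i \<lhd> G\<lparr>carrier := S\<rparr>) \<and> (\<forall>i<k. Q i \<subseteq> Q (Suc i)) \<and>
      (\<forall>i. 1 \<le> i \<and> i \<le> k \<longrightarrow>
        iter_comm G (Omega1 G p (centralizer_in G S (Q (i - 1)))) (Q i) (p - 1) = {\<one>})"
    by (elim exE)
  have Q: "Q 0 = {\<one>}" "Q k = K" "\<And>i. i \<le> k \<Longrightarrow> Q i \<lhd> G\<lparr>carrier := S\<rparr>"
    "\<And>i. i < k \<Longrightarrow> Q i \<subseteq> Q (Suc i)"
    "\<And>i. 1 \<le> i \<Longrightarrow> i \<le> k \<Longrightarrow> iter_comm G (Omega1 G p (centralizer_in G S (Q (i - 1)))) (Q i) (p - 1) = {\<one>}"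
    using Q0 by simp_all
  \<comment> \<open>\<open>p - 1\<close> is a successor, so the last iterated commutator is a
    generated subgroup and contains the identity.\<close>
  have step': "iter_comm G (Omega1 G p (centralizer_in G S K)) Y (p - 1) = {\<one>}"
    using iter_comm_Suc_eq_one[of _ _ "p - 2"] step p by (simp add: numeral_2_eq_2 Suc_diff_Suc)
  define R where "R = Q(Suc k := Y)"
  have RQ: "R i = Q i" if "i \<le> k" for i using that unfolding R_def by simp
  have RY: "R (Suc k) = Y" unfolding R_def by simp
  have R3: "R i \<lhd> G\<lparr>carrier := S\<rparr>" if "i \<le> Suc k" for i
    using that Q(3) Y(1) RQ RY by (cases "i = Suc k") simp_all
  have R4: "R i \<subseteq> R (Suc i)" if "i < Suc k" for i
    using that Q(2,4) Y(2) RQ RY by (cases "i = k") simp_all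
  have R5: "iter_comm G (Omega1 G p (centralizer_in G S (R (i - 1)))) (R i) (p - 1) = {\<one>}"
    if "1 \<le> i" "i \<le> Suc k" for i
  proof (cases "i = Suc k")
    case True
    then show ?thesis using step' Q(2) RQ RY by simp
  next
    case False
    then have "i \<le> k" "i - 1 \<le> k" using that by simp_all
    then show ?thesis using that(1) Q(5)[of i] RQ by simp
  qed
  show ?thesis
    unfolding has_Q_series_def
  proof (intro exI[of _ R] exI[of _ "Suc k"] conjI allI impI)
    show "R 0 = {\<one>}" using Q(1) RQ by simp
    show "R (Suc k) = Y" by (rule RY)
  qed (use R3 R4 R5 in simp_all)
qed

text \<open>If \<open>a\<close> commutes with \<open>k\<close>, the commutator of \<open>a\<close>
  with \<open>k \<otimes> r\<close> equals that of \<open>a\<close> with \<open>r\<close>. Normality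
  of \<open>C\<close> keeps all iterated commutators in \<open>C\<close>, so the factor
  \<open>K\<close> drops out at every stage.\<close>

lemma iter_comm_set_mult_centralized:
  assumes S: "subgroup S G" and C: "subgroup C G" "C \<subseteq> S" "\<And>s x. s \<in> S \<Longrightarrow> x \<in> C \<Longrightarrow> s \<otimes> x \<otimes> inv s \<in> C"
    and W: "W \<subseteq> C" and K: "K \<subseteq> S" and R: "R \<subseteq> S"
    and comm: "\<And>x k. x \<in> C \<Longrightarrow> k \<in> K \<Longrightarrow> x \<otimes> k = k \<otimes> x"
  shows "iter_comm G W (K <#> R) j \<subseteq> iter_comm G W R j \<inter> C"
proof (induction j)
  case 0
  then show ?case using W by simp
next
  case (Suc j)
  have eq: "commutator G a (k \<otimes> r) = commutator G a r" if a: "a \<in> C" and k: "k \<in> K" and r: "r \<in> R" for a k r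
  proof -
    have c: "a \<in> carrier G" "k \<in> carrier G" "r \<in> carrier G"
      using a k r C K R subgroup.mem_carrier[OF S] by blast+
    have "inv k \<otimes> (a \<otimes> k) = inv k \<otimes> (k \<otimes> a)" using comm[OF a k] by simp
    then have "inv k \<otimes> (a \<otimes> k) = a" using c by (simp add: word_simps)
    moreover have "commutator G a (k \<otimes> r) = inv a \<otimes> inv r \<otimes> (inv k \<otimes> (a \<otimes> k)) \<otimes> r"
      unfolding commutator_def using c by (simp add: word_simps)
    ultimately show ?thesis unfolding commutator_def by simp
  qed
  have "comm_sub G (iter_comm G W (K <#> R) j) (K <#> R) \<subseteq> comm_sub G (iter_comm G W R j) R"
    unfolding comm_sub_def
  proof (intro mono_generate subsetI)
    fix c assume "c \<in> {c. \<exists>a\<in>iter_comm G W (K <#> R) j. \<exists>b\<in>K <#> R. c = commutator G a b}"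
    then obtain a b where ab: "a \<in> iter_comm G W (K <#> R) j" "b \<in> K <#> R" "c = commutator G a b" by blast
    obtain k r where kr: "k \<in> K" "r \<in> R" "b = k \<otimes> r" using ab(2) by (rule set_mult_memE)
    have "a \<in> C" "a \<in> iter_comm G W R j" using ab(1) Suc.IH by auto
    then show "c \<in> {c. \<exists>a\<in>iter_comm G W R j. \<exists>b\<in>R. c = commutator G a b}"
      using eq kr ab(3) by auto
  qed
  moreover have "comm_sub G (iter_comm G W (K <#> R) j) (K <#> R) \<subseteq> C"
  proof (rule comm_sub_subset[OF C(1)])
    fix a b assume a: "a \<in> iter_comm G W (K <#> R) j" and b: "b \<in> K <#> R"
    have "b \<in> S" using b K R subgroup.m_closed[OF S] by (auto elim!: set_mult_memE)
    moreover have "a \<in> C" using a Suc.IH by auto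
    ultimately show "commutator G a b \<in> C"
      using commutator_in_normalized(2)[OF S C] by blast
  qed
  ultimately show ?case by simp
qed

text \<open>The series of \<open>K\<close> is continued by the products \<open>K <#> Q i\<close>.
  Whatever centralises such a product centralises \<open>K\<close>, so only the factor
  \<open>Q (Suc i)\<close> contributes to commutators; it also centralises \<open>Q i\<close>, so
  the required vanishing is inherited from the series of \<open>R\<close>.\<close>

lemma has_Q_series_mult:
  assumes S: "subgroup S G" and p: "p \<ge> 2" and K: "has_Q_series G p S K" and R: "has_Q_series G p S R"
  shows "has_Q_series G p S (K <#> R)"
proof -
  from R[unfolded has_Q_series_def] obtain Q k where
    Q0: "Q 0 = {\<one>} \<and> Q k = R \<and> (\<forall>i\<le>k. Q i \<lhd> G\<lparr>carrier := S\<rparr>) \<and> (\<forall>i<k. Q i \<subseteq> Q (Suc i)) \<and>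
      (\<forall>i. 1 \<le> i \<and> i \<le> k \<longrightarrow>
        iter_comm G (Omega1 G p (centralizer_in G S (Q (i - 1)))) (Q i) (p - 1) = {\<one>})"
    by (elim exE)
  have Q: "Q 0 = {\<one>}" "Q k = R" "\<And>i. i \<le> k \<Longrightarrow> Q i \<lhd> G\<lparr>carrier := S\<rparr>"
    "\<And>i. i < k \<Longrightarrow> Q i \<subseteq> Q (Suc i)"
    "\<And>i. 1 \<le> i \<Longrightarrow> i \<le> k \<Longrightarrow> iter_comm G (Omega1 G p (centralizer_in G S (Q (i - 1)))) (Q i) (p - 1) = {\<one>}"
    using Q0 by simp_all
  have Kn: "subgroup K G" "K \<subseteq> S" "\<And>s k. s \<in> S \<Longrightarrow> k \<in> K \<Longrightarrow> s \<otimes> k \<otimes> inv s \<in> K"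
    using has_Q_series_normal[OF K] normal_in_subgroup_iff[OF S] by auto
  have Qn: "subgroup (Q i) G" "Q i \<subseteq> S" "\<And>s k. s \<in> S \<Longrightarrow> k \<in> Q i \<Longrightarrow> s \<otimes> k \<otimes> inv s \<in> Q i"
    if "i \<le> k" for i
    using Q(3)[OF that] normal_in_subgroup_iff[OF S] by auto
  have Sc: "x \<in> carrier G" if "x \<in> S" for x using that subgroup.mem_carrier[OF S] by blast
  have KQ: "subgroup (K <#> Q i) G" "K <#> Q i \<subseteq> S"
    "\<And>s x. s \<in> S \<Longrightarrow> x \<in> K <#> Q i \<Longrightarrow> s \<otimes> x \<otimes> inv s \<in> K <#> Q i" if i: "i \<le> k" for i
  proof -
    show "subgroup (K <#> Q i) G"
    proof (rule set_mult_subgroup_of_normalizing[OF Kn(1) Qn(1)[OF i]])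
      fix a b assume "a \<in> Q i" "b \<in> K"
      then show "a \<otimes> b \<otimes> inv a \<in> K" using Kn(3) Qn(2)[OF i] by blast
    qed
    show "K <#> Q i \<subseteq> S"
      using Kn(2) Qn(2)[OF i] subgroup.m_closed[OF S] by (auto elim!: set_mult_memE)
    fix s x assume s: "s \<in> S" and "x \<in> K <#> Q i"
    then obtain a b where ab: "a \<in> K" "b \<in> Q i" "x = a \<otimes> b" by (auto elim!: set_mult_memE)
    have c: "s \<in> carrier G" "a \<in> carrier G" "b \<in> carrier G" using s ab Kn(2) Qn(2)[OF i] Sc by auto
    have "s \<otimes> x \<otimes> inv s = (s \<otimes> a \<otimes> inv s) \<otimes> (s \<otimes> b \<otimes> inv s)" using c ab(3) by (simp add: word_simps)
    then show "s \<otimes> x \<otimes> inv s \<in> K <#> Q i"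
      using set_mult_memI[OF Kn(3)[OF s ab(1)] Qn(3)[OF i s ab(2)]] by simp
  qed
  have "has_Q_series G p S (K <#> Q i)" if "i \<le> k" for i
    using that
  proof (induction i)
    case 0
    have "K <#> {\<one>} = K"
      using Kn(2) Sc unfolding set_mult_def by force
    then show ?case using K Q(1) by simp
  next
    case (Suc i)
    let ?C = "centralizer_in G S (K <#> Q i)"
    have i: "i \<le> k" using Suc.prems by simp
    have Csub: "subgroup ?C G" using centralizer_in_subgroup[OF S] KQ(1)[OF i] subgroup.subset by blast
    show ?case
    proof (rule has_Q_series_extend[OF p Suc.IH[OF i]])
      show "K <#> Q (Suc i) \<lhd> G\<lparr>carrier := S\<rparr>"
        using KQ[OF Suc.prems] normal_in_subgroup_iff[OF S] by blast
      show "K <#> Q i \<subseteq> K <#> Q (Suc i)"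
        using Q(4)[of i] Suc.prems by (auto elim!: set_mult_memE intro!: set_mult_memI)
      have "iter_comm G (Omega1 G p ?C) (K <#> Q (Suc i)) (p - 1) \<subseteq> iter_comm G (Omega1 G p ?C) (Q (Suc i)) (p - 1)"
      proof -
        have "?C \<subseteq> S" unfolding centralizer_in_def by auto
        moreover have "x \<otimes> a = a \<otimes> x" if "x \<in> ?C" "a \<in> K" for x a
          using that subset_set_mult(1)[OF Kn(1) Qn(1)[OF i]] unfolding centralizer_in_def by blast
        ultimately show ?thesis
          using iter_comm_set_mult_centralized[OF S Csub _ _ Omega1_subset[OF Csub] Kn(2) Qn(2)[OF Suc.prems]]
            centralizer_in_normalized[OF S KQ(1,3)[OF i]] by blast
      qed
      also have "\<dots> \<subseteq> iter_comm G (Omega1 G p (centralizer_in G S (Q i))) (Q (Suc i)) (p - 1)"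
      proof (intro iter_comm_mono Omega1_mono)
        show "?C \<subseteq> centralizer_in G S (Q i)"
          using subset_set_mult(2)[OF Kn(1) Qn(1)[OF i]] unfolding centralizer_in_def by blast
      qed simp
      also have "\<dots> \<subseteq> {\<one>}" using Q(5)[of "Suc i"] Suc.prems by simp
      finally show "iter_comm G (Omega1 G p ?C) (K <#> Q (Suc i)) (p - 1) \<subseteq> {\<one>}" .
    qed
  qed
  then show ?thesis using Q(2) by blast
qed

text \<open>Closure under products turns a member of maximal order into a greatest member, which
  makes the \<open>THE\<close> in the definition meaningful.\<close>

lemma oliver_subgroup_greatest:
  assumes fin: "finite (carrier G)" and S: "subgroup S G" and p: "p \<ge> 2"
  shows "has_Q_series G p S (oliver_subgroup G p S)"
    and "\<And>K. has_Q_series G p S K \<Longrightarrow> K \<subseteq> oliver_subgroup G p S"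
proof -
  define \<K> where "\<K> = {K. has_Q_series G p S K}"
  have sub: "subgroup K G" if "K \<in> \<K>" for K
    using that has_Q_series_normal normal_in_subgroup_iff[OF S] unfolding \<K>_def by blast
  have "\<K> \<subseteq> Pow (carrier G)" using sub subgroup.subset by blast
  then have "finite \<K>" using fin finite_subset by blast
  moreover have "\<K> \<noteq> {}" using has_Q_series_one[OF S] unfolding \<K>_def by blast
  ultimately obtain Xo where Xo: "Xo \<in> \<K>" "\<And>K. K \<in> \<K> \<Longrightarrow> card K \<le> card Xo"
    using obtains_MAX[of \<K> card] by (metis Max_ge finite_imageI imageI)
  have greatest: "K \<subseteq> Xo" if K: "K \<in> \<K>" for K
  proof -
    have XK: "Xo <#> K \<in> \<K>" using has_Q_series_mult[OF S p] Xo(1) K unfolding \<K>_def by blast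
    have "finite (Xo <#> K)" using sub[OF XK] subgroup.subset fin finite_subset by blast
    then have "Xo = Xo <#> K"
      using subset_set_mult(1)[OF sub[OF Xo(1)] sub[OF K]] Xo(2)[OF XK] card_seteq by blast
    then show ?thesis using subset_set_mult(2)[OF sub[OF Xo(1)] sub[OF K]] by simp
  qed
  have "oliver_subgroup G p S = Xo"
    unfolding oliver_subgroup_def
  proof (rule the_equality)
    show "Xo \<lhd> G\<lparr>carrier := S\<rparr> \<and> has_Q_series G p S Xo \<and>
      (\<forall>K'. K' \<lhd> G\<lparr>carrier := S\<rparr> \<and> has_Q_series G p S K' \<longrightarrow> K' \<subseteq> Xo)"
      using Xo(1) greatest has_Q_series_normal unfolding \<K>_def by blast
    fix K assume "K \<lhd> G\<lparr>carrier := S\<rparr> \<and> has_Q_series G p S K \<and>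
      (\<forall>K'. K' \<lhd> G\<lparr>carrier := S\<rparr> \<and> has_Q_series G p S K' \<longrightarrow> K' \<subseteq> K)"
    then show "K = Xo" using Xo(1) greatest has_Q_series_normal unfolding \<K>_def by blast
  qed
  then show "has_Q_series G p S (oliver_subgroup G p S)"
    "\<And>K. has_Q_series G p S K \<Longrightarrow> K \<subseteq> oliver_subgroup G p S"
    using Xo(1) greatest unfolding \<K>_def by auto
qed

text \<open>A series with the single step from 1 to \<open>Q\<close>: the centraliser of the trivial
  group is all of \<open>S\<close>.\<close>

lemma oliver_subgroup_contains:
  assumes fin: "finite (carrier G)" and S: "subgroup S G" and p: "p \<ge> 2"
    and Q: "subgroup Q G" "Q \<subseteq> S" "\<And>s k. s \<in> S \<Longrightarrow> k \<in> Q \<Longrightarrow> s \<otimes> k \<otimes> inv s \<in> Q"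
    and step: "iter_comm G S Q (p - 1) \<subseteq> {\<one>}"
  shows "Q \<subseteq> oliver_subgroup G p S"
proof (rule oliver_subgroup_greatest(2)[OF fin S p], rule has_Q_series_extend[OF p has_Q_series_one[OF S]])
  show "Q \<lhd> G\<lparr>carrier := S\<rparr>" using Q normal_in_subgroup_iff[OF S] by blast
  show "{\<one>} \<subseteq> Q" using subgroup.one_closed[OF Q(1)] by blast
  have "subgroup (centralizer_in G S {\<one>}) G" using centralizer_in_subgroup[OF S] by simp
  then have "Omega1 G p (centralizer_in G S {\<one>}) \<subseteq> S"
    using Omega1_subset unfolding centralizer_in_def by fast
  then show "iter_comm G (Omega1 G p (centralizer_in G S {\<one>})) Q (p - 1) \<subseteq> {\<one>}"
    using iter_comm_mono[of _ S Q Q "p - 1"] step by blast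
qed

lemma oliver_subgroup_normal:
  assumes fin: "finite (carrier G)" and S: "subgroup S G" and p: "p \<ge> 2"
  shows "subgroup (oliver_subgroup G p S) G" "oliver_subgroup G p S \<subseteq> S"
    "\<And>s k. s \<in> S \<Longrightarrow> k \<in> oliver_subgroup G p S \<Longrightarrow> s \<otimes> k \<otimes> inv s \<in> oliver_subgroup G p S"
  using has_Q_series_normal[OF oliver_subgroup_greatest(1)[OF fin S p]] normal_in_subgroup_iff[OF S] by auto

text \<open>If the centraliser were not contained in it, a fixed coset of \<open>S\<close> there
  would enlarge the Oliver subgroup. The enlarged group has a Q-series because two commutators
  already vanish and \<open>p - 1\<close> is at least 2.\<close>

lemma oliver_subgroup_centric:
  fixes p :: nat
  assumes fin: "finite (carrier G)" and p: "Factorial_Ring.prime p" "p \<ge> 3"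
    and S: "subgroup S G" "card S = p ^ k"
  shows "centralizer_in G S (oliver_subgroup G p S) \<subseteq> oliver_subgroup G p S"
proof (rule ccontr)
  define Xo where "Xo = oliver_subgroup G p S"
  define C where "C = centralizer_in G S Xo"
  have p2: "p \<ge> 2" using p by simp
  have Xo: "subgroup Xo G" "Xo \<subseteq> S" "\<And>s k. s \<in> S \<Longrightarrow> k \<in> Xo \<Longrightarrow> s \<otimes> k \<otimes> inv s \<in> Xo"
    unfolding Xo_def using oliver_subgroup_normal[OF fin S(1) p2] by auto
  have C: "subgroup C G" "C \<subseteq> S" "\<And>s x. s \<in> S \<Longrightarrow> x \<in> C \<Longrightarrow> s \<otimes> x \<otimes> inv s \<in> C"
    unfolding C_def using centralizer_in_subgroup[OF S(1) subgroup.subset[OF Xo(1)]]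
      centralizer_in_normalized[OF S(1) Xo(1,3)] by (auto simp: centralizer_in_def)
  have CX: "c \<otimes> x = x \<otimes> c" if "c \<in> C" "x \<in> Xo" for c x
    using that unfolding C_def centralizer_in_def by auto
  have Sc [simp]: "x \<in> carrier G" if "x \<in> S" for x using that subgroup.mem_carrier[OF S(1)] by blast
  have Cc [simp]: "x \<in> carrier G" if "x \<in> C" for x using that C(2) by auto
  have Xc [simp]: "x \<in> carrier G" if "x \<in> Xo" for x using that Xo(2) by auto
  assume "\<not> ?thesis"
  then have nC: "\<not> C \<subseteq> Xo" unfolding C_def Xo_def .
  \<comment> \<open>\<open>S\<close> acts by conjugation on \<open>C\<close> and preserves the
    proper subgroup \<open>C \<inter> Xo\<close>.\<close>
  have "\<exists>c\<in>C - Xo. \<forall>s\<in>S. s \<otimes> c \<otimes> inv s \<in> (C \<inter> Xo) #> c"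
  proof -
    have gS: "group (G\<lparr>carrier := S\<rparr>)" and gC: "group (G\<lparr>carrier := C\<rparr>)"
      using S(1) C(1) subgroup_imp_group by auto
    have CXs: "subgroup (C \<inter> Xo) (G\<lparr>carrier := C\<rparr>)"
      using subgroup_incl[OF subgroups_Inter_pair[OF C(1) Xo(1)] C(1)] by simp
    have "subgroup C (G\<lparr>carrier := S\<rparr>)" using subgroup_incl[OF C(1) S(1) C(2)] .
    from group.lagrange[OF gS this] have "card (rcosets\<^bsub>G\<lparr>carrier := S\<rparr>\<^esub> C) * card C = p ^ k"
      using S(2) by (simp add: order_def)
    then have "card C dvd p ^ k" by (metis dvd_triv_right)
    then obtain j where j: "card C = p ^ j" using p(1) divides_primepow_nat by blast
    have "\<exists>x\<in>carrier (G\<lparr>carrier := C\<rparr>) - C \<inter> Xo. \<forall>s\<in>carrier (G\<lparr>carrier := S\<rparr>).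
        s \<otimes> x \<otimes> inv s \<in> (C \<inter> Xo) #>\<^bsub>G\<lparr>carrier := C\<rparr>\<^esub> x"
    proof (rule p_group_fixed_coset[OF gS _ p(1) gC _ CXs])
      show "order (G\<lparr>carrier := S\<rparr>) = p ^ k" "order (G\<lparr>carrier := C\<rparr>) = p ^ j"
        using S j by (simp_all add: order_def)
      show "C \<inter> Xo \<noteq> carrier (G\<lparr>carrier := C\<rparr>)" using nC by auto
    qed (use C Xo in \<open>auto simp: word_simps\<close>)
    then show ?thesis by (auto simp: r_coset_def)
  qed
  then obtain c where c: "c \<in> C" "c \<notin> Xo" "\<And>s. s \<in> S \<Longrightarrow> s \<otimes> c \<otimes> inv s \<in> (C \<inter> Xo) #> c" by blast
  \<comment> \<open>The elements of \<open>C\<close> that are central in \<open>S\<close> modulo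
    \<open>Xo\<close>.\<close>
  define T where "T = {t \<in> C. \<forall>s\<in>S. s \<otimes> t \<otimes> inv s \<otimes> inv t \<in> Xo}"
  have TC: "T \<subseteq> C" unfolding T_def by auto
  have cT: "c \<in> T"
    unfolding T_def
  proof (intro CollectI conjI ballI)
    fix s assume s: "s \<in> S"
    then obtain x where x: "x \<in> Xo" "s \<otimes> c \<otimes> inv s = x \<otimes> c" using c(3) unfolding r_coset_def by auto
    then show "s \<otimes> c \<otimes> inv s \<otimes> inv c \<in> Xo" using c(1) by (simp add: word_simps)
  qed (rule c(1))
  have Tsub: "subgroup T G"
  proof (rule subgroupI)
    show "T \<subseteq> carrier G" "T \<noteq> {}" using cT TC by auto
    fix t assume t: "t \<in> T"
    then have tC: "t \<in> C" and tX: "\<And>s. s \<in> S \<Longrightarrow> s \<otimes> t \<otimes> inv s \<otimes> inv t \<in> Xo" unfolding T_def by auto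
    have tS: "t \<in> S" using tC C(2) by blast
    have "s \<otimes> inv t \<otimes> inv s \<otimes> inv (inv t) \<in> Xo" if s: "s \<in> S" for s
    proof -
      have "inv t \<otimes> inv (s \<otimes> t \<otimes> inv s \<otimes> inv t) \<otimes> inv (inv t) \<in> Xo"
        using Xo(3) tX[OF s] subgroup.m_inv_closed[OF Xo(1)] subgroup.m_inv_closed[OF S(1) tS] by blast
      then show ?thesis using s tC by (simp add: word_simps)
    qed
    then show "inv t \<in> T" using subgroup.m_inv_closed[OF C(1) tC] unfolding T_def by auto
    fix u assume u: "u \<in> T"
    then have uC: "u \<in> C" and uX: "\<And>s. s \<in> S \<Longrightarrow> s \<otimes> u \<otimes> inv s \<otimes> inv u \<in> Xo" unfolding T_def by auto
    have "s \<otimes> (t \<otimes> u) \<otimes> inv s \<otimes> inv (t \<otimes> u) \<in> Xo" if s: "s \<in> S" for s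
    proof -
      have "(s \<otimes> t \<otimes> inv s \<otimes> inv t) \<otimes> (t \<otimes> (s \<otimes> u \<otimes> inv s \<otimes> inv u) \<otimes> inv t) \<in> Xo"
        using Xo(3)[OF tS uX[OF s]] tX[OF s] subgroup.m_closed[OF Xo(1)] by blast
      then show ?thesis using s tC uC by (simp add: word_simps)
    qed
    then show "t \<otimes> u \<in> T" using subgroup.m_closed[OF C(1) tC uC] unfolding T_def by auto
  qed
  have Tn: "s \<otimes> t \<otimes> inv s \<in> Xo <#> T" if s: "s \<in> S" and t: "t \<in> T" for s t
  proof -
    have "t \<in> C" using t TC by blast
    then have "s \<otimes> t \<otimes> inv s = (s \<otimes> t \<otimes> inv s \<otimes> inv t) \<otimes> t" using s by (simp add: word_simps)
    moreover have "s \<otimes> t \<otimes> inv s \<otimes> inv t \<in> Xo" using s t unfolding T_def by blast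
    ultimately show ?thesis using set_mult_memI t by metis
  qed
  define Y where "Y = Xo <#> T"
  have Ysub: "subgroup Y G"
    unfolding Y_def
  proof (rule set_mult_subgroup_of_normalizing[OF Xo(1) Tsub])
    fix a b assume "a \<in> T" "b \<in> Xo"
    then show "a \<otimes> b \<otimes> inv a \<in> Xo" using Xo(3) TC C(2) by blast
  qed
  have TS: "T \<subseteq> S" using TC C(2) by blast
  have YS: "Y \<subseteq> S"
    unfolding Y_def using TS Xo(2) subgroup.m_closed[OF S(1)] by (auto elim!: set_mult_memE)
  have Yn: "s \<otimes> y \<otimes> inv s \<in> Y" if s: "s \<in> S" and y: "y \<in> Y" for s y
  proof -
    obtain x t where xt: "x \<in> Xo" "t \<in> T" "y = x \<otimes> t" using y unfolding Y_def by (rule set_mult_memE)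
    have tC: "t \<in> C" using xt TC by blast
    have "s \<otimes> y \<otimes> inv s = (s \<otimes> x \<otimes> inv s) \<otimes> (s \<otimes> t \<otimes> inv s)"
      using xt(1,3) tC s by (simp add: word_simps)
    moreover have "s \<otimes> x \<otimes> inv s \<in> Y"
      using Xo(3)[OF s xt(1)] subset_set_mult(1)[OF Xo(1) Tsub] unfolding Y_def by blast
    moreover have "s \<otimes> t \<otimes> inv s \<in> Y" using Tn[OF s xt(2)] unfolding Y_def .
    ultimately show ?thesis using subgroup.m_closed[OF Ysub] by simp
  qed
  let ?W = "Omega1 G p C"
  have WC: "?W \<subseteq> C" using Omega1_subset[OF C(1)] .
  \<comment> \<open>The factor \<open>Xo\<close> of \<open>Y\<close> drops out of commutators with
    \<open>C\<close>, and \<open>T\<close> commutes with \<open>C\<close> modulo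
    \<open>Xo\<close>.\<close>
  have "iter_comm G ?W Y 1 \<subseteq> C \<inter> Xo"
  proof -
    have "iter_comm G ?W Y 1 \<subseteq> iter_comm G ?W T 1 \<inter> C"
      unfolding Y_def using iter_comm_set_mult_centralized[OF S(1) C WC Xo(2) _ CX, of T 1] TC C(2) by blast
    moreover have "iter_comm G ?W T 1 \<subseteq> Xo"
    proof -
      have "commutator G w t \<in> Xo" if w: "w \<in> ?W" and t: "t \<in> T" for w t
      proof -
        have wC: "w \<in> C" and tC: "t \<in> C" using w t WC TC by auto
        have "inv w \<otimes> inv t \<otimes> inv (inv w) \<otimes> inv (inv t) \<in> Xo"
          using subgroup.m_inv_closed[OF Tsub t] subgroup.m_inv_closed[OF C(1) wC] C(2) unfolding T_def by auto
        then show ?thesis using wC tC unfolding commutator_def by simp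
      qed
      then show ?thesis using comm_sub_subset[OF Xo(1)] by simp
    qed
    ultimately show ?thesis by blast
  qed
  \<comment> \<open>\<open>m\<close> commutes with \<open>Xo\<close> because it lies in
    \<open>C\<close>, and with \<open>T \<subseteq> C\<close> because it lies in
    \<open>Xo\<close>.\<close>
  moreover have "commutator G m y = \<one>" if m: "m \<in> C \<inter> Xo" and y: "y \<in> Y" for m y
  proof -
    obtain x t where xt: "x \<in> Xo" "t \<in> T" "y = x \<otimes> t" using y unfolding Y_def by (rule set_mult_memE)
    have tC: "t \<in> C" using xt TC by blast
    have c: "m \<in> carrier G" "x \<in> carrier G" "t \<in> carrier G" using m xt tC by auto
    have mx: "m \<otimes> x = x \<otimes> m" and tm: "t \<otimes> m = m \<otimes> t" using CX m xt(1) tC by auto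
    have "m \<otimes> y = x \<otimes> m \<otimes> t" using xt(3) mx c by (simp add: m_assoc[symmetric])
    also have "\<dots> = y \<otimes> m" using xt(3) tm c by (simp add: m_assoc)
    finally have my: "m \<otimes> y = y \<otimes> m" .
    have yc: "y \<in> carrier G" using xt c by simp
    show ?thesis unfolding commutator_def using my c(1) yc by (simp add: m_assoc) (simp add: word_simps)
  qed
  ultimately have "comm_sub G (iter_comm G ?W Y 1) Y \<subseteq> {\<one>}"
    by (intro comm_sub_subset[OF triv_subgroup]) auto
  then have "iter_comm G ?W Y 2 \<subseteq> {\<one>}" by (simp add: numeral_2_eq_2)
  then have step: "iter_comm G ?W Y (p - 1) \<subseteq> {\<one>}"
    using iter_comm_trivial_mono[OF subgroup.subset[OF Ysub]] p(2) by simp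
  have "has_Q_series G p S Y"
  proof (rule has_Q_series_extend[OF p2 oliver_subgroup_greatest(1)[OF fin S(1) p2]])
    show "Y \<lhd> G\<lparr>carrier := S\<rparr>" using Ysub YS Yn normal_in_subgroup_iff[OF S(1)] by blast
    show "oliver_subgroup G p S \<subseteq> Y" using subset_set_mult(1)[OF Xo(1) Tsub] unfolding Xo_def Y_def .
    show "iter_comm G (Omega1 G p (centralizer_in G S (oliver_subgroup G p S))) Y (p - 1) \<subseteq> {\<one>}"
      using step unfolding C_def Xo_def .
  qed
  then have "Y \<subseteq> Xo" unfolding Xo_def using oliver_subgroup_greatest(2)[OF fin S(1) p2] by blast
  moreover have "c \<in> Y" using cT subset_set_mult(2)[OF Xo(1) Tsub] unfolding Y_def by blast
  ultimately show False using c(2) by blast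
qed

text \<open>By centricity the centraliser of the Oliver subgroup is its centre, so \<open>V\<close>
  is elementary abelian and contains \<open>Omega1\<close> of that centre. The centraliser of
  \<open>V\<close> thus commutes with this \<open>Omega1\<close>, and appending it prolongs the
  Q-series.\<close>

lemma oliver_subgroup_contains_centralizer:
  fixes p :: nat
  assumes fin: "finite (carrier G)" and p: "Factorial_Ring.prime p" "p \<ge> 3"
    and S: "subgroup S G" "card S = p ^ k"
    and V_def: "V = {x \<in> centralizer_in G S (oliver_subgroup G p S). x [^] p = \<one>}"
  shows "elem_abelian_sub G p S V"
    and "\<And>s v. s \<in> S \<Longrightarrow> v \<in> V \<Longrightarrow> s \<otimes> v \<otimes> inv s \<in> V"
    and "centralizer_in G S V \<subseteq> oliver_subgroup G p S"
proof -
  define Xo where "Xo = oliver_subgroup G p S"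
  define C where "C = centralizer_in G S Xo"
  have V: "V = {x \<in> C. x [^] p = \<one>}" unfolding V_def C_def Xo_def by simp
  have p2: "p \<ge> 2" using p by simp
  have Xo: "subgroup Xo G" "Xo \<subseteq> S" "\<And>s k. s \<in> S \<Longrightarrow> k \<in> Xo \<Longrightarrow> s \<otimes> k \<otimes> inv s \<in> Xo"
    unfolding Xo_def using oliver_subgroup_normal[OF fin S(1) p2] by auto
  have C: "subgroup C G" "C \<subseteq> S" "\<And>s x. s \<in> S \<Longrightarrow> x \<in> C \<Longrightarrow> s \<otimes> x \<otimes> inv s \<in> C"
    unfolding C_def using centralizer_in_subgroup[OF S(1) subgroup.subset[OF Xo(1)]]
      centralizer_in_normalized[OF S(1) Xo(1,3)] by (auto simp: centralizer_in_def)
  have CX: "C \<subseteq> Xo" unfolding C_def Xo_def using oliver_subgroup_centric[OF fin p S] .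
  have comm: "x \<otimes> y = y \<otimes> x" if "x \<in> C" "y \<in> Xo" for x y
    using that unfolding C_def centralizer_in_def by auto
  have Sc [simp]: "x \<in> carrier G" if "x \<in> S" for x using that subgroup.mem_carrier[OF S(1)] by blast
  have Cc [simp]: "x \<in> carrier G" if "x \<in> C" for x using that C(2) by auto
  have Vsub: "subgroup V G"
  proof (rule subgroupI)
    show "V \<subseteq> carrier G" unfolding V by auto
    have "\<one> \<in> V" unfolding V using subgroup.one_closed[OF C(1)] by simp
    then show "V \<noteq> {}" by blast
    show "inv x \<in> V" if "x \<in> V" for x
      using that subgroup.m_inv_closed[OF C(1)] unfolding V by (auto simp: nat_pow_inv)
    show "x \<otimes> y \<in> V" if "x \<in> V" "y \<in> V" for x y
      using that subgroup.m_closed[OF C(1)] comm CX pow_mult_distrib[of x y p] unfolding V by auto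
  qed
  show elV: "elem_abelian_sub G p S V"
    using Vsub C(2) CX comm unfolding elem_abelian_sub_def V by auto
  have conj_pow: "(s \<otimes> x \<otimes> inv s) [^] (n::nat) = s \<otimes> x [^] n \<otimes> inv s" if "s \<in> S" "x \<in> C" for s x n
    using that by (induction n) (simp_all add: word_simps)
  show Vn: "s \<otimes> v \<otimes> inv s \<in> V" if s: "s \<in> S" and v: "v \<in> V" for s v
    using v C(3)[OF s] conj_pow[OF s] s unfolding V by auto
  have D: "subgroup (centralizer_in G S V) G" "centralizer_in G S V \<subseteq> S"
    "\<And>s x. s \<in> S \<Longrightarrow> x \<in> centralizer_in G S V \<Longrightarrow> s \<otimes> x \<otimes> inv s \<in> centralizer_in G S V"
    using centralizer_in_subgroup[OF S(1) subgroup.subset[OF Vsub]]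
      centralizer_in_normalized[OF S(1) Vsub Vn] by (auto simp: centralizer_in_def)
  have XD: "Xo \<subseteq> centralizer_in G S V"
    using Xo(2) comm unfolding centralizer_in_def V by force
  have "Omega1 G p C \<subseteq> V"
    unfolding Omega1_def
  proof (rule generate_subgroup_incl[OF _ Vsub], intro subsetI)
    fix x assume "x \<in> {x \<in> C. ord x = p}"
    then show "x \<in> V" using pow_ord_eq_1[of x] unfolding V by auto
  qed
  moreover have "commutator G v d = \<one>" if v: "v \<in> V" and d: "d \<in> centralizer_in G S V" for v d
  proof -
    have c: "v \<in> carrier G" "d \<in> carrier G" using v d D(2) unfolding V by auto
    have "v \<otimes> d = d \<otimes> v" using v d unfolding centralizer_in_def by auto
    then show ?thesis unfolding commutator_def using c by (simp add: m_assoc) (simp add: word_simps)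
  qed
  ultimately have "comm_sub G (Omega1 G p C) (centralizer_in G S V) \<subseteq> {\<one>}"
    by (intro comm_sub_subset[OF triv_subgroup]) auto
  then have "iter_comm G (Omega1 G p C) (centralizer_in G S V) 1 \<subseteq> {\<one>}" by simp
  then have step: "iter_comm G (Omega1 G p C) (centralizer_in G S V) (p - 1) \<subseteq> {\<one>}"
    by (rule iter_comm_trivial_mono[OF subgroup.subset[OF D(1)]]) (use p(2) in simp)
  have "has_Q_series G p S (centralizer_in G S V)"
  proof (rule has_Q_series_extend[OF p2 oliver_subgroup_greatest(1)[OF fin S(1) p2]])
    show "centralizer_in G S V \<lhd> G\<lparr>carrier := S\<rparr>" using D normal_in_subgroup_iff[OF S(1)] by blast
    show "oliver_subgroup G p S \<subseteq> centralizer_in G S V" using XD unfolding Xo_def .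
    show "iter_comm G (Omega1 G p (centralizer_in G S (oliver_subgroup G p S))) (centralizer_in G S V) (p - 1) \<subseteq> {\<one>}"
      using step unfolding C_def Xo_def .
  qed
  from oliver_subgroup_greatest(2)[OF fin S(1) p2 this]
  show "centralizer_in G S V \<subseteq> oliver_subgroup G p S" .
qed

end

section \<open>Unitary matrices as endomorphisms\<close>

text \<open>Square matrices of variable size do not form a type; linear endomorphisms of sequences do.\<close>

typedef (overloaded) 'a endo = "{f :: (nat \<Rightarrow> 'a::field) \<Rightarrow> nat \<Rightarrow> 'a.
    (\<forall>x y. f (x + y) = f x + f y) \<and> (\<forall>c x. f (\<lambda>i. c * x i) = (\<lambda>i. c * f x i))}"
  morphisms app Abs_endo
  by (rule exI[of _ "\<lambda>x. x"]) simp

setup_lifting type_definition_endo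

lemma sum_apply_fun: "(\<Sum>i\<in>I. f i) x = (\<Sum>i\<in>I. f i x)"
  by (induction I rule: infinite_finite_induct) simp_all

lemma app_add: "app f (x + y) = app f x + app f y"
  using app[of f] by simp

lemma app_scale: "app f (\<lambda>i. c * x i) = (\<lambda>i. c * app f x i)"
  using app[of f] by simp

lemma app_zero [simp]: "app f 0 = 0"
  using app_add[of f 0 0] by simp

lemma app_minus: "app f (- x) = - app f x"
  using app_add[of f x "- x"] by (simp add: eq_neg_iff_add_eq_0 add.commute)

lemma app_diff: "app f (x - y) = app f x - app f y"
  using app_add[of f x "- y"] app_minus[of f y] by simp

lemma app_sum: "app f (\<Sum>i\<in>I. x i) = (\<Sum>i\<in>I. app f (x i))"
proof (induction I rule: infinite_finite_induct)
  case (insert i I)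
  show ?case unfolding sum.insert[OF insert.hyps] app_add insert.IH ..
next
  case (infinite I)
  show ?case unfolding sum.infinite[OF infinite.hyps] app_zero ..
next
  case empty
  show ?case unfolding sum.empty app_zero ..
qed

lemma endo_eqI: "(\<And>x. app f x = app g x) \<Longrightarrow> f = g"
  by (simp add: app_inject[symmetric] ext)

instantiation endo :: (field) ring_1
begin

lift_definition zero_endo :: "'a endo" is "\<lambda>x. 0" by auto
lift_definition one_endo :: "'a endo" is "\<lambda>x. x" by auto
lift_definition plus_endo :: "'a endo \<Rightarrow> 'a endo \<Rightarrow> 'a endo" is "\<lambda>f g x. f x + g x"
  by (auto simp: algebra_simps)
lift_definition minus_endo :: "'a endo \<Rightarrow> 'a endo \<Rightarrow> 'a endo" is "\<lambda>f g x. f x - g x"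
  by (auto simp: algebra_simps)
lift_definition uminus_endo :: "'a endo \<Rightarrow> 'a endo" is "\<lambda>f x. - f x"
  by (auto simp: algebra_simps)
lift_definition times_endo :: "'a endo \<Rightarrow> 'a endo \<Rightarrow> 'a endo" is "\<lambda>f g x. f (g x)" by auto

lemma app_ring:
  "app 0 x = 0" "app 1 x = x" "app (f + g) x = app f x + app g x" "app (f - g) x = app f x - app g x"
  "app (- f) x = - app f x" "app (f * g) x = app f (app g x)"
  by (transfer; simp)+

instance
proof
  fix f g k :: "'a endo"
  show "f + g + k = f + (g + k)" "f + g = g + f" "0 + f = f" "- f + f = 0" "f - g = f + - g"
    "f * g * k = f * (g * k)" "1 * f = f" "f * 1 = f"
    "(f + g) * k = f * k + g * k" "f * (g + k) = f * g + f * k"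
    by (rule endo_eqI; simp add: app_ring app_add algebra_simps)+
  show "(0::'a endo) \<noteq> 1"
  proof
    assume "(0::'a endo) = 1"
    then have "app (0::'a endo) (\<lambda>_. 1) 0 = app 1 (\<lambda>_. 1) 0" by simp
    then show False unfolding app_ring by simp
  qed
qed

end

lift_definition scalar_endo :: "'a::field \<Rightarrow> 'a endo" is "\<lambda>c x i. c * x i"
  by (auto simp: algebra_simps fun_eq_iff)

lemma app_scalar_endo: "app (scalar_endo c) x = (\<lambda>i. c * x i)"
  by transfer simp

lemma scalar_endo_central: "scalar_endo c * f = f * scalar_endo c"
  by (rule endo_eqI) (simp add: app_ring app_scalar_endo app_scale)

lemma of_nat_endo: "of_nat k = scalar_endo (of_nat k)"
proof (rule endo_eqI)
  fix x :: "nat \<Rightarrow> 'a"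
  show "app (of_nat k) x = app (scalar_endo (of_nat k)) x"
    by (induction k) (simp_all add: app_ring app_scalar_endo fun_eq_iff algebra_simps)
qed

text \<open>Matrices act as the identity on the coordinates from \<open>n\<close> on: this makes the passage to
  endomorphisms unital, so that identities can be computed in one ring type for all \<open>n\<close>.\<close>

definition mat_endo :: "nat \<Rightarrow> 'a::field mat \<Rightarrow> 'a endo" where
  "mat_endo n A = Abs_endo (\<lambda>x i. if i < n then \<Sum>j<n. A $$ (i, j) * x j else x i)"

lemma app_mat_endo:
  "app (mat_endo n A) x i = (if i < n then \<Sum>j<n. A $$ (i, j) * x j else x i)"
proof -
  have "(\<lambda>x i. if i < n then \<Sum>j<n. A $$ (i, j) * x j else x i) \<in> {f :: (nat \<Rightarrow> 'a::field) \<Rightarrow> nat \<Rightarrow> 'a.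
    (\<forall>x y. f (x + y) = f x + f y) \<and> (\<forall>c x. f (\<lambda>i. c * x i) = (\<lambda>i. c * f x i))}"
  proof (intro CollectI conjI allI; rule ext)
    fix x y :: "nat \<Rightarrow> 'a" and c i
    show "(if i < n then \<Sum>j<n. A $$ (i, j) * (x + y) j else (x + y) i) =
      ((\<lambda>i. if i < n then \<Sum>j<n. A $$ (i, j) * x j else x i) + (\<lambda>i. if i < n then \<Sum>j<n. A $$ (i, j) * y j else y i)) i"
      by (simp add: distrib_left sum.distrib)
    show "(if i < n then \<Sum>j<n. A $$ (i, j) * (c * x j) else c * x i) =
      c * (if i < n then \<Sum>j<n. A $$ (i, j) * x j else x i)"
      by (simp add: sum_distrib_left mult.left_commute)
  qed
  then show ?thesis unfolding mat_endo_def by (simp only: Abs_endo_inverse)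
qed

lemma mat_endo_mult:
  assumes "A \<in> carrier_mat n n" "B \<in> carrier_mat n n"
  shows "mat_endo n (A * B) = mat_endo n A * mat_endo n B"
proof (rule endo_eqI, rule ext)
  fix x :: "nat \<Rightarrow> 'a" and i
  have AB: "(A * B) $$ (i, j) = (\<Sum>k<n. A $$ (i, k) * B $$ (k, j))" if "i < n" "j < n" for j
    using assms that by (simp add: scalar_prod_def atLeast0LessThan)
  show "app (mat_endo n (A * B)) x i = app (mat_endo n A * mat_endo n B) x i"
  proof (cases "i < n")
    case True
    have "(\<Sum>j<n. (A * B) $$ (i, j) * x j) = (\<Sum>j<n. \<Sum>k<n. A $$ (i, k) * B $$ (k, j) * x j)"
      using AB[OF True] by (simp add: sum_distrib_right)
    also have "\<dots> = (\<Sum>k<n. \<Sum>j<n. A $$ (i, k) * B $$ (k, j) * x j)" by (rule sum.swap)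
    also have "\<dots> = (\<Sum>k<n. A $$ (i, k) * (\<Sum>j<n. B $$ (k, j) * x j))"
      by (simp add: sum_distrib_left mult.assoc)
    finally show ?thesis using True by (simp add: app_mat_endo app_ring)
  qed (simp add: app_mat_endo app_ring)
qed

lemma mat_endo_one: "mat_endo n (1\<^sub>m n) = 1"
proof (rule endo_eqI, rule ext)
  fix x :: "nat \<Rightarrow> 'a" and i
  have "(\<Sum>j<n. (1\<^sub>m n) $$ (i, j) * x j) = (\<Sum>j<n. if j = i then x j else 0)" if "i < n"
    using that by (intro sum.cong) auto
  then show "app (mat_endo n (1\<^sub>m n)) x i = app 1 x i"
    by (simp add: app_mat_endo app_ring)
qed

definition unit_fun :: "nat \<Rightarrow> nat \<Rightarrow> 'a::field" where
  "unit_fun j = (\<lambda>i. if i = j then 1 else 0)"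

lemma app_mat_endo_unit_fun:
  assumes "i < n" "j < n"
  shows "app (mat_endo n A) (unit_fun j) i = A $$ (i, j)"
proof -
  have "(\<Sum>k<n. A $$ (i, k) * unit_fun j k) = (\<Sum>k<n. if k = j then A $$ (i, k) else 0)"
    by (intro sum.cong) (auto simp: unit_fun_def)
  then show ?thesis using assms by (simp add: app_mat_endo)
qed

definition supp_fun :: "nat \<Rightarrow> (nat \<Rightarrow> 'a::field) set" where
  "supp_fun n = {x. \<forall>i\<ge>n. x i = 0}"

lemma unit_fun_supp: "j < n \<Longrightarrow> unit_fun j \<in> supp_fun n"
  by (auto simp: unit_fun_def supp_fun_def)

lemma supp_fun_closed:
  "0 \<in> supp_fun n" "x \<in> supp_fun n \<Longrightarrow> y \<in> supp_fun n \<Longrightarrow> x + y \<in> supp_fun n"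
  "x \<in> supp_fun n \<Longrightarrow> y \<in> supp_fun n \<Longrightarrow> x - y \<in> supp_fun n"
  "x \<in> supp_fun n \<Longrightarrow> (\<lambda>i. c * x i) \<in> supp_fun n"
  "x \<in> supp_fun n \<Longrightarrow> app (mat_endo n A) x \<in> supp_fun n"
  by (auto simp: supp_fun_def app_mat_endo)

lemma mat_endo_inj:
  assumes "A \<in> carrier_mat n n" "B \<in> carrier_mat n n"
    and "\<And>x. x \<in> supp_fun n \<Longrightarrow> app (mat_endo n A) x = app (mat_endo n B) x"
  shows "A = B"
proof (rule eq_matI)
  fix i j assume "i < dim_row B" "j < dim_col B"
  then show "A $$ (i, j) = B $$ (i, j)"
    using assms(1,2) assms(3)[OF unit_fun_supp, of j]
      app_mat_endo_unit_fun[of i n j A] app_mat_endo_unit_fun[of i n j B] by auto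
qed (use assms in auto)

text \<open>The image of \<open>mat_endo n\<close>, described without matrices: this lets isometries
  be built as endomorphisms and turned into matrices afterwards.\<close>

definition mat_like :: "nat \<Rightarrow> 'a::field endo \<Rightarrow> bool" where
  "mat_like n f \<longleftrightarrow> (\<forall>x. app f x - x \<in> supp_fun n) \<and> (\<forall>x. (\<forall>i<n. x i = 0) \<longrightarrow> app f x = x)"

lemma mat_like_mat_endo: "mat_like n (mat_endo n A)"
  by (auto simp: mat_like_def supp_fun_def app_mat_endo fun_eq_iff)

lemma mat_like_imp_mat_endo:
  fixes f :: "'a::field endo"
  assumes "mat_like n f"
  obtains A where "A \<in> carrier_mat n n" "f = mat_endo n A"
proof
  define A where "A = mat n n (\<lambda>(i, j). app f (unit_fun j) i)"
  show "A \<in> carrier_mat n n" unfolding A_def by simp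
  show "f = mat_endo n A"
  proof (rule endo_eqI, rule ext)
    fix x :: "nat \<Rightarrow> 'a" and i
    \<comment> \<open>The truncation of \<open>x\<close> to the first \<open>n\<close> coordinates;
      the remainder \<open>x - y\<close> is fixed by \<open>f\<close>.\<close>
    define y where "y = (\<Sum>j<n. (\<lambda>i. x j * unit_fun j i))"
    have y: "y i = (if i < n then x i else 0)" for i
    proof -
      have "y i = (\<Sum>j<n. x j * unit_fun j i)" unfolding y_def by (simp add: sum_apply_fun)
      also have "\<dots> = (\<Sum>j<n. if j = i then x j else 0)" by (intro sum.cong) (auto simp: unit_fun_def)
      finally show ?thesis by simp
    qed
    have "app f (x - y) = x - y"
      using assms unfolding mat_like_def by (simp add: y)
    then have fx: "app f x = app f y + (x - y)" by (simp add: app_diff algebra_simps)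
    have fy: "app f y i = (\<Sum>j<n. x j * app f (unit_fun j) i)"
      unfolding y_def by (simp add: app_sum app_scale sum_apply_fun)
    show "app f x i = app (mat_endo n A) x i"
    proof (cases "i < n")
      case True
      then show ?thesis using fx fy y by (simp add: app_mat_endo A_def mult.commute)
    next
      case False
      then show ?thesis using assms unfolding mat_like_def supp_fun_def by (simp add: app_mat_endo)
    qed
  qed
qed

section \<open>The hermitian form and its isometry group\<close>

definition herm :: "nat \<Rightarrow> nat \<Rightarrow> (nat \<Rightarrow> 'a::field) \<Rightarrow> (nat \<Rightarrow> 'a) \<Rightarrow> 'a" where
  "herm q n x y = (\<Sum>i<n. x i ^ q * y i)"

locale unitary_space =
  fixes q n :: nat and ty :: "'a::{field,finite} itself"
  assumes q: "prime_power q" and card: "card (UNIV :: 'a set) = q ^ 2"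
begin

abbreviation "h \<equiv> herm q n :: (nat \<Rightarrow> 'a) \<Rightarrow> (nat \<Rightarrow> 'a) \<Rightarrow> 'a"
abbreviation "W \<equiv> supp_fun n :: (nat \<Rightarrow> 'a) set"

text \<open>The characteristic divides the order \<open>q ^ 2\<close> of the field, so it is the
  prime of which \<open>q\<close> is a power. This makes the \<open>q\<close>-th power map
  additive.\<close>

lemma char: "\<exists>e. Factorial_Ring.prime CHAR('a) \<and> e \<ge> 1 \<and> q = CHAR('a) ^ e"
proof -
  obtain r e where r: "Factorial_Ring.prime (r::nat)" "e \<ge> 1" "q = r ^ e"
    using q unfolding prime_power_def by blast
  have "CHAR('a) dvd r ^ (e * 2)"
    using CHAR_dvd_CARD[where ?'a = 'a] card r(3) by (simp add: power_mult)
  moreover have pr: "Factorial_Ring.prime CHAR('a)"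
    using prime_CHAR_semidom[where ?'a = 'a] finite_imp_CHAR_pos[where ?'a = 'a] by simp
  ultimately have "CHAR('a) dvd r" using prime_dvd_power by blast
  then have "CHAR('a) = r" using pr r(1) primes_dvd_imp_eq by blast
  then show ?thesis using r pr by blast
qed

lemma q_pos: "q > 0"
  using char by (auto simp: prime_gt_0_nat)

lemma zero_power_q [simp]: "(0::'a) ^ q = 0"
  using q_pos by simp

lemma power_q_add: "(x + y :: 'a) ^ q = x ^ q + y ^ q"
  using char freshmans_dream' by blast

lemma power_q_sum: "(\<Sum>i\<in>I. f i :: 'a) ^ q = (\<Sum>i\<in>I. f i ^ q)"
  using char freshmans_dream_sum' by blast

lemma power_q_minus: "(- x :: 'a) ^ q = - (x ^ q)"
  using power_q_add[of x "- x"] by (simp add: eq_neg_iff_add_eq_0 add.commute)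

lemma power_q_diff: "(x - y :: 'a) ^ q = x ^ q - y ^ q"
  using power_q_add[of x "- y"] power_q_minus[of y] by simp

text \<open>Multiplication by a nonzero \<open>x\<close> permutes the nonzero elements, whose
  product can then be cancelled. With order \<open>q ^ 2\<close> this makes the \<open>q\<close>-th
  power map an involution.\<close>

lemma power_card: "(x::'a) ^ card (UNIV :: 'a set) = x"
proof (cases "x = 0")
  case False
  let ?U = "UNIV - {0::'a}"
  have "bij_betw ((*) x) ?U ?U"
    by (rule bij_betw_byWitness[where f' = "\<lambda>y. y / x"]) (use False in auto)
  then have "(\<Prod>y\<in>?U. x * y) = \<Prod>?U" by (rule prod.reindex_bij_betw)
  then have "x ^ card ?U * \<Prod>?U = \<Prod>?U" by (simp add: prod.distrib)
  moreover have "\<Prod>?U \<noteq> 0" by simp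
  ultimately have 1: "x ^ card ?U = 1" by simp
  have "card (UNIV :: 'a set) = Suc (card ?U)" by (simp add: card_Diff_singleton card_gt_0_iff)
  then have "x ^ card (UNIV :: 'a set) = x * x ^ card ?U" by (metis power_Suc)
  then show ?thesis unfolding 1 by simp
qed (simp add: card_gt_0_iff)

lemma power_q_q: "((x::'a) ^ q) ^ q = x"
  using power_card[of x] by (simp add: card power2_eq_square power_mult)

lemma h_add: "h (x + x') y = h x y + h x' y" "h x (y + y') = h x y + h x y'"
  by (simp_all add: herm_def power_q_add algebra_simps sum.distrib)

lemma h_diff: "h (x - x') y = h x y - h x' y" "h x (y - y') = h x y - h x y'"
  by (simp_all add: herm_def power_q_diff algebra_simps sum_subtractf)

lemma h_scale: "h (\<lambda>i. c * x i) y = c ^ q * h x y" "h x (\<lambda>i. c * y i) = c * h x y"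
  by (simp_all add: herm_def power_mult_distrib sum_distrib_left algebra_simps)

lemma h_zero [simp]: "h 0 y = 0" "h x 0 = 0"
  by (simp_all add: herm_def)

lemma h_sym: "h y x = h x y ^ q"
  by (simp add: herm_def power_q_sum power_mult_distrib power_q_q mult.commute)

lemma h_nondegenerate:
  assumes "x \<in> W" "\<And>y. y \<in> W \<Longrightarrow> h y x = 0"
  shows "x = 0"
proof
  fix i
  show "x i = (0 :: nat \<Rightarrow> 'a) i"
  proof (cases "i < n")
    case True
    have "h (unit_fun i) x = (\<Sum>j<n. if j = i then x j else 0)"
      unfolding herm_def by (intro sum.cong) (auto simp: unit_fun_def)
    then show ?thesis using True assms(2)[OF unit_fun_supp[OF True]] by simp
  next
    case False
    then show ?thesis using assms(1) by (simp add: supp_fun_def)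
  qed
qed

text \<open>\<open>M\<close> is the Gram matrix of the columns of \<open>A\<close>, and unit vectors
  read off its entries. The form sees only the first \<open>n\<close> coordinates, so
  \<open>x\<close> and \<open>y\<close> may be arbitrary sequences.\<close>

lemma unitary_mats_iff:
  assumes A: "A \<in> carrier_mat n n"
  shows "A \<in> unitary_mats q n \<longleftrightarrow> (\<forall>x y. h (app (mat_endo n A) x) (app (mat_endo n A) y) = h x y)"
proof -
  define M where "M = transpose_mat (bar_mat q A) * A"
  have M: "M $$ (i, j) = (\<Sum>k<n. A $$ (k, i) ^ q * A $$ (k, j))" if "i < n" "j < n" for i j
    unfolding M_def using A that by (simp add: bar_mat_def scalar_prod_def atLeast0LessThan)
  have Mc: "M \<in> carrier_mat n n" unfolding M_def using A by (simp add: bar_mat_def)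
  have hM: "h (app (mat_endo n A) x) (app (mat_endo n A) y) = (\<Sum>i<n. \<Sum>j<n. x i ^ q * y j * M $$ (i, j))" for x y
  proof -
    have "h (app (mat_endo n A) x) (app (mat_endo n A) y)
      = (\<Sum>k<n. (\<Sum>i<n. A $$ (k, i) ^ q * x i ^ q) * (\<Sum>j<n. A $$ (k, j) * y j))"
      by (simp add: herm_def app_mat_endo power_q_sum power_mult_distrib)
    also have "\<dots> = (\<Sum>k<n. \<Sum>i<n. \<Sum>j<n. x i ^ q * y j * (A $$ (k, i) ^ q * A $$ (k, j)))"
      unfolding sum_product by (intro sum.cong refl) (simp add: mult_ac)
    also have "\<dots> = (\<Sum>i<n. \<Sum>k<n. \<Sum>j<n. x i ^ q * y j * (A $$ (k, i) ^ q * A $$ (k, j)))"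
      by (rule sum.swap)
    also have "\<dots> = (\<Sum>i<n. \<Sum>j<n. \<Sum>k<n. x i ^ q * y j * (A $$ (k, i) ^ q * A $$ (k, j)))"
      by (rule sum.cong[OF refl]) (rule sum.swap)
    also have "\<dots> = (\<Sum>i<n. \<Sum>j<n. x i ^ q * y j * M $$ (i, j))"
      by (simp add: M sum_distrib_left)
    finally show ?thesis .
  qed
  have "A \<in> unitary_mats q n \<longleftrightarrow> M = 1\<^sub>m n" unfolding unitary_mats_def M_def using A by simp
  also have "\<dots> \<longleftrightarrow> (\<forall>x y. (\<Sum>i<n. \<Sum>j<n. x i ^ q * y j * M $$ (i, j)) = h x y)"
  proof (intro iffI allI)
    fix x y :: "nat \<Rightarrow> 'a"
    assume M1: "M = 1\<^sub>m n"
    have "(\<Sum>j<n. x i ^ q * y j * M $$ (i, j)) = x i ^ q * y i" if "i < n" for i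
    proof -
      have "(\<Sum>j<n. x i ^ q * y j * M $$ (i, j)) = (\<Sum>j<n. if j = i then x i ^ q * y j else 0)"
        using that M1 by (intro sum.cong) auto
      then show ?thesis using that by simp
    qed
    then show "(\<Sum>i<n. \<Sum>j<n. x i ^ q * y j * M $$ (i, j)) = h x y" by (simp add: herm_def)
  next
    assume *: "\<forall>x y. (\<Sum>i<n. \<Sum>j<n. x i ^ q * y j * M $$ (i, j)) = h x y"
    show "M = 1\<^sub>m n"
    proof (rule eq_matI)
      fix i j assume "i < dim_row (1\<^sub>m n :: 'a mat)" "j < dim_col (1\<^sub>m n :: 'a mat)"
      then have ij: "i < n" "j < n" by auto
      let ?u = "unit_fun :: nat \<Rightarrow> nat \<Rightarrow> 'a"
      have "(\<Sum>a<n. \<Sum>b<n. ?u i a ^ q * ?u j b * M $$ (a, b)) = (\<Sum>a<n. if a = i then \<Sum>b<n. if b = j then M $$ (a, b) else 0 else 0)"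
      proof (rule sum.cong[OF refl])
        fix a
        have "(\<Sum>b<n. ?u i a ^ q * ?u j b * M $$ (a, b)) = (\<Sum>b<n. if b = j then ?u i a ^ q * M $$ (a, b) else 0)"
          by (rule sum.cong[OF refl]) (simp add: unit_fun_def)
        then show "(\<Sum>b<n. ?u i a ^ q * ?u j b * M $$ (a, b)) = (if a = i then \<Sum>b<n. if b = j then M $$ (a, b) else 0 else 0)"
          by (simp add: unit_fun_def)
      qed
      also have "\<dots> = M $$ (i, j)" using ij by simp
      finally have "M $$ (i, j) = h (?u i) (?u j)" using * by simp
      also have "\<dots> = (\<Sum>a<n. if a = i then (if i = j then 1 else 0) else 0)"
        unfolding herm_def by (intro sum.cong refl) (auto simp: unit_fun_def)
      also have "\<dots> = (1\<^sub>m n) $$ (i, j)" using ij by simp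
      finally show "M $$ (i, j) = 1\<^sub>m n $$ (i, j)" .
    qed (use Mc in auto)
  qed
  finally show ?thesis using hM by simp
qed

abbreviation "G \<equiv> unitary_group q n :: 'a mat monoid"

lemma G_simps [simp]:
  "carrier G = unitary_mats q n" "x \<otimes>\<^bsub>G\<^esub> y = x * y" "\<one>\<^bsub>G\<^esub> = 1\<^sub>m n"
  by (simp_all add: unitary_group_def)

lemma unitary_carrier: "A \<in> unitary_mats q n \<Longrightarrow> A \<in> carrier_mat n n"
  by (simp add: unitary_mats_def)

abbreviation rep :: "'a mat \<Rightarrow> 'a endo" where "rep \<equiv> mat_endo n"

lemma unitaryI:
  assumes "mat_like n f" "\<And>x y. h (app f x) (app f y) = h x y"
  obtains A where "A \<in> carrier G" "rep A = f"
proof -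
  obtain A where A: "A \<in> carrier_mat n n" "f = rep A" using mat_like_imp_mat_endo[OF assms(1)] .
  then have "A \<in> carrier G" using assms(2) unitary_mats_iff[OF A(1)] by simp
  then show thesis using that A(2) by blast
qed

lemma rep_unitary:
  "A \<in> carrier G \<Longrightarrow> h (app (rep A) x) (app (rep A) y) = h x y"
  using unitary_mats_iff[OF unitary_carrier] by simp

lemma finite_G: "finite (carrier G)"
proof (rule finite_subset)
  let ?F = "PiE ({..<n} \<times> {..<n}) (\<lambda>_. UNIV :: 'a set)"
  show "carrier G \<subseteq> mat n n ` ?F"
  proof
    fix A assume "A \<in> carrier G"
    then have A: "A \<in> carrier_mat n n" using unitary_carrier by simp
    have "A = mat n n (restrict (\<lambda>ij. A $$ ij) ({..<n} \<times> {..<n}))"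
      using A by (intro eq_matI) auto
    then show "A \<in> mat n n ` ?F" by (metis image_eqI restrict_PiE_iff UNIV_I)
  qed
  show "finite (mat n n ` ?F)" by (intro finite_imageI finite_PiE) auto
qed

lemma rep_mult: "A \<in> carrier G \<Longrightarrow> B \<in> carrier G \<Longrightarrow> rep (A \<otimes>\<^bsub>G\<^esub> B) = rep A * rep B"
  by (simp add: mat_endo_mult unitary_carrier)

lemma rep_one: "rep \<one>\<^bsub>G\<^esub> = 1"
  by (simp add: mat_endo_one)

sublocale G: group G
proof (rule groupI)
  fix A B assume AB: "A \<in> carrier G" "B \<in> carrier G"
  have AB': "A * B \<in> carrier_mat n n" using AB unitary_carrier mult_carrier_mat by simp blast
  moreover have "h (app (rep (A * B)) x) (app (rep (A * B)) y) = h x y" for x y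
    using rep_mult[OF AB] rep_unitary AB by (simp add: app_ring)
  ultimately show "A \<otimes>\<^bsub>G\<^esub> B \<in> carrier G" using unitary_mats_iff[OF AB'] by simp
next
  show "\<one>\<^bsub>G\<^esub> \<in> carrier G" using unitary_mats_iff[of "1\<^sub>m n"] by (simp add: mat_endo_one app_ring)
next
  fix A B C assume "A \<in> carrier G" "B \<in> carrier G" "C \<in> carrier G"
  then show "A \<otimes>\<^bsub>G\<^esub> B \<otimes>\<^bsub>G\<^esub> C = A \<otimes>\<^bsub>G\<^esub> (B \<otimes>\<^bsub>G\<^esub> C)"
    using unitary_carrier by (auto intro: assoc_mult_mat)
next
  fix A assume "A \<in> carrier G"
  then show "\<one>\<^bsub>G\<^esub> \<otimes>\<^bsub>G\<^esub> A = A" using left_mult_one_mat[OF unitary_carrier] by simp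
next
  fix A assume A: "A \<in> carrier G"
  define B where "B = transpose_mat (bar_mat q A)"
  have c: "A \<in> carrier_mat n n" "B \<in> carrier_mat n n"
    using A unitary_carrier unfolding B_def bar_mat_def by auto
  have BA: "B * A = 1\<^sub>m n" using A unfolding B_def by (simp add: unitary_mats_def)
  then have AB: "A * B = 1\<^sub>m n" using mat_mult_left_right_inverse c by blast
  have "h (app (rep B) x) (app (rep B) y) = h x y" for x y
  proof -
    have "app (rep A) (app (rep B) u) = u" for u
      using mat_endo_mult[OF c] AB by (simp add: mat_endo_one app_ring flip: app_ring(6))
    then show ?thesis using rep_unitary[OF A, of "app (rep B) x" "app (rep B) y"] by simp
  qed
  then have "B \<in> carrier G" using unitary_mats_iff[OF c(2)] by simp
  then show "\<exists>B\<in>carrier G. B \<otimes>\<^bsub>G\<^esub> A = \<one>\<^bsub>G\<^esub>" using BA by auto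
qed

lemma rep_inj:
  assumes "A \<in> carrier G" "B \<in> carrier G" "\<And>x. x \<in> W \<Longrightarrow> app (rep A) x = app (rep B) x"
  shows "A = B"
  by (rule mat_endo_inj) (use assms unitary_carrier in simp_all)

lemma rep_inv: "A \<in> carrier G \<Longrightarrow> rep (inv\<^bsub>G\<^esub> A) * rep A = 1" "A \<in> carrier G \<Longrightarrow> rep A * rep (inv\<^bsub>G\<^esub> A) = 1"
  using rep_mult[of "inv\<^bsub>G\<^esub> A" A] rep_mult[of A "inv\<^bsub>G\<^esub> A"] rep_one by (metis G.inv_closed G.l_inv G.r_inv)+

lemma rep_pow: "A \<in> carrier G \<Longrightarrow> rep (A [^]\<^bsub>G\<^esub> (k::nat)) = rep A ^ k"
proof (induction k)
  case (Suc k)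
  then show ?case using rep_mult[OF G.nat_pow_closed[OF Suc.prems]] by (simp add: power_Suc2 del: G_simps power_Suc)
qed (simp add: mat_endo_one)

declare G_simps [simp del]

end

section \<open>Characteristic prime to p\<close>

text \<open>If \<open>x ^ p = 1\<close> and \<open>p\<close> is invertible, this sum divided by
  \<open>p\<close> is the projection onto the vectors fixed by \<open>x\<close>. It exists even when
  the field lacks nontrivial \<open>p\<close>-th roots of unity.\<close>

definition geom :: "nat \<Rightarrow> 'r::ring_1 \<Rightarrow> 'r" where
  "geom p x = (\<Sum>j<p. x ^ j)"

text \<open>Multiplication by \<open>x\<close> shifts the terms cyclically, with
  \<open>x ^ p\<close> taking the place of 1.\<close>

lemma mult_geom:
  fixes x :: "'r::ring_1"
  assumes "x ^ p = 1"
  shows "x * geom p x = geom p x" "geom p x * x = geom p x"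
proof -
  have "1 + x * geom p x = (\<Sum>j<Suc p. x ^ j)"
    unfolding geom_def sum.lessThan_Suc_shift by (simp add: sum_distrib_left)
  also have "\<dots> = geom p x + 1" unfolding geom_def using assms by simp
  finally show 1: "x * geom p x = geom p x" by (simp add: add.commute)
  have "geom p x * x = x * geom p x"
    unfolding geom_def sum_distrib_left sum_distrib_right by (simp add: power_commutes)
  then show "geom p x * x = geom p x" using 1 by simp
qed

lemma power_mult_fixed:
  fixes x y :: "'r::monoid_mult"
  shows "x * y = y \<Longrightarrow> x ^ k * y = y" "y * x = y \<Longrightarrow> y * x ^ k = y"
  by (induction k) (simp_all add: mult.assoc[symmetric], metis mult.assoc power_commutes)

lemma geom_mult_fixed:
  fixes x y :: "'r::ring_1"
  shows "x * y = y \<Longrightarrow> geom p x * y = of_nat p * y" "y * x = y \<Longrightarrow> y * geom p x = of_nat p * y"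
  unfolding geom_def sum_distrib_left sum_distrib_right by (simp_all add: power_mult_fixed)

lemma commute_power: "x * y = y * x \<Longrightarrow> x * y ^ k = y ^ k * (x :: 'r::monoid_mult)"
  by (metis power_commuting_commutes)

lemma commute_mult:
  fixes x y a :: "'r::monoid_mult"
  assumes "a * x = x * a" "a * y = y * a"
  shows "a * (x * y) = (x * y) * a"
proof -
  have "a * (x * y) = (a * x) * y" by (simp only: mult.assoc)
  also have "\<dots> = x * (a * y)" unfolding assms(1) by (simp only: mult.assoc)
  finally show ?thesis unfolding assms(2) by (simp only: mult.assoc)
qed

lemma commute_inverse:
  fixes a b y :: "'r::monoid_mult"
  assumes "a * b = 1" "b * a = 1" "y * a = a * y"
  shows "y * b = b * y"
proof -
  have "y * b = b * a * y * b" unfolding assms(2) by simp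
  also have "\<dots> = b * (a * y) * b" by (simp only: mult.assoc)
  also have "\<dots> = b * y * (a * b)" unfolding assms(3)[symmetric] by (simp only: mult.assoc)
  finally show ?thesis unfolding assms(1) by simp
qed

lemma commute_geom: "x * y = y * x \<Longrightarrow> x * geom p y = geom p y * (x :: 'r::ring_1)"
  unfolding geom_def sum_distrib_left sum_distrib_right by (simp add: commute_power)

lemma power_mult_distrib_commute:
  fixes x y :: "'r::monoid_mult"
  assumes "x * y = y * x"
  shows "(x * y) ^ k = x ^ k * y ^ k"
proof (induction k)
  case (Suc k)
  have "(x * y) ^ Suc k = x * (y * x ^ k) * y ^ k" using Suc by (simp add: mult.assoc)
  also have "y * x ^ k = x ^ k * y" using commute_power[of y x k] assms by simp
  finally show ?case by (simp add: mult.assoc)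
qed simp

section \<open>Idempotents attached to two commuting elements of exponent p\<close>

locale commuting_roots =
  fixes p :: nat and c v z :: "'r::ring_1"
  assumes p: "Factorial_Ring.prime p" "p \<ge> 3"
    and c: "\<And>x. c * x = x * c" "c * of_nat p = 1"
    and vz: "v * z = z * v" and vp: "v ^ p = 1" and zp: "z ^ p = 1"
begin

lemma c_cancel: "c * (of_nat p * x) = x"
  by (simp add: mult.assoc[symmetric] c(2))

lemma cancel_p: "of_nat p * x = of_nat p * y \<Longrightarrow> x = (y :: 'r)"
proof -
  assume "of_nat p * x = of_nat p * y"
  then have "c * (of_nat p * x) = c * (of_nat p * y)" by (rule arg_cong)
  then show "x = y" unfolding c_cancel .
qed

lemma c_left: "x * (c * y) = c * (x * y)"
  using c(1)[of x] by (simp add: mult.assoc[symmetric])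

lemma power_mod_p: "z ^ k = z ^ (k mod p)"
proof -
  have "z ^ k = z ^ (p * (k div p) + k mod p)" by simp
  also have "\<dots> = z ^ (k mod p)" unfolding power_add power_mult zp by simp
  finally show ?thesis .
qed

text \<open>\<open>x\<close> and \<open>x ^ m\<close> are powers of each other, so each sum absorbs
  the other element, and the product of the two sums is \<open>p\<close> times either of
  them.\<close>

lemma geom_power_eq:
  fixes x :: 'r
  assumes x: "x ^ p = 1" and l: "(x ^ m) ^ l = x"
  shows "geom p (x ^ m) = geom p x"
proof (rule cancel_p)
  have xm: "(x ^ m) ^ p = 1" using x by (metis mult.commute power_mult power_one)
  have 1: "geom p (x ^ m) * geom p x = of_nat p * geom p x"
    by (rule geom_mult_fixed(1)[OF power_mult_fixed(1)[OF mult_geom(1)[OF x]]])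
  have "geom p (x ^ m) * x = geom p (x ^ m)"
    using power_mult_fixed(2)[OF mult_geom(2)[OF xm], of l] l by simp
  then have "geom p (x ^ m) * geom p x = of_nat p * geom p (x ^ m)"
    by (rule geom_mult_fixed(2))
  then show "of_nat p * geom p (x ^ m) = of_nat p * geom p x" using 1 by simp
qed

text \<open>With \<open>c\<close> as \<open>1 / p\<close>, \<open>f\<close> removes the fixed part
  of \<open>z\<close>. For endomorphisms, on what remains the eigenvalues of \<open>z\<close> in an
  extension field are primitive \<open>p\<close>-th roots of unity, so each joint eigenvector of
  \<open>v\<close> and \<open>z\<close> is fixed by exactly one \<open>v * z ^ i\<close> with
  \<open>i < p\<close>; \<open>e i\<close> projects onto that part.\<close>

definition "f = 1 - c * geom p z"
definition "e i = c * f * geom p (v * z ^ i)"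

lemma f_commute: "x * z = z * x \<Longrightarrow> x * f = f * x"
  using commute_geom[of x z p] c(1)[of x] unfolding f_def
  by (simp add: algebra_simps) (metis mult.assoc)

lemma f_geom: "f * geom p z = 0" "geom p z * f = 0"
proof -
  have "c * geom p z * geom p z = geom p z"
    using geom_mult_fixed(1)[OF mult_geom(1)[OF zp], of p] c(2) by (metis mult.assoc mult_1)
  then show "f * geom p z = 0" unfolding f_def by (simp add: algebra_simps)
  then show "geom p z * f = 0" using f_commute[of "geom p z"] commute_geom[of z z p] by simp
qed

lemma f_idem: "f * f = f"
proof -
  have "f * f = f - f * (c * geom p z)" by (subst (2) f_def) (simp add: algebra_simps)
  also have "f * (c * geom p z) = c * (f * geom p z)" by (metis c(1) mult.assoc)
  finally show ?thesis using f_geom(1) by simp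
qed

text \<open>\<open>j\<close> is invertible modulo \<open>p\<close>, so \<open>z\<close> is a power
  of \<open>z ^ j\<close> and both have the same sum, which \<open>f\<close> annihilates.\<close>

lemma f_geom_power:
  assumes "0 < j" "j < p"
  shows "f * geom p (z ^ j) = 0"
proof -
  have "coprime j p" using assms p(1) by (metis coprime_commute nat_dvd_not_less prime_imp_coprime)
  then obtain m where "[j * m = 1] (mod p)" using cong_solve_coprime_nat by auto
  then have "(j * m) mod p = 1" using p(2) by (simp add: cong_def)
  then have "(z ^ j) ^ m = z" using power_mod_p[of "j * m"] by (simp add: power_mult)
  then show ?thesis using geom_power_eq[OF zp] f_geom(1) by simp
qed

lemma zi: "v * z ^ i = z ^ i * v" "(v * z ^ i) ^ p = 1" "z * (v * z ^ i) = v * z ^ i * z"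
proof -
  show 1: "v * z ^ i = z ^ i * v" using commute_power[OF vz] .
  have "(z ^ i) ^ p = 1" using zp by (metis mult.commute power_mult power_one)
  then show "(v * z ^ i) ^ p = 1" using power_mult_distrib_commute[OF 1, of p] vp by simp
  show "z * (v * z ^ i) = v * z ^ i * z" using vz by (metis mult.assoc power_commutes)
qed

lemma e_commute: "z * e i = e i * z"
proof -
  have "z * e i = c * (z * f) * geom p (v * z ^ i)" unfolding e_def by (metis c(1) mult.assoc)
  also have "\<dots> = c * f * (z * geom p (v * z ^ i))" using f_commute[of z] by (simp add: mult.assoc)
  also have "\<dots> = e i * z" using commute_geom[OF zi(3)] unfolding e_def by (simp add: mult.assoc)
  finally show ?thesis .
qed

lemma f_commute_geom: "f * geom p (v * z ^ i) = geom p (v * z ^ i) * f"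
  using f_commute[of "geom p (v * z ^ i)"] commute_geom[OF zi(3)[of i], of p] by simp

lemma e_mult: "e i * e j = c * (c * (f * (geom p (v * z ^ i) * geom p (v * z ^ j))))"
proof -
  let ?P = "geom p (v * z ^ i)" and ?R = "geom p (v * z ^ j)"
  have "e i * e j = c * (f * (?P * (c * (f * ?R))))" unfolding e_def by (simp only: mult.assoc)
  also have "\<dots> = c * (c * (f * ((?P * f) * ?R)))" unfolding c_left[of ?P] c_left[of f] by (simp only: mult.assoc)
  also have "\<dots> = c * (c * ((f * f) * (?P * ?R)))" unfolding f_commute_geom[symmetric] by (simp only: mult.assoc)
  finally show ?thesis unfolding f_idem .
qed

lemma e_idem: "e i * e i = e i"
proof -
  let ?P = "geom p (v * z ^ i)"
  have "e i * e i = c * (c * (f * (of_nat p * ?P)))"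
    unfolding e_mult geom_mult_fixed(1)[OF mult_geom(1)[OF zi(2)]] ..
  also have "f * (of_nat p * ?P) = of_nat p * (f * ?P)"
    using mult_of_nat_commute[of p f] by (simp add: mult.assoc[symmetric])
  finally show ?thesis unfolding c_cancel e_def by (simp only: mult.assoc)
qed

text \<open>Next to \<open>geom p v\<close> the element \<open>v\<close> may be replaced by 1, which
  turns \<open>v * z ^ i\<close> into \<open>z ^ i\<close>; the sum of the latter is annihilated by
  \<open>f\<close>.\<close>

lemma e_orth:
  assumes "0 < i" "i < p"
  shows "e 0 * e i = 0"
proof -
  have vP: "geom p v * v ^ j = geom p v" for j using power_mult_fixed(2)[OF mult_geom(2)[OF vp]] .
  have "geom p v * geom p (v * z ^ i) = (\<Sum>j<p. geom p v * (v * z ^ i) ^ j)"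
    unfolding geom_def[of p "v * z ^ i"] by (simp add: sum_distrib_left)
  also have "\<dots> = (\<Sum>j<p. geom p v * (z ^ i) ^ j)"
    using power_mult_distrib_commute[OF zi(1)] vP by (simp add: mult.assoc[symmetric])
  also have "\<dots> = geom p v * geom p (z ^ i)" unfolding geom_def[of p "z ^ i"] by (simp add: sum_distrib_left)
  finally have PP: "geom p v * geom p (v * z ^ i) = geom p v * geom p (z ^ i)" .
  have fP: "f * geom p v = geom p v * f" using f_commute_geom[of 0] by simp
  have "f * (geom p v * geom p (z ^ i)) = geom p v * (f * geom p (z ^ i))"
    using fP by (simp add: mult.assoc[symmetric])
  then have "f * (geom p v * geom p (z ^ i)) = 0" using f_geom_power[OF assms] by simp
  then show ?thesis using e_mult[of 0 i] PP by simp
qed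

text \<open>Exchanging the sums collects powers of \<open>v\<close>. The factor \<open>f\<close>
  kills the coefficient of \<open>v ^ j\<close> unless \<open>j = 0\<close>, where that coefficient
  is \<open>p\<close>.\<close>

lemma sum_e: "(\<Sum>i<p. e i) = f"
proof -
  have p0: "{..<p} = insert 0 {0<..<p}" using p(2) by auto
  have "(\<Sum>i<p. geom p (v * z ^ i)) = (\<Sum>i<p. \<Sum>j<p. v ^ j * (z ^ j) ^ i)"
    unfolding geom_def using power_mult_distrib_commute[OF zi(1)]
    by (simp add: power_mult[symmetric] mult.commute)
  also have "\<dots> = (\<Sum>j<p. v ^ j * geom p (z ^ j))"
    unfolding geom_def sum_distrib_left by (rule sum.swap)
  finally have s: "(\<Sum>i<p. geom p (v * z ^ i)) = (\<Sum>j<p. v ^ j * geom p (z ^ j))" .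
  have fv: "f * v ^ j = v ^ j * f" for j using f_commute[of "v ^ j"] commute_power[of z v j] vz by simp
  have "(\<Sum>i<p. e i) = c * (f * (\<Sum>j<p. v ^ j * geom p (z ^ j)))"
    unfolding e_def s[symmetric] by (simp add: sum_distrib_left mult.assoc)
  also have "f * (\<Sum>j<p. v ^ j * geom p (z ^ j)) = (\<Sum>j<p. v ^ j * (f * geom p (z ^ j)))"
    unfolding sum_distrib_left using fv by (intro sum.cong) (simp_all add: mult.assoc[symmetric])
  also have "\<dots> = f * geom p 1 + (\<Sum>j\<in>{0<..<p}. v ^ j * (f * geom p (z ^ j)))"
    unfolding p0 by simp
  also have "(\<Sum>j\<in>{0<..<p}. v ^ j * (f * geom p (z ^ j))) = 0"
    using f_geom_power by (intro sum.neutral) auto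
  also have "geom p (1::'r) = of_nat p" unfolding geom_def by simp
  also have "c * (f * of_nat p + 0) = f" using c by (metis add_0_right mult.assoc mult_1_right)
  finally show ?thesis .
qed

text \<open>The element acting as \<open>z\<close> on the range of \<open>e 0\<close> alone. Its
  powers have the same shape because \<open>e 0\<close> is an idempotent commuting with
  \<open>z\<close>.\<close>

definition "w = 1 + e 0 * (z - 1)"

lemma w_power: "w ^ k = 1 + e 0 * (z ^ k - 1)"
proof (induction k)
  case (Suc k)
  let ?B = "z ^ k - 1"
  have "(z - 1) * e 0 = e 0 * (z - 1)" using e_commute[of 0] by (simp add: left_diff_distrib right_diff_distrib)
  then have ze: "(z - 1) * (e 0 * ?B) = e 0 * ((z - 1) * ?B)" by (simp only: mult.assoc[symmetric])
  have "w ^ Suc k = (1 + e 0 * (z - 1)) * (1 + e 0 * ?B)" unfolding power_Suc Suc by (simp only: w_def)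
  also have "\<dots> = 1 + e 0 * ?B + (e 0 * (z - 1) + e 0 * ((z - 1) * (e 0 * ?B)))"
    by (simp only: distrib_right distrib_left mult_1 mult_1_right mult.assoc add_ac)
  also have "e 0 * ((z - 1) * (e 0 * ?B)) = (e 0 * e 0) * ((z - 1) * ?B)" unfolding ze by (simp only: mult.assoc)
  also have "1 + e 0 * ?B + (e 0 * (z - 1) + (e 0 * e 0) * ((z - 1) * ?B)) = 1 + e 0 * (?B + (z - 1) + (z - 1) * ?B)"
    unfolding e_idem by (simp only: distrib_left add.assoc)
  also have "?B + (z - 1) + (z - 1) * ?B = z ^ Suc k - 1" by (simp add: algebra_simps)
  finally show ?case .
qed simp

lemma w_power_p: "w ^ p = 1"
  unfolding w_power zp by simp

text \<open>The idempotents \<open>e i\<close> are permuted by conjugation with \<open>g\<close>, in a cycle of length at least 3.\<close>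

lemma quadratic_imp_trivial:
  assumes g: "g * gi = 1" "gi * g = 1" and gv: "g * v * gi = v * z" and gz: "g * z = z * g"
    and quad: "g * (w ^ (p - 1) * (g * w * gi)) = (w ^ (p - 1) * (g * w * gi)) * g"
  shows "z = 1"
proof -
  have gz': "g * z * gi = z" using gz g(1) by (metis mult.assoc mult_1_right)
  have conj_mult: "g * (x * y) * gi = (g * x * gi) * (g * y * gi)" for x y
    using g(2) by (metis mult.assoc mult_1)
  have conj_1: "g * 1 * gi = 1" using g by simp
  have conj_power: "g * x ^ k * gi = (g * x * gi) ^ k" for x k
    by (induction k) (use conj_1 conj_mult in simp_all)
  have conj_sum: "g * (\<Sum>i\<in>I. x i) * gi = (\<Sum>i\<in>I. g * x i * gi)" for x :: "nat \<Rightarrow> 'r" and I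
    by (simp add: sum_distrib_left sum_distrib_right)
  have conj_geom: "g * geom p x * gi = geom p (g * x * gi)" for x
    unfolding geom_def by (simp add: conj_sum conj_power)
  have conj_c: "g * c * gi = c" by (metis c(1) g(1) mult.assoc mult_1_right)
  have conj_f: "g * f * gi = f"
  proof -
    have "g * f * gi = g * 1 * gi - g * (c * geom p z) * gi" unfolding f_def by (simp add: algebra_simps)
    also have "\<dots> = f" unfolding conj_mult conj_1 conj_c conj_geom gz' f_def ..
    finally show ?thesis .
  qed
  \<comment> \<open>Conjugation by \<open>g\<close> takes \<open>v * z ^ i\<close> to
    \<open>v * z ^ Suc i\<close> and fixes \<open>c\<close> and \<open>f\<close>.\<close>
  have conj_e: "g * e i * gi = e (Suc i)" for i
    unfolding e_def conj_mult conj_c conj_f conj_geom conj_power gv gz' by (simp add: mult.assoc)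
  have "e 0 = 0"
  proof -
    \<comment> \<open>\<open>w ^ (p - 1)\<close> is the inverse of \<open>w\<close>, so
      \<open>y\<close> is the commutator of \<open>w\<close> with \<open>g\<close>, and
      \<open>quad\<close> says that conjugation by \<open>g\<close> fixes it.\<close>
    define y where "y = w ^ (p - 1) * (g * w * gi)"
    have gy: "g * y * gi = y" using quad g(1) unfolding y_def[symmetric] by (metis mult.assoc mult_1_right)
    have wy: "w * y = g * w * gi"
    proof -
      have "w * w ^ (p - 1) = w ^ p" using p(2) by (simp add: power_eq_if)
      then show ?thesis unfolding y_def using w_power_p by (simp add: mult.assoc[symmetric])
    qed
    have w1: "g * w * gi = 1 + e 1 * (z - 1)"
    proof -
      have "g * w * gi = g * 1 * gi + g * (e 0 * (z - 1)) * gi" unfolding w_def by (simp add: algebra_simps)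
      also have "g * (z - 1) * gi = z - 1" using gz' g by (simp add: algebra_simps)
      then have "g * (e 0 * (z - 1)) * gi = e 1 * (z - 1)" unfolding conj_mult conj_e by simp
      finally show ?thesis using conj_1 by simp
    qed
    have w2: "g * (g * w * gi) * gi = 1 + e 2 * (z - 1)"
    proof -
      have "g * (g * w * gi) * gi = g * 1 * gi + g * (e 1 * (z - 1)) * gi" unfolding w1 by (simp add: algebra_simps)
      also have "g * (z - 1) * gi = z - 1" using gz' g by (simp add: algebra_simps)
      then have "g * (e 1 * (z - 1)) * gi = e 2 * (z - 1)" unfolding conj_mult conj_e by (simp add: numeral_2_eq_2)
      finally show ?thesis using conj_1 by simp
    qed
    \<comment> \<open>As \<open>p \<ge> 3\<close>, both 1 and 2 are indices at which
      \<open>e_orth\<close> applies; so \<open>e 0\<close> absorbs both conjugates of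
      \<open>w\<close>.\<close>
    have e01: "e 0 * (g * w * gi) = e 0"
      unfolding w1 using e_orth[of 1] p(2) by (simp add: distrib_left mult.assoc[symmetric])
    have e02: "e 0 * (g * (g * w * gi) * gi) = e 0"
      unfolding w2 using e_orth[of 2] p(2) by (simp add: distrib_left mult.assoc[symmetric])
    \<comment> \<open>Conjugating \<open>w * y = g * w * gi\<close> by \<open>g\<close> leaves
      \<open>y\<close> alone, so \<open>e 0\<close> absorbs \<open>y\<close> too. Multiplying the
      original equation by \<open>e 0\<close> then shows that \<open>z\<close> fixes
      \<open>e 0\<close>, which \<open>f\<close> excludes unless \<open>e 0 = 0\<close>.\<close>
    have "g * (g * w * gi) * gi = (g * w * gi) * y" using conj_mult[of w y] wy gy by simp
    then have "e 0 * (g * (g * w * gi) * gi) = (e 0 * (g * w * gi)) * y" by (simp only: mult.assoc)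
    then have "e 0 * y = e 0" unfolding e01 e02 by simp
    moreover have "e 0 * w = z * e 0"
    proof -
      have "e 0 * w = e 0 + (e 0 * e 0) * (z - 1)" unfolding w_def by (simp only: distrib_left mult_1_right mult.assoc)
      also have "\<dots> = e 0 * z" unfolding e_idem by (simp add: right_diff_distrib)
      finally show ?thesis using e_commute[of 0] by simp
    qed
    then have "z * (e 0 * y) = e 0 * (w * y)" by (simp add: mult.assoc[symmetric])
    ultimately have "z * e 0 = e 0" using e01 wy by simp
    then have "geom p z * e 0 = of_nat p * e 0" by (rule geom_mult_fixed(1))
    moreover have "geom p z * e 0 = c * (geom p z * f) * geom p v" unfolding e_def by (simp add: mult.assoc c_left[of "geom p z"])
    ultimately have "of_nat p * e 0 = of_nat p * 0" using f_geom(2) by simp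
    then show ?thesis by (rule cancel_p)
  qed
  \<comment> \<open>All \<open>e i\<close> are conjugate to \<open>e 0\<close>; with them their sum
    \<open>f\<close> vanishes, so \<open>z\<close> has only a fixed part.\<close>
  then have "e i = 0" for i
  proof (induction i)
    case (Suc i)
    then show ?case using conj_e[of i] by simp
  qed
  then have "f = 0" using sum_e by simp
  then have "c * geom p z = 1" unfolding f_def by simp
  then show "z = 1" using mult_geom(1)[OF zp] by (metis c(1) mult.assoc mult_1_right)
qed

end

section \<open>Adjoints, and the theorem for p not dividing q\<close>

context unitary_space
begin

definition adj :: "'a endo \<Rightarrow> 'a endo \<Rightarrow> bool" where
  "adj f g \<longleftrightarrow> (\<forall>x y. h (app f x) y = h x (app g y))"

lemma adj_one: "adj 1 1"
  by (simp add: adj_def app_ring)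

lemma adj_add: "adj f g \<Longrightarrow> adj f' g' \<Longrightarrow> adj (f + f') (g + g')"
  by (simp add: adj_def app_ring h_add)

lemma adj_diff: "adj f g \<Longrightarrow> adj f' g' \<Longrightarrow> adj (f - f') (g - g')"
  by (simp add: adj_def app_ring h_diff)

lemma adj_mult: "adj f g \<Longrightarrow> adj f' g' \<Longrightarrow> adj (f * f') (g' * g)"
  by (simp add: adj_def app_ring)

lemma adj_power: "adj f g \<Longrightarrow> adj (f ^ k) (g ^ k)"
proof (induction k)
  case (Suc k)
  then show ?case using adj_mult[of f g "f ^ k" "g ^ k"] by (simp add: power_commutes)
qed (simp add: adj_one)

lemma adj_geom: "adj f g \<Longrightarrow> adj (geom k f) (geom k g)"
proof (induction k)
  case 0
  then show ?case by (simp add: adj_def geom_def app_ring)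
next
  case (Suc k)
  then show ?case using adj_add[OF Suc.IH adj_power[of f g k]] by (simp add: geom_def)
qed

lemma adj_scalar:
  assumes "c ^ q = c"
  shows "adj (scalar_endo c) (scalar_endo c)"
  using assms by (simp add: adj_def app_scalar_endo h_scale)

lemma adj_rep:
  assumes "A \<in> carrier G"
  shows "adj (rep A) (rep (inv\<^bsub>G\<^esub> A))"
  unfolding adj_def
proof (intro allI)
  fix x y
  have "h (app (rep A) x) y = h (app (rep A) x) (app (rep A) (app (rep (inv\<^bsub>G\<^esub> A)) y))"
    using rep_inv(2)[OF assms] by (metis app_ring(2,6))
  then show "h (app (rep A) x) y = h x (app (rep (inv\<^bsub>G\<^esub> A)) y)"
    using rep_unitary[OF assms] by simp
qed

definition preserves_W :: "'a endo \<Rightarrow> bool" where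
  "preserves_W f \<longleftrightarrow> (\<forall>x\<in>W. app f x \<in> W)"

lemma preserves_W:
  "preserves_W 0" "preserves_W 1" "preserves_W (scalar_endo c)" "preserves_W (rep A)"
  "preserves_W f \<Longrightarrow> preserves_W g \<Longrightarrow> preserves_W (f + g)"
  "preserves_W f \<Longrightarrow> preserves_W g \<Longrightarrow> preserves_W (f - g)"
  "preserves_W f \<Longrightarrow> preserves_W g \<Longrightarrow> preserves_W (f * g)"
  by (simp_all add: preserves_W_def app_ring app_scalar_endo supp_fun_closed)

lemma preserves_W_power: "preserves_W f \<Longrightarrow> preserves_W (f ^ k)"
  by (induction k) (simp_all add: preserves_W)

lemma preserves_W_geom: "preserves_W f \<Longrightarrow> preserves_W (geom k f)"
  by (induction k) (simp_all add: geom_def preserves_W preserves_W_power)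

lemma power_q_of_nat: "(of_nat k :: 'a) ^ q = of_nat k"
  by (induction k) (simp_all add: power_q_add)

lemma rep_inv_power:
  assumes A: "A \<in> carrier G" and p: "A [^]\<^bsub>G\<^esub> p = \<one>\<^bsub>G\<^esub>" "p \<ge> 1"
  shows "rep (inv\<^bsub>G\<^esub> A) = rep A ^ (p - 1)" "rep A ^ p = 1"
proof -
  show 1: "rep A ^ p = 1" using rep_pow[OF A, of p] p(1) rep_one by simp
  have 2: "rep A * rep A ^ (p - 1) = 1" using 1 p(2) by (simp add: power_eq_if)
  have "rep (inv\<^bsub>G\<^esub> A) * (rep A * rep A ^ (p - 1)) = rep A ^ (p - 1)"
    by (simp add: mult.assoc[symmetric] rep_inv(1)[OF A])
  then show "rep (inv\<^bsub>G\<^esub> A) = rep A ^ (p - 1)" unfolding 2 by simp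
qed

text \<open>The adjoint of \<open>rep v\<close> is its inverse, a power generating the same cyclic
  group, so averages are self-adjoint; the scalar \<open>1 / p\<close> lies in the prime field and
  is fixed by the \<open>q\<close>-th power. Hence \<open>e 0\<close> is self-adjoint and the
  adjoint of \<open>w\<close> is its inverse.\<close>

lemma root_projection_unitary:
  assumes p: "Factorial_Ring.prime p" "p \<ge> 3" "of_nat p \<noteq> (0::'a)"
    and v: "v \<in> carrier G" "v [^]\<^bsub>G\<^esub> p = \<one>\<^bsub>G\<^esub>" and z: "z \<in> carrier G" "z [^]\<^bsub>G\<^esub> p = \<one>\<^bsub>G\<^esub>"
    and vz: "v \<otimes>\<^bsub>G\<^esub> z = z \<otimes>\<^bsub>G\<^esub> v"
  defines "c \<equiv> scalar_endo (1 / of_nat p)"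
  shows "commuting_roots p c (rep v) (rep z)"
    and "\<exists>A\<in>carrier G. rep A = commuting_roots.w p c (rep v) (rep z)"
proof -
  have p1: "p \<ge> 1" using p(2) by simp
  have vzr: "rep v * rep z = rep z * rep v" using rep_mult[OF v(1) z(1)] rep_mult[OF z(1) v(1)] vz by simp
  note vr = rep_inv_power[OF v p1] and zr = rep_inv_power[OF z p1]
  have cp: "c * of_nat p = 1"
    unfolding c_def of_nat_endo by (rule endo_eqI) (use p(3) in \<open>simp add: app_ring app_scalar_endo\<close>)
  show cr: "commuting_roots p c (rep v) (rep z)"
    by unfold_locales (use p vzr vr zr cp scalar_endo_central in \<open>auto simp: c_def\<close>)
  interpret commuting_roots p c "rep v" "rep z" by (rule cr)
  have geom_inv: "geom p (x ^ (p - 1)) = geom p x" if x: "x ^ p = 1" for x :: "'a endo"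
  proof (rule geom_power_eq[OF x])
    obtain m where m: "p = Suc (Suc m)" using p(2) by (metis Suc_le_D numeral_3_eq_3 Suc_le_mono le_SucE)
    \<comment> \<open>\<open>p - 1\<close> is its own inverse modulo \<open>p\<close>, so taking
      inverses twice returns \<open>x\<close>.\<close>
    have "(p - 1) * (p - 1) = p * (p - 2) + 1" unfolding m by simp
    then show "(x ^ (p - 1)) ^ (p - 1) = x" using x by (simp add: power_mult[symmetric] power_add) (simp add: power_mult)
  qed
  have adj_v: "adj (geom p (rep v)) (geom p (rep v))"
    using adj_geom[OF adj_rep[OF v(1)], of p] vr geom_inv by simp
  have adj_z: "adj (geom p (rep z)) (geom p (rep z))"
    using adj_geom[OF adj_rep[OF z(1)], of p] zr geom_inv by simp
  have "(1 / of_nat p :: 'a) ^ q = 1 / of_nat p" by (simp add: power_divide power_q_of_nat)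
  then have adj_c: "adj c c" unfolding c_def by (rule adj_scalar)
  have adj_f: "adj f f"
    using adj_diff[OF adj_one adj_mult[OF adj_c adj_z]] c(1)[of "geom p (rep z)"] unfolding f_def by simp
  have "adj (e 0) (geom p (rep v) * (f * c))"
    unfolding e_def using adj_mult[OF adj_mult[OF adj_c adj_f] adj_v] by simp
  moreover have "geom p (rep v) * (f * c) = e 0"
    unfolding e_def using f_commute_geom[of 0] c(1) by (simp, metis mult.assoc)
  ultimately have adj_e: "adj (e 0) (e 0)" by simp
  have "adj (rep z - 1) (rep z ^ (p - 1) - 1)"
    using adj_diff[OF adj_rep[OF z(1)] adj_one] zr by simp
  then have "adj w (1 + (rep z ^ (p - 1) - 1) * e 0)"
    unfolding w_def by (intro adj_add[OF adj_one] adj_mult[OF adj_e])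
  moreover have "(rep z ^ (p - 1) - 1) * e 0 = e 0 * (rep z ^ (p - 1) - 1)"
    using commute_power[of "e 0" "rep z" "p - 1"] e_commute[of 0] by (simp add: algebra_simps)
  ultimately have "adj w (w ^ (p - 1))" unfolding w_power[of "p - 1"] by simp
  moreover have "w ^ (p - 1) * w = 1"
    using w_power_p p1 by (metis power_minus_mult Suc_le_eq One_nat_def)
  ultimately have "h (app w x) (app w y) = h x y" for x y
    unfolding adj_def by (metis app_ring(2,6))
  moreover have "mat_like n w"
    unfolding mat_like_def
  proof (intro conjI allI impI)
    fix x
    have "preserves_W (e 0)"
      unfolding e_def f_def
      by (intro preserves_W(2,4,6,7) preserves_W_geom preserves_W_power preserves_W(3)[of "1 / of_nat p", folded c_def])
    moreover have "app (rep z) x - x \<in> W" using mat_like_mat_endo unfolding mat_like_def by blast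
    moreover have "app w x - x = app (e 0) (app (rep z) x - x)" unfolding w_def by (simp add: app_ring)
    ultimately show "app w x - x \<in> W" unfolding preserves_W_def by simp
    assume "\<forall>i<n. x i = 0"
    then have "app (rep z) x = x" using mat_like_mat_endo unfolding mat_like_def by blast
    then show "app w x = x" unfolding w_def by (simp add: app_ring)
  qed
  ultimately show "\<exists>A\<in>carrier G. rep A = w" using unitaryI by metis
qed

theorem thompson_le_oliver_coprime:
  assumes p: "Factorial_Ring.prime p" "p \<ge> 3" "of_nat p \<noteq> (0::'a)" and Syl: "sylow_subgroup G p S"
  shows "thompson_subgroup G p S \<subseteq> oliver_subgroup G p S"
proof -
  obtain ks where S: "subgroup S G" "card S = p ^ ks" using Syl unfolding sylow_subgroup_def by blast
  have p1: "p \<ge> 1" and p2: "p \<ge> 2" using p(2) by simp_all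
  define V where "V = {x \<in> centralizer_in G S (oliver_subgroup G p S). x [^]\<^bsub>G\<^esub> p = \<one>\<^bsub>G\<^esub>}"
  note V = G.oliver_subgroup_contains_centralizer[OF finite_G p(1,2) S V_def]
  note V' = G.elem_abelian_subD[OF V(1)]
  note Xn = G.oliver_subgroup_normal[OF finite_G S(1) p2]
  have Sc: "x \<in> carrier G" if "x \<in> S" for x using that subgroup.mem_carrier[OF S(1)] by blast
  have Vc: "x \<in> carrier G" if "x \<in> V" for x using that V'(3) by blast
  have rep_comm: "rep x * rep y = rep y * rep x \<longleftrightarrow> x \<otimes>\<^bsub>G\<^esub> y = y \<otimes>\<^bsub>G\<^esub> x" if "x \<in> carrier G" "y \<in> carrier G" for x y
    using that rep_mult rep_inj[of "x \<otimes>\<^bsub>G\<^esub> y" "y \<otimes>\<^bsub>G\<^esub> x"] G.m_closed by (metis (no_types))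
  \<comment> \<open>Every polynomial in elements of \<open>V\<close> with central coefficients
    satisfies the commutation condition, which is how \<open>w\<close> will be caught.\<close>
  define D where "D = {d \<in> carrier G. d [^]\<^bsub>G\<^esub> p = \<one>\<^bsub>G\<^esub> \<and>
    (\<forall>y. (\<forall>u\<in>V. y * rep u = rep u * y) \<longrightarrow> y * rep d = rep d * y)}"
  have Dc: "d \<in> carrier G" if "d \<in> D" for d using that unfolding D_def by simp
  have DP: "y * rep d = rep d * y" if "d \<in> D" "\<And>u. u \<in> V \<Longrightarrow> y * rep u = rep u * y" for d y
    using that unfolding D_def by simp
  \<comment> \<open>The abelian group \<open>V\<close> lies in its own commutant, so
    \<open>D\<close> commutes with \<open>V\<close>; thus \<open>D\<close> lies in the commutant as
    well and is abelian.\<close>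
  have DV: "d \<otimes>\<^bsub>G\<^esub> u = u \<otimes>\<^bsub>G\<^esub> d" if "d \<in> D" "u \<in> V" for d u
  proof -
    have "rep u * rep u' = rep u' * rep u" if "u' \<in> V" for u'
      using rep_comm[OF Vc Vc] that \<open>u \<in> V\<close> V'(4) by blast
    then have "rep u * rep d = rep d * rep u" using DP[OF that(1)] by blast
    then show ?thesis using rep_comm[OF Dc[OF that(1)] Vc[OF that(2)]] by simp
  qed
  have Dcomm: "x \<otimes>\<^bsub>G\<^esub> y = y \<otimes>\<^bsub>G\<^esub> x" if "x \<in> D" "y \<in> D" for x y
  proof -
    have "rep x * rep u = rep u * rep x" if "u \<in> V" for u
      using DV[OF \<open>x \<in> D\<close> that] rep_comm[OF Dc[OF \<open>x \<in> D\<close>] Vc[OF that]] by simp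
    then have "rep x * rep y = rep y * rep x" using DP[OF that(2)] by blast
    then show ?thesis using rep_comm[OF Dc[OF that(1)] Dc[OF that(2)]] by simp
  qed
  have Dsub: "subgroup D G"
  proof (rule G.subgroupI)
    show "D \<subseteq> carrier G" using Dc by blast
    have "\<one>\<^bsub>G\<^esub> \<in> D" unfolding D_def using rep_one G.nat_pow_one by simp
    then show "D \<noteq> {}" by blast
    fix x assume x: "x \<in> D"
    have "y * rep (inv\<^bsub>G\<^esub> x) = rep (inv\<^bsub>G\<^esub> x) * y" if y: "\<forall>u\<in>V. y * rep u = rep u * y" for y
    proof -
      have "y * rep x = rep x * y" using DP[OF x] y by blast
      then show ?thesis using commute_inverse[OF rep_inv(2)[OF Dc[OF x]] rep_inv(1)[OF Dc[OF x]]] by blast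
    qed
    then show "inv\<^bsub>G\<^esub> x \<in> D" using x unfolding D_def by (simp add: G.nat_pow_inv)
    fix y assume y: "y \<in> D"
    have "(x \<otimes>\<^bsub>G\<^esub> y) [^]\<^bsub>G\<^esub> p = \<one>\<^bsub>G\<^esub>"
      using G.pow_mult_distrib[OF Dcomm[OF x y] Dc[OF x] Dc[OF y]] x y unfolding D_def by simp
    moreover have "a * rep (x \<otimes>\<^bsub>G\<^esub> y) = rep (x \<otimes>\<^bsub>G\<^esub> y) * a" if a: "\<forall>u\<in>V. a * rep u = rep u * a" for a
    proof -
      have "a * rep x = rep x * a" "a * rep y = rep y * a" using DP[OF x] DP[OF y] a by blast+
      then show ?thesis unfolding rep_mult[OF Dc[OF x] Dc[OF y]] by (rule commute_mult)
    qed
    ultimately show "x \<otimes>\<^bsub>G\<^esub> y \<in> D" using Dc[OF x] Dc[OF y] unfolding D_def by simp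
  qed
  have Dn: "s \<otimes>\<^bsub>G\<^esub> d \<otimes>\<^bsub>G\<^esub> inv\<^bsub>G\<^esub> s \<in> D" if s: "s \<in> S" and d: "d \<in> D" for s d
  proof -
    note sc = Sc[OF s] and dc = Dc[OF d]
    have rs: "rep (s \<otimes>\<^bsub>G\<^esub> x \<otimes>\<^bsub>G\<^esub> inv\<^bsub>G\<^esub> s) = rep s * rep x * rep (inv\<^bsub>G\<^esub> s)" if "x \<in> carrier G" for x
      using that sc by (simp add: rep_mult)
    have pw: "(s \<otimes>\<^bsub>G\<^esub> d \<otimes>\<^bsub>G\<^esub> inv\<^bsub>G\<^esub> s) [^]\<^bsub>G\<^esub> k = s \<otimes>\<^bsub>G\<^esub> d [^]\<^bsub>G\<^esub> k \<otimes>\<^bsub>G\<^esub> inv\<^bsub>G\<^esub> s" for k :: nat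
      using sc dc by (induction k) (simp_all add: G.word_simps)
    have "y * rep (s \<otimes>\<^bsub>G\<^esub> d \<otimes>\<^bsub>G\<^esub> inv\<^bsub>G\<^esub> s) = rep (s \<otimes>\<^bsub>G\<^esub> d \<otimes>\<^bsub>G\<^esub> inv\<^bsub>G\<^esub> s) * y"
      if y: "\<forall>u\<in>V. y * rep u = rep u * y" for y
    proof -
      \<comment> \<open>Conjugating \<open>y\<close> back by \<open>s\<close> keeps it in the
        commutant, because \<open>S\<close> normalises \<open>V\<close>.\<close>
      let ?y = "rep (inv\<^bsub>G\<^esub> s) * y * rep s"
      have "?y * rep u = rep u * ?y" if u: "u \<in> V" for u
      proof -
        have "y * rep (s \<otimes>\<^bsub>G\<^esub> u \<otimes>\<^bsub>G\<^esub> inv\<^bsub>G\<^esub> s) = rep (s \<otimes>\<^bsub>G\<^esub> u \<otimes>\<^bsub>G\<^esub> inv\<^bsub>G\<^esub> s) * y" using y V(2)[OF s u] by blast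
        then have "y * (rep s * rep u * rep (inv\<^bsub>G\<^esub> s)) = rep s * rep u * rep (inv\<^bsub>G\<^esub> s) * y"
          unfolding rs[OF Vc[OF u]] .
        then have "rep (inv\<^bsub>G\<^esub> s) * (y * (rep s * rep u * rep (inv\<^bsub>G\<^esub> s))) * rep s
          = rep (inv\<^bsub>G\<^esub> s) * (rep s * rep u * rep (inv\<^bsub>G\<^esub> s) * y) * rep s" by simp
        moreover have "rep (inv\<^bsub>G\<^esub> s) * (y * (rep s * rep u * rep (inv\<^bsub>G\<^esub> s))) * rep s = ?y * rep u * (rep (inv\<^bsub>G\<^esub> s) * rep s)"
          by (simp add: mult.assoc)
        moreover have "rep (inv\<^bsub>G\<^esub> s) * (rep s * rep u * rep (inv\<^bsub>G\<^esub> s) * y) * rep s = (rep (inv\<^bsub>G\<^esub> s) * rep s) * (rep u * ?y)"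
          by (simp add: mult.assoc)
        ultimately show ?thesis using rep_inv(1)[OF sc] by simp
      qed
      then have "?y * rep d = rep d * ?y" using DP[OF d] by blast
      then have "rep s * (?y * rep d) * rep (inv\<^bsub>G\<^esub> s) = rep s * (rep d * ?y) * rep (inv\<^bsub>G\<^esub> s)" by simp
      moreover have "rep s * (?y * rep d) * rep (inv\<^bsub>G\<^esub> s) = (rep s * rep (inv\<^bsub>G\<^esub> s)) * (y * (rep s * rep d * rep (inv\<^bsub>G\<^esub> s)))"
        by (simp add: mult.assoc)
      moreover have "rep s * (rep d * ?y) * rep (inv\<^bsub>G\<^esub> s) = rep s * rep d * rep (inv\<^bsub>G\<^esub> s) * y * (rep s * rep (inv\<^bsub>G\<^esub> s))"
        by (simp add: mult.assoc)
      ultimately show ?thesis unfolding rs[OF dc] using rep_inv(2)[OF sc] by simp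
    qed
    moreover have "(s \<otimes>\<^bsub>G\<^esub> d \<otimes>\<^bsub>G\<^esub> inv\<^bsub>G\<^esub> s) [^]\<^bsub>G\<^esub> p = \<one>\<^bsub>G\<^esub>"
      unfolding pw using d sc G.r_inv[OF sc] unfolding D_def by (simp)
    ultimately show ?thesis using sc dc unfolding D_def by (simp)
  qed
  have Dp: "x [^]\<^bsub>G\<^esub> p = \<one>\<^bsub>G\<^esub>" if "x \<in> D" for x using that unfolding D_def by simp
  have "finite D" using finite_subset[OF subgroup.subset[OF Dsub] finite_G] .
  then obtain i where "card D = p ^ i" using G.elem_p_group_card[OF p(1) Dsub _ Dp] by blast
  then have DS: "D \<subseteq> S" using G.sylow_contains_normalized_p_subgroup[OF finite_G p(1) Syl Dsub _ Dn] by blast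
  \<comment> \<open>The Oliver subgroup centralises \<open>V\<close>, so its elements lie in the
    commutant and commute with \<open>d\<close>. Being in \<open>S\<close> and of exponent
    \<open>p\<close>, \<open>d\<close> meets the definition of \<open>V\<close>.\<close>
  have "d \<in> V" if d: "d \<in> D" for d
  proof -
    have "d \<otimes>\<^bsub>G\<^esub> x = x \<otimes>\<^bsub>G\<^esub> d" if x: "x \<in> oliver_subgroup G p S" for x
    proof -
      have xc: "x \<in> carrier G" using x Xn(2) Sc by blast
      have "rep x * rep u = rep u * rep x" if "u \<in> V" for u
        using that x rep_comm[OF xc Vc[OF that]] unfolding V_def centralizer_in_def by auto
      then have "rep x * rep d = rep d * rep x" using DP[OF d] by blast
      then show ?thesis using rep_comm[OF xc Dc[OF d]] by simp
    qed
    then show ?thesis using d DS Dp unfolding V_def centralizer_in_def by auto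
  qed
  then have DV: "D \<subseteq> V" by blast
  have "thompson_subgroup G p S \<subseteq> centralizer_in G S V"
  proof (rule G.thompson_subgroup_le_centralizer[OF finite_G p(1) S V(1,2)])
    fix g assume g: "g \<in> S" and quad: "\<And>a. a \<in> V \<Longrightarrow>
      g \<otimes>\<^bsub>G\<^esub> (inv\<^bsub>G\<^esub> a \<otimes>\<^bsub>G\<^esub> (g \<otimes>\<^bsub>G\<^esub> a \<otimes>\<^bsub>G\<^esub> inv\<^bsub>G\<^esub> g)) =
      (inv\<^bsub>G\<^esub> a \<otimes>\<^bsub>G\<^esub> (g \<otimes>\<^bsub>G\<^esub> a \<otimes>\<^bsub>G\<^esub> inv\<^bsub>G\<^esub> g)) \<otimes>\<^bsub>G\<^esub> g"
    have gc: "g \<in> carrier G" using Sc[OF g] .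
    have "g \<otimes>\<^bsub>G\<^esub> v = v \<otimes>\<^bsub>G\<^esub> g" if v: "v \<in> V" for v
    proof -
      note vc = Vc[OF v]
      define z where "z = inv\<^bsub>G\<^esub> v \<otimes>\<^bsub>G\<^esub> (g \<otimes>\<^bsub>G\<^esub> v \<otimes>\<^bsub>G\<^esub> inv\<^bsub>G\<^esub> g)"
      have zV: "z \<in> V"
        unfolding z_def using V(2)[OF g v] subgroup.m_closed[OF V'(1)] subgroup.m_inv_closed[OF V'(1) v] by blast
      note zc = Vc[OF zV]
      have conj_v: "v \<otimes>\<^bsub>G\<^esub> z = g \<otimes>\<^bsub>G\<^esub> v \<otimes>\<^bsub>G\<^esub> inv\<^bsub>G\<^esub> g"
        unfolding z_def using vc gc by (simp add: G.word_simps)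
      have gz: "g \<otimes>\<^bsub>G\<^esub> z = z \<otimes>\<^bsub>G\<^esub> g" unfolding z_def using quad[OF v] .
      define c where "c = (scalar_endo (1 / of_nat p) :: 'a endo)"
      note rp = root_projection_unitary[OF p vc V'(5)[OF v] zc V'(5)[OF zV] V'(4)[OF v zV], folded c_def]
      interpret commuting_roots p c "rep v" "rep z" by (rule rp(1))
      obtain A where A: "A \<in> carrier G" "rep A = w" using rp(2) by blast
      have "A [^]\<^bsub>G\<^esub> p = \<one>\<^bsub>G\<^esub>"
        by (rule rep_inj) (use A rep_pow[OF A(1)] w_power_p rep_one in \<open>auto\<close>)
      \<comment> \<open>\<open>w\<close> is formed from \<open>v\<close>, \<open>z\<close> and a
        central scalar. Once \<open>A\<close> is known to lie in \<open>V\<close>, the quadratic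
        hypothesis applies to it.\<close>
      moreover have "y * w = w * y" if y: "\<forall>u\<in>V. y * rep u = rep u * y" for y
      proof -
        have yv: "y * rep v = rep v * y" and yz: "y * rep z = rep z * y" using y v zV by auto
        have yc: "y * c = c * y" using c(1)[of y] by simp
        have yg: "y * geom p (rep v) = geom p (rep v) * y" "y * geom p (rep z) = geom p (rep z) * y"
          using commute_geom[OF yv] commute_geom[OF yz] by auto
        have "y * f = f * y" using f_commute[OF yz] .
        then have "y * e 0 = e 0 * y"
          unfolding e_def using commute_mult[OF commute_mult[OF yc] yg(1)] by simp
        moreover have "y * (rep z - 1) = (rep z - 1) * y" using yz by (simp add: left_diff_distrib right_diff_distrib)
        ultimately have "y * (e 0 * (rep z - 1)) = (e 0 * (rep z - 1)) * y" by (rule commute_mult)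
        then show ?thesis unfolding w_def by (simp add: distrib_left distrib_right)
      qed
      ultimately have "A \<in> D" using A unfolding D_def by simp
      then have AV: "A \<in> V" using DV by blast
      have "rep (inv\<^bsub>G\<^esub> A) = w ^ (p - 1)" using rep_inv_power(1)[OF A(1) V'(5)[OF AV] p1] A(2) by simp
      then have "rep g * (w ^ (p - 1) * (rep g * w * rep (inv\<^bsub>G\<^esub> g))) = w ^ (p - 1) * (rep g * w * rep (inv\<^bsub>G\<^esub> g)) * rep g"
        using arg_cong[OF quad[OF AV], of rep] A gc by (simp add: rep_mult)
      moreover have "rep g * rep v * rep (inv\<^bsub>G\<^esub> g) = rep v * rep z"
        using arg_cong[OF conj_v, of rep] vc zc gc by (simp add: rep_mult)
      moreover have "rep g * rep z = rep z * rep g" using rep_comm[OF gc zc] gz by simp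
      ultimately have "rep z = 1"
        using quadratic_imp_trivial[OF rep_inv(2)[OF gc] rep_inv(1)[OF gc]] by blast
      then have "z = \<one>\<^bsub>G\<^esub>" using rep_inj[OF zc G.one_closed] rep_one by simp
      then have "v = g \<otimes>\<^bsub>G\<^esub> v \<otimes>\<^bsub>G\<^esub> inv\<^bsub>G\<^esub> g" using conj_v G.r_one[OF vc] by (simp)
      then have "v \<otimes>\<^bsub>G\<^esub> g = g \<otimes>\<^bsub>G\<^esub> v \<otimes>\<^bsub>G\<^esub> inv\<^bsub>G\<^esub> g \<otimes>\<^bsub>G\<^esub> g" by simp
      then show ?thesis using vc gc by (simp add: G.word_simps)
    qed
    then show "g \<in> centralizer_in G S V" using g unfolding centralizer_in_def by blast
  qed
  then show ?thesis using V(3) by blast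
qed

end

section \<open>Defining characteristic\<close>

context unitary_space
begin

text \<open>Counting fixed cosets needs only the additive structure; closure under scalars is
  imposed separately in \<open>isotropic_invariant\<close>.\<close>

definition additive_subgroup :: "(nat \<Rightarrow> 'a) set \<Rightarrow> bool" where
  "additive_subgroup M \<longleftrightarrow> M \<subseteq> W \<and> 0 \<in> M \<and> (\<forall>x\<in>M. \<forall>y\<in>M. x - y \<in> M)"

lemma additive_subgroupD:
  assumes "additive_subgroup M"
  shows "x \<in> M \<Longrightarrow> x \<in> W" "0 \<in> M" "x \<in> M \<Longrightarrow> y \<in> M \<Longrightarrow> x - y \<in> M"
    "x \<in> M \<Longrightarrow> - x \<in> M" "x \<in> M \<Longrightarrow> y \<in> M \<Longrightarrow> x + y \<in> M"
proof -
  show 0: "0 \<in> M" and m: "\<And>x y. x \<in> M \<Longrightarrow> y \<in> M \<Longrightarrow> x - y \<in> M" and "x \<in> M \<Longrightarrow> x \<in> W"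
    using assms unfolding additive_subgroup_def by auto
  show n: "\<And>x. x \<in> M \<Longrightarrow> - x \<in> M" using m[OF 0] by force
  show "x \<in> M \<Longrightarrow> y \<in> M \<Longrightarrow> x + y \<in> M" using m[of x "- y"] n[of y] by simp
qed

definition add_group :: "(nat \<Rightarrow> 'a) set \<Rightarrow> (nat \<Rightarrow> 'a) monoid" where
  "add_group M = \<lparr>carrier = M, monoid.mult = (+), one = 0\<rparr>"

lemma add_group_simps [simp]:
  "carrier (add_group M) = M" "x \<otimes>\<^bsub>add_group M\<^esub> y = x + y" "\<one>\<^bsub>add_group M\<^esub> = 0"
  by (simp_all add: add_group_def)

lemma group_add_group:
  assumes "additive_subgroup M"
  shows "group (add_group M)"
proof (rule groupI)
  fix x assume "x \<in> carrier (add_group M)"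
  then show "\<exists>y\<in>carrier (add_group M). y \<otimes>\<^bsub>add_group M\<^esub> x = \<one>\<^bsub>add_group M\<^esub>"
    using additive_subgroupD(4)[OF assms] by (intro bexI[of _ "- x"]) auto
qed (use additive_subgroupD[OF assms] in \<open>auto simp: add.assoc\<close>)

lemma subgroup_add_group:
  assumes N: "additive_subgroup N" and M: "additive_subgroup M" and "N \<subseteq> M"
  shows "subgroup N (add_group M)"
proof -
  interpret group "add_group M" using group_add_group[OF M] .
  have "inv\<^bsub>add_group M\<^esub> x = - x" if "x \<in> N" for x
    using that assms(3) additive_subgroupD(4)[OF M] by (intro inv_equality) auto
  then show ?thesis
    using additive_subgroupD[OF N] assms(3) by (intro subgroupI) auto
qed

lemma card_W: "card W = q ^ (2 * n)" "finite W"
proof -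
  let ?F = "PiE {..<n} (\<lambda>_. UNIV :: 'a set)"
  have bij: "bij_betw (\<lambda>x. restrict x {..<n}) W ?F"
  proof (rule bij_betw_byWitness[where f' = "\<lambda>f i. if i < n then f i else 0"])
    show "\<forall>x\<in>W. (\<lambda>i. if i < n then restrict x {..<n} i else 0) = x"
      by (auto simp: supp_fun_def fun_eq_iff)
    show "\<forall>f\<in>?F. restrict (\<lambda>i. if i < n then f i else 0) {..<n} = f"
    proof (intro ballI ext)
      fix f :: "nat \<Rightarrow> 'a" and i assume "f \<in> ?F"
      then show "restrict (\<lambda>i. if i < n then f i else 0) {..<n} i = f i" using PiE_arb[of f "{..<n}" _ i] by simp
    qed
    show "(\<lambda>x. restrict x {..<n}) ` W \<subseteq> ?F"
      by (rule image_subsetI) (simp add: restrict_PiE_iff)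
    show "(\<lambda>f i. if i < n then f i else 0) ` ?F \<subseteq> W"
      by (rule image_subsetI) (simp add: supp_fun_def)
  qed
  have "card ?F = (q ^ 2) ^ n" by (simp add: card_PiE card)
  then show "card W = q ^ (2 * n)" using bij_betw_same_card[OF bij] by (simp add: power_mult)
  have "finite ?F" by (intro finite_PiE) auto
  then show "finite W" using bij_betw_finite[OF bij] by simp
qed

lemma additive_W: "additive_subgroup W"
  unfolding additive_subgroup_def using supp_fun_closed by auto

abbreviation ac :: "'a mat \<Rightarrow> (nat \<Rightarrow> 'a) \<Rightarrow> nat \<Rightarrow> 'a" where "ac g \<equiv> app (rep g)"

lemma ac_mult: "g \<in> carrier G \<Longrightarrow> k \<in> carrier G \<Longrightarrow> ac (g \<otimes>\<^bsub>G\<^esub> k) x = ac g (ac k x)"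
  using rep_mult by (simp add: app_ring)

lemma ac_one: "ac \<one>\<^bsub>G\<^esub> x = x"
  using rep_one by (simp add: app_ring)

lemma ac_inv:
  assumes "g \<in> carrier G"
  shows "ac g (ac (inv\<^bsub>G\<^esub> g) x) = x" "ac (inv\<^bsub>G\<^esub> g) (ac g x) = x"
  using rep_inv[OF assms] by (metis app_ring(2,6))+

lemma h_ac_inv: "g \<in> carrier G \<Longrightarrow> h x (ac g y) = h (ac (inv\<^bsub>G\<^esub> g) x) y"
  using rep_unitary[of g "ac (inv\<^bsub>G\<^esub> g) x" y] ac_inv(1)[of g x] by simp

lemma ac_W: "x \<in> W \<Longrightarrow> ac g x \<in> W"
  by (rule supp_fun_closed(5))

text \<open>\<open>M\<close> is a subgroup of \<open>W\<close>, whose order is a power of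
  \<open>q\<close> and so of \<open>p\<close>; the coset argument therefore applies to
  vectors.\<close>

lemma p_group_fixed_vector:
  fixes p :: nat
  assumes p: "Factorial_Ring.prime p" and qp: "q = p ^ l"
    and S: "subgroup S G" "card S = p ^ k"
    and M: "additive_subgroup M" and N: "additive_subgroup N" and NM: "N \<subset> M"
    and MS: "\<And>s x. s \<in> S \<Longrightarrow> x \<in> M \<Longrightarrow> ac s x \<in> M"
    and NS: "\<And>s x. s \<in> S \<Longrightarrow> x \<in> N \<Longrightarrow> ac s x \<in> N"
  shows "\<exists>x\<in>M - N. \<forall>s\<in>S. ac s x - x \<in> N"
proof -
  have gS: "group (G\<lparr>carrier := S\<rparr>)" using S(1) G.subgroup_imp_group by blast
  interpret AW: group "add_group W" using group_add_group[OF additive_W] .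
  have MW: "M \<subseteq> W" using additive_subgroupD(1)[OF M] by blast
  have "card (rcosets\<^bsub>add_group W\<^esub> M) * card M = card W"
    using AW.lagrange[OF subgroup_add_group[OF M additive_W MW]] by (simp add: order_def)
  then have "card M dvd p ^ (l * (2 * n))" using card_W(1) qp by (metis dvd_triv_right power_mult)
  then obtain j where j: "card M = p ^ j" using p divides_primepow_nat by blast
  have Sc: "s \<in> carrier G" if "s \<in> S" for s using that subgroup.mem_carrier[OF S(1)] by blast
  have "\<exists>x\<in>carrier (add_group M) - N. \<forall>s\<in>carrier (G\<lparr>carrier := S\<rparr>). ac s x \<in> N #>\<^bsub>add_group M\<^esub> x"
  proof (rule p_group_fixed_coset[OF gS _ p group_add_group[OF M]])
    show "order (G\<lparr>carrier := S\<rparr>) = p ^ k" "order (add_group M) = p ^ j"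
      using S(2) j by (simp_all add: order_def)
    show "subgroup N (add_group M)" using subgroup_add_group[OF N M] NM by blast
    show "N \<noteq> carrier (add_group M)" using NM by auto
    show "ac (s \<otimes>\<^bsub>G\<lparr>carrier := S\<rparr>\<^esub> t) x = ac s (ac t x)"
      if "s \<in> carrier (G\<lparr>carrier := S\<rparr>)" "t \<in> carrier (G\<lparr>carrier := S\<rparr>)" for s t x
      using that ac_mult[OF Sc Sc] by simp
    show "ac \<one>\<^bsub>G\<lparr>carrier := S\<rparr>\<^esub> x = x" for x using ac_one by simp
  qed (use MS NS in \<open>simp_all add: app_add\<close>)
  then obtain x where x: "x \<in> M" "x \<notin> N" "\<And>s. s \<in> S \<Longrightarrow> \<exists>m\<in>N. ac s x = m + x"
    by (auto simp: r_coset_def)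
  have "ac s x - x \<in> N" if s: "s \<in> S" for s
  proof -
    obtain m where m: "m \<in> N" "ac s x = m + x" using x(3)[OF s] by blast
    show ?thesis unfolding m(2) add_diff_cancel_right' by (rule m(1))
  qed
  then show ?thesis using x by blast
qed

section \<open>Invariant isotropic subspaces and transvections\<close>

definition perp :: "(nat \<Rightarrow> 'a) set \<Rightarrow> (nat \<Rightarrow> 'a) set" where
  "perp M = {x \<in> W. \<forall>u\<in>M. h u x = 0}"

lemma additive_perp: "additive_subgroup (perp M)"
  unfolding additive_subgroup_def perp_def using supp_fun_closed by (auto simp: h_diff)

lemma perp_invariant:
  assumes S: "subgroup S G" and M: "\<And>s x. s \<in> S \<Longrightarrow> x \<in> M \<Longrightarrow> ac s x \<in> M"
    and s: "s \<in> S" and x: "x \<in> perp M"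
  shows "ac s x \<in> perp M"
  using x s M subgroup.m_inv_closed[OF S s] h_ac_inv[of s] subgroup.mem_carrier[OF S s] ac_W
  unfolding perp_def by auto

definition isotropic_invariant :: "'a mat set \<Rightarrow> (nat \<Rightarrow> 'a) set \<Rightarrow> bool" where
  "isotropic_invariant S U \<longleftrightarrow> additive_subgroup U \<and> (\<forall>c. \<forall>u\<in>U. (\<lambda>i. c * u i) \<in> U) \<and>
     (\<forall>u\<in>U. \<forall>v\<in>U. h u v = 0) \<and> (\<forall>s\<in>S. \<forall>u\<in>U. ac s u \<in> U)"

lemma isotropic_invariantD:
  assumes "isotropic_invariant S U"
  shows "additive_subgroup U" "u \<in> U \<Longrightarrow> (\<lambda>i. c * u i) \<in> U" "u \<in> U \<Longrightarrow> v \<in> U \<Longrightarrow> h u v = 0"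
    "s \<in> S \<Longrightarrow> u \<in> U \<Longrightarrow> ac s u \<in> U" "U \<subseteq> perp U"
  using assms additive_subgroupD(1) unfolding isotropic_invariant_def perp_def by blast+

lemma h_zero_sym: "h x y = 0 \<Longrightarrow> h y x = 0"
  using h_sym[of y x] by simp

text \<open>A fixed vector of \<open>S\<close> modulo \<open>U\<close> that is orthogonal to all such vectors is isotropic and
  hence enlarges \<open>U\<close>; so by maximality only \<open>U\<close> is orthogonal to the fixed vectors.\<close>

lemma exists_trivial_on_perp:
  fixes p :: nat
  assumes p: "Factorial_Ring.prime p" and qp: "q = p ^ l" and S: "subgroup S G" "card S = p ^ k"
  shows "\<exists>U. isotropic_invariant S U \<and> (\<forall>g\<in>S. \<forall>x\<in>perp U. ac g x - x \<in> U)"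
proof -
  define \<U> where "\<U> = {U. isotropic_invariant S U}"
  have "\<U> \<subseteq> Pow W" unfolding \<U>_def isotropic_invariant_def additive_subgroup_def by blast
  then have "finite \<U>" using card_W(2) finite_subset by blast
  moreover have "{0} \<in> \<U>"
    unfolding \<U>_def isotropic_invariant_def additive_subgroup_def using supp_fun_closed(1) by (auto simp: fun_eq_iff)
  ultimately have "\<exists>U\<in>\<U>. \<forall>U'\<in>\<U>. card U' \<le> card U"
    using Max_in[of "card ` \<U>"] Max_ge[of "card ` \<U>"] by fastforce
  then obtain U where U: "isotropic_invariant S U" and Umax: "\<And>U'. isotropic_invariant S U' \<Longrightarrow> card U' \<le> card U"
    unfolding \<U>_def by blast
  note U' = isotropic_invariantD[OF U] and Ua = additive_subgroupD[OF isotropic_invariantD(1)[OF U]]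
  have Sc: "s \<in> carrier G" if "s \<in> S" for s using that subgroup.mem_carrier[OF S(1)] by blast
  \<comment> \<open>The preimage in \<open>perp U\<close> of the \<open>S\<close>-fixed vectors
    modulo \<open>U\<close>. It contains \<open>U\<close>, so \<open>R\<close> below is contained in
    \<open>perp U\<close>.\<close>
  define T where "T = {v \<in> perp U. \<forall>g\<in>S. ac g v - v \<in> U}"
  have UT: "U \<subseteq> T" unfolding T_def using U'(4,5) Ua(3) by blast
  have TS: "ac s v \<in> T" if s: "s \<in> S" and v: "v \<in> T" for s v
    unfolding T_def
  proof (intro CollectI conjI ballI)
    have vp: "v \<in> perp U" using v unfolding T_def by blast
    show "ac s v \<in> perp U" using perp_invariant[OF S(1) U'(4) s vp] .
    fix g assume g: "g \<in> S"
    have u: "ac s v - v \<in> U" "ac g v - v \<in> U" using v s g unfolding T_def by auto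
    have "ac g (ac s v) - ac s v = ac g (ac s v - v) - (ac s v - v) + (ac g v - v)"
      by (simp add: app_diff)
    then show "ac g (ac s v) - ac s v \<in> U"
      using Ua(5)[OF Ua(3)[OF U'(4)[OF g u(1)] u(1)] u(2)] by (simp only:)
  qed
  define R where "R = perp T"
  have RS: "ac s x \<in> R" if "s \<in> S" "x \<in> R" for s x
    using perp_invariant[OF S(1) TS] that unfolding R_def by blast
  have RU: "R \<subseteq> U"
  proof (rule ccontr)
    assume "\<not> R \<subseteq> U"
    have Ra: "additive_subgroup R" unfolding R_def by (rule additive_perp)
    note Ra' = additive_subgroupD[OF Ra]
    have RUa: "additive_subgroup (R \<inter> U)"
      unfolding additive_subgroup_def
    proof (intro conjI ballI)
      show "R \<inter> U \<subseteq> W" using Ra'(1) by blast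
      show "0 \<in> R \<inter> U" using Ra'(2) Ua(2) by blast
      show "x - y \<in> R \<inter> U" if "x \<in> R \<inter> U" "y \<in> R \<inter> U" for x y using that Ra'(3) Ua(3) by blast
    qed
    have "\<exists>x\<in>R - R \<inter> U. \<forall>s\<in>S. ac s x - x \<in> R \<inter> U"
    proof (rule p_group_fixed_vector[OF p qp S Ra RUa])
      show "R \<inter> U \<subset> R" using \<open>\<not> R \<subseteq> U\<close> by blast
      show "ac s x \<in> R" if "s \<in> S" "x \<in> R" for s x using RS that .
      show "ac s x \<in> R \<inter> U" if "s \<in> S" "x \<in> R \<inter> U" for s x using RS U'(4) that by blast
    qed
    then obtain x where x: "x \<in> R" "x \<notin> U" "\<And>s. s \<in> S \<Longrightarrow> ac s x - x \<in> U" by blast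
    have xp: "x \<in> perp U" using x(1) UT unfolding R_def perp_def by blast
    then have "x \<in> T" using x(3) unfolding T_def by blast
    then have hxx: "h x x = 0" using x(1) unfolding R_def perp_def by blast
    have xW: "x \<in> W" using xp unfolding perp_def by blast
    have hux: "h u x = 0" "h x u = 0" if "u \<in> U" for u
      using xp that h_zero_sym unfolding perp_def by auto
    define U1 where "U1 = {u + (\<lambda>i. c * x i) | u c. u \<in> U}"
    have U1I: "u + (\<lambda>i. c * x i) \<in> U1" if "u \<in> U" for u c using that unfolding U1_def by blast
    have "isotropic_invariant S U1"
      unfolding isotropic_invariant_def additive_subgroup_def
    proof (intro conjI ballI allI)
      show "U1 \<subseteq> W" unfolding U1_def using xW Ua(1) supp_fun_closed by blast
      have "(0::nat \<Rightarrow> 'a) + (\<lambda>i. 0 * x i) = 0" by (rule ext) simp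
      then show "0 \<in> U1" using U1I[OF Ua(2), of 0] by (simp only:)
    next
      fix a b assume "a \<in> U1" "b \<in> U1"
      then obtain u c v d where a: "u \<in> U" "a = u + (\<lambda>i. c * x i)" and b: "v \<in> U" "b = v + (\<lambda>i. d * x i)"
        unfolding U1_def by blast
      have "a - b = (u - v) + (\<lambda>i. (c - d) * x i)" unfolding a(2) b(2) by (rule ext) (simp add: algebra_simps)
      then show "a - b \<in> U1" using U1I[OF Ua(3)[OF a(1) b(1)]] by (simp only:)
      show "h a b = 0"
        unfolding a(2) b(2) by (simp add: h_add h_scale hux hxx U'(3) a(1) b(1))
    next
      fix e a assume "a \<in> U1"
      then obtain u c where a: "u \<in> U" "a = u + (\<lambda>i. c * x i)" unfolding U1_def by blast
      have "(\<lambda>i. e * a i) = (\<lambda>i. e * u i) + (\<lambda>i. (e * c) * x i)" unfolding a(2) by (rule ext) (simp add: algebra_simps)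
      then show "(\<lambda>i. e * a i) \<in> U1" using U1I[OF U'(2)[OF a(1)]] by (simp only:)
    next
      fix s a assume s: "s \<in> S" and "a \<in> U1"
      then obtain u c where a: "u \<in> U" "a = u + (\<lambda>i. c * x i)" unfolding U1_def by blast
      define d where "d = ac s x - x"
      have sx: "ac s x = x + d" unfolding d_def by simp
      have "ac s a = (ac s u + (\<lambda>i. c * d i)) + (\<lambda>i. c * x i)"
        unfolding a(2) app_add app_scale sx by (rule ext) (simp add: algebra_simps)
      moreover have "ac s u + (\<lambda>i. c * d i) \<in> U" using U'(4)[OF s a(1)] U'(2) x(3)[OF s] Ua(5) unfolding d_def by blast
      ultimately show "ac s a \<in> U1" using U1I by (simp only:)
    qed
    then have le: "card U1 \<le> card U" by (rule Umax)
    have "U \<subseteq> U1"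
    proof
      fix u assume u: "u \<in> U"
      have "u + (\<lambda>i. 0 * x i) = u" by (rule ext) simp
      then show "u \<in> U1" using U1I[OF u, of 0] by (simp only:)
    qed
    moreover have "x \<in> U1"
    proof -
      have "0 + (\<lambda>i. 1 * x i) = x" by (rule ext) simp
      then show ?thesis using U1I[OF Ua(2), of 1] by (simp only:)
    qed
    moreover have "finite U1"
      using \<open>isotropic_invariant S U1\<close> card_W(2) finite_subset unfolding isotropic_invariant_def additive_subgroup_def by blast
    ultimately have "card U < card U1" using x(2) by (intro psubset_card_mono) auto
    then show False using le by simp
  qed
  \<comment> \<open>Moving \<open>g\<close> to the other argument pairs \<open>x\<close> with the
    displacement of \<open>t\<close> under the inverse of \<open>g\<close>, which lies in
    \<open>U\<close>. So the displacement of \<open>x\<close> is orthogonal to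
    \<open>T\<close>.\<close>
  have "ac g x - x \<in> U" if g: "g \<in> S" and x: "x \<in> perp U" for g x
  proof -
    have xW: "x \<in> W" using x unfolding perp_def by blast
    have "h t (ac g x - x) = 0" if t: "t \<in> T" for t
    proof -
      have "ac (inv\<^bsub>G\<^esub> g) t - t \<in> U" using t subgroup.m_inv_closed[OF S(1) g] unfolding T_def by blast
      then have "h (ac (inv\<^bsub>G\<^esub> g) t - t) x = 0" using x unfolding perp_def by blast
      then show ?thesis using h_ac_inv[OF Sc[OF g]] by (simp add: h_diff)
    qed
    moreover have "ac g x - x \<in> W" using ac_W[OF xW] xW supp_fun_closed(3) by blast
    ultimately have "ac g x - x \<in> R" unfolding R_def perp_def by blast
    then show ?thesis using RU by blast
  qed
  then show ?thesis using U by blast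
qed

text \<open>\<open>X ^ q - X\<close> has at most \<open>q\<close> roots in a field of
  \<open>q ^ 2\<close> elements, and any value \<open>y ^ q - y\<close> changes sign under the
  involution.\<close>

lemma exists_skew: "\<exists>c::'a. c \<noteq> 0 \<and> c ^ q = - c"
proof -
  have q2: "q \<ge> 2"
  proof -
    obtain e where e: "Factorial_Ring.prime CHAR('a)" "e \<ge> 1" "q = CHAR('a) ^ e" using char by blast
    have "CHAR('a) ^ 1 \<le> CHAR('a) ^ e" using e prime_gt_0_nat by (intro power_increasing) (auto simp: Suc_leI)
    then show ?thesis using e prime_ge_2_nat[OF e(1)] by simp
  qed
  have "\<exists>y::'a. y ^ q \<noteq> y"
  proof (rule ccontr)
    assume "\<not> ?thesis"
    then have all: "y ^ q = y" for y :: 'a by blast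
    let ?P = "monom 1 q - monom 1 1 :: 'a poly"
    have "coeff ?P q = 1" using q2 by simp
    then have P0: "?P \<noteq> 0" by (metis coeff_0 zero_neq_one)
    have "{y. poly ?P y = 0} = UNIV" using all by (auto simp: poly_monom)
    then have "card (UNIV :: 'a set) \<le> degree ?P" using card_poly_roots_bound[OF P0] by simp
    also have "\<dots> \<le> q"
      using q2 by (intro degree_diff_le) (auto intro: order.trans[OF degree_monom_le])
    finally have "q ^ 2 \<le> q" using card by simp
    then show False using q2 by (simp add: power2_eq_square)
  qed
  then obtain y :: 'a where y: "y ^ q \<noteq> y" by blast
  have "(y ^ q - y) ^ q = - (y ^ q - y)" by (simp add: power_q_diff power_q_q)
  then show ?thesis using y by (intro exI[of _ "y ^ q - y"]) simp
qed

text \<open>On expanding the form, the two mixed terms cancel because \<open>c ^ q = - c\<close>,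
  and the remaining one contains \<open>h u u = 0\<close>.\<close>

lemma exists_transvection:
  assumes u: "u \<in> W" "h u u = 0" and c: "c ^ q = - c"
  shows "\<exists>a\<in>carrier G. \<forall>x. ac a x = x + (\<lambda>i. c * h u x * u i)"
proof -
  let ?f = "\<lambda>x. x + (\<lambda>i. c * h u x * u i)"
  have "?f \<in> {f. (\<forall>x y. f (x + y) = f x + f y) \<and> (\<forall>c x. f (\<lambda>i. c * x i) = (\<lambda>i. c * f x i))}"
    by (auto simp: h_add h_scale fun_eq_iff algebra_simps)
  then have app: "app (Abs_endo ?f) = ?f" by (simp only: Abs_endo_inverse)
  have "mat_like n (Abs_endo ?f)"
    unfolding mat_like_def app
  proof (intro conjI allI impI)
    show "?f x - x \<in> W" for x using supp_fun_closed(4)[OF u(1), of "c * h u x"] by simp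
    fix x :: "nat \<Rightarrow> 'a" assume "\<forall>i<n. x i = 0"
    then have "h u x = 0" by (simp add: herm_def)
    then show "?f x = x" by (simp add: fun_eq_iff)
  qed
  moreover have "h (app (Abs_endo ?f) x) (app (Abs_endo ?f) y) = h x y" for x y
  proof -
    have "h (?f x) (?f y) = h x y + c * h u y * h x u + (c ^ q * h u x ^ q * h u y + c ^ q * h u x ^ q * (c * h u y * h u u))"
      unfolding h_add h_scale by (simp add: power_mult_distrib algebra_simps)
    also have "h u x ^ q = h x u" using h_sym[of x u] by simp
    finally have "h (?f x) (?f y) = h x y" unfolding c u(2) by (simp only: mult_zero_right add_0_right, simp)
    then show ?thesis unfolding app .
  qed
  ultimately obtain a where a: "a \<in> carrier G" "rep a = Abs_endo ?f" using unitaryI by blast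
  have "\<forall>x. ac a x = ?f x" unfolding a(2) app by simp
  then show ?thesis using a(1) by blast
qed

theorem thompson_le_oliver_defining:
  fixes p :: nat
  assumes p: "Factorial_Ring.prime p" "p \<ge> 5" and char0: "of_nat p = (0::'a)" and qp: "q = p ^ l"
    and Syl: "sylow_subgroup G p S"
  shows "thompson_subgroup G p S \<subseteq> oliver_subgroup G p S"
proof -
  obtain ks where S: "subgroup S G" "card S = p ^ ks" using Syl unfolding sylow_subgroup_def by blast
  have p2: "p \<ge> 2" using p(2) by simp
  have Sc: "s \<in> carrier G" if "s \<in> S" for s using that subgroup.mem_carrier[OF S(1)] by blast
  obtain U where U: "isotropic_invariant S U" and stab: "\<And>g x. g \<in> S \<Longrightarrow> x \<in> perp U \<Longrightarrow> ac g x - x \<in> U"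
    using exists_trivial_on_perp[OF p(1) qp S] by blast
  note U' = isotropic_invariantD[OF U] and Ua = additive_subgroupD[OF isotropic_invariantD(1)[OF U]]
  define A where "A = {g \<in> carrier G. (\<forall>x\<in>W. ac g x - x \<in> U) \<and> (\<forall>x\<in>perp U. ac g x = x)}"
  have Ac: "g \<in> carrier G" and A1: "x \<in> W \<Longrightarrow> ac g x - x \<in> U" and A2: "x \<in> perp U \<Longrightarrow> ac g x = x" if "g \<in> A" for g x
    using that unfolding A_def by auto
  have A3: "ac g x = x" if "g \<in> A" "x \<in> U" for g x using A2[OF that(1)] U'(5) that(2) by blast
  \<comment> \<open>Displacements lie in \<open>U\<close>, which \<open>A\<close> fixes, so they add
    up under composition. Commutativity follows, and in characteristic \<open>p\<close> also
    exponent \<open>p\<close>.\<close>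
  have Amult: "ac g (ac k x) = x + (ac g x - x) + (ac k x - x)" if "g \<in> A" "k \<in> A" "x \<in> W" for g k x
  proof -
    have "ac g (ac k x) = ac g x + ac g (ac k x - x)" by (simp add: app_diff)
    also have "ac g (ac k x - x) = ac k x - x" using A3[OF that(1) A1[OF that(2,3)]] .
    also have "ac g x + (ac k x - x) = x + (ac g x - x) + (ac k x - x)" by simp
    finally show ?thesis .
  qed
  have Asub: "subgroup A G"
  proof (rule G.subgroupI)
    show "A \<subseteq> carrier G" using Ac by blast
    have "\<one>\<^bsub>G\<^esub> \<in> A" unfolding A_def using ac_one Ua(2) G.one_closed by simp
    then show "A \<noteq> {}" by blast
    fix g assume g: "g \<in> A"
    note gc = Ac[OF g]
    show "inv\<^bsub>G\<^esub> g \<in> A"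
      unfolding A_def
    proof (intro CollectI conjI ballI)
      show "inv\<^bsub>G\<^esub> g \<in> carrier G" using G.inv_closed[OF gc] .
      fix x assume x: "x \<in> W"
      have "ac g (ac (inv\<^bsub>G\<^esub> g) x) - ac (inv\<^bsub>G\<^esub> g) x \<in> U" using A1[OF g ac_W[OF x]] .
      then have "x - ac (inv\<^bsub>G\<^esub> g) x \<in> U" unfolding ac_inv(1)[OF gc] .
      from Ua(4)[OF this] show "ac (inv\<^bsub>G\<^esub> g) x - x \<in> U" unfolding minus_diff_eq .
    next
      fix x assume "x \<in> perp U"
      then show "ac (inv\<^bsub>G\<^esub> g) x = x" using A2[OF g] ac_inv(2)[OF gc, of x] by simp
    qed
    fix k assume k: "k \<in> A"
    show "g \<otimes>\<^bsub>G\<^esub> k \<in> A"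
      unfolding A_def
    proof (intro CollectI conjI ballI)
      show "g \<otimes>\<^bsub>G\<^esub> k \<in> carrier G" using G.m_closed[OF gc Ac[OF k]] .
      fix x assume x: "x \<in> W"
      have "ac (g \<otimes>\<^bsub>G\<^esub> k) x - x = (ac g x - x) + (ac k x - x)"
        unfolding ac_mult[OF gc Ac[OF k]] Amult[OF g k x] by simp
      then show "ac (g \<otimes>\<^bsub>G\<^esub> k) x - x \<in> U" using Ua(5)[OF A1[OF g x] A1[OF k x]] by (simp only:)
    next
      fix x assume x: "x \<in> perp U"
      show "ac (g \<otimes>\<^bsub>G\<^esub> k) x = x" unfolding ac_mult[OF gc Ac[OF k]] A2[OF k x] A2[OF g x] ..
    qed
  qed
  have Acomm: "g \<otimes>\<^bsub>G\<^esub> k = k \<otimes>\<^bsub>G\<^esub> g" if g: "g \<in> A" and k: "k \<in> A" for g k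
  proof (rule rep_inj)
    show "g \<otimes>\<^bsub>G\<^esub> k \<in> carrier G" "k \<otimes>\<^bsub>G\<^esub> g \<in> carrier G" using G.m_closed Ac g k by blast+
    fix x assume x: "x \<in> W"
    show "ac (g \<otimes>\<^bsub>G\<^esub> k) x = ac (k \<otimes>\<^bsub>G\<^esub> g) x"
      unfolding ac_mult[OF Ac[OF g] Ac[OF k]] ac_mult[OF Ac[OF k] Ac[OF g]] Amult[OF g k x] Amult[OF k g x] by (simp only: add_ac)
  qed
  have Apow: "ac (g [^]\<^bsub>G\<^esub> k) x = x + (\<lambda>i. of_nat k * (ac g x - x) i)" if g: "g \<in> A" and x: "x \<in> W" for g x and k :: nat
  proof (induction k)
    case 0
    then show ?case using ac_one[of x] by (simp add: fun_eq_iff)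
  next
    case (Suc k)
    have gk: "g [^]\<^bsub>G\<^esub> k \<in> A" using G.subgroup_int_pow_closed[OF Asub g, of "int k"] by (simp add: int_pow_int)
    have "ac (g [^]\<^bsub>G\<^esub> Suc k) x = ac (g [^]\<^bsub>G\<^esub> k) (ac g x)"
      using ac_mult[OF Ac[OF gk] Ac[OF g]] by (simp)
    also have "\<dots> = x + (ac (g [^]\<^bsub>G\<^esub> k) x - x) + (ac g x - x)" using Amult[OF gk g x] .
    also have "\<dots> = x + (\<lambda>i. of_nat (Suc k) * (ac g x - x) i)"
      unfolding Suc by (rule ext) (simp add: algebra_simps)
    finally show ?case .
  qed
  have Aexp: "g [^]\<^bsub>G\<^esub> p = \<one>\<^bsub>G\<^esub>" if g: "g \<in> A" for g
  proof (rule rep_inj)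
    show "g [^]\<^bsub>G\<^esub> p \<in> carrier G" "\<one>\<^bsub>G\<^esub> \<in> carrier G" using G.nat_pow_closed[OF Ac[OF g]] G.one_closed by blast+
    fix x assume x: "x \<in> W"
    show "ac (g [^]\<^bsub>G\<^esub> p) x = ac \<one>\<^bsub>G\<^esub> x"
      unfolding Apow[OF g x] ac_one char0 by (simp add: fun_eq_iff)
  qed
  have permp: "ac s x \<in> perp U" if "s \<in> S" "x \<in> perp U" for s x
    using perp_invariant[OF S(1) U'(4)] that by blast
  have An: "s \<otimes>\<^bsub>G\<^esub> g \<otimes>\<^bsub>G\<^esub> inv\<^bsub>G\<^esub> s \<in> A" if s: "s \<in> S" and g: "g \<in> A" for s g
  proof -
    note sc = Sc[OF s] and gc = Ac[OF g]
    have si: "inv\<^bsub>G\<^esub> s \<in> S" using subgroup.m_inv_closed[OF S(1) s] .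
    have eq: "ac (s \<otimes>\<^bsub>G\<^esub> g \<otimes>\<^bsub>G\<^esub> inv\<^bsub>G\<^esub> s) x = ac s (ac g (ac (inv\<^bsub>G\<^esub> s) x))" for x
      using ac_mult[OF G.m_closed[OF sc gc] G.inv_closed[OF sc]] ac_mult[OF sc gc] by simp
    have "ac (s \<otimes>\<^bsub>G\<^esub> g \<otimes>\<^bsub>G\<^esub> inv\<^bsub>G\<^esub> s) x - x \<in> U" if x: "x \<in> W" for x
    proof -
      let ?y = "ac (inv\<^bsub>G\<^esub> s) x"
      have "ac s (ac g ?y) - x = ac s (ac g ?y - ?y)" using ac_inv(1)[OF sc] by (simp add: app_diff)
      then show ?thesis unfolding eq using U'(4)[OF s A1[OF g ac_W[OF x]]] by simp
    qed
    moreover have "ac (s \<otimes>\<^bsub>G\<^esub> g \<otimes>\<^bsub>G\<^esub> inv\<^bsub>G\<^esub> s) x = x" if x: "x \<in> perp U" for x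
      unfolding eq A2[OF g permp[OF si x]] using ac_inv(1)[OF sc] .
    ultimately show ?thesis unfolding A_def using G.m_closed[OF G.m_closed[OF sc gc] G.inv_closed[OF sc]] by blast
  qed
  have "finite A" using finite_subset[OF subgroup.subset[OF Asub] finite_G] .
  then obtain j where "card A = p ^ j" using G.elem_p_group_card[OF p(1) Asub _ Aexp] by blast
  then have AS: "A \<subseteq> S" using G.sylow_contains_normalized_p_subgroup[OF finite_G p(1) Syl Asub _ An] by blast
  have elA: "elem_abelian_sub G p S A"
    unfolding elem_abelian_sub_def using Asub AS Acomm Aexp by blast
  \<comment> \<open>\<open>a\<close> moves \<open>x\<close> by a vector of \<open>U\<close>, which
    \<open>g\<close> fixes, and \<open>g\<close> moves \<open>x\<close> by a vector of
    \<open>perp U\<close>, which \<open>a\<close> fixes; in either order the displacements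
    add.\<close>
  have fix_comm: "g \<otimes>\<^bsub>G\<^esub> a = a \<otimes>\<^bsub>G\<^esub> g" if g: "g \<in> S" and fixU: "\<And>u. u \<in> U \<Longrightarrow> ac g u = u" and a: "a \<in> A" for g a
  proof (rule rep_inj)
    note gc = Sc[OF g] and acc = Ac[OF a]
    show "g \<otimes>\<^bsub>G\<^esub> a \<in> carrier G" "a \<otimes>\<^bsub>G\<^esub> g \<in> carrier G" using G.m_closed gc acc by blast+
    fix x assume x: "x \<in> W"
    have "ac g (ac a x) = ac g x + ac g (ac a x - x)" by (simp add: app_diff)
    also have "ac g (ac a x - x) = ac a x - x" using fixU[OF A1[OF a x]] .
    finally have 1: "ac g (ac a x) = ac g x + (ac a x - x)" .
    have "h u (ac g x - x) = 0" if u: "u \<in> U" for u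
    proof -
      have "ac (inv\<^bsub>G\<^esub> g) u = u" using fixU[OF u] ac_inv(2)[OF gc, of u] by simp
      then show ?thesis using h_ac_inv[OF gc] by (simp add: h_diff)
    qed
    then have "ac g x - x \<in> perp U" unfolding perp_def using supp_fun_closed(3)[OF ac_W[OF x] x] by blast
    then have 2: "ac a (ac g x - x) = ac g x - x" using A2[OF a] by blast
    have 3: "ac a (ac g x) = ac a x + ac a (ac g x - x)" by (simp add: app_diff)
    show "ac (g \<otimes>\<^bsub>G\<^esub> a) x = ac (a \<otimes>\<^bsub>G\<^esub> g) x"
      unfolding ac_mult[OF gc acc] ac_mult[OF acc gc] 1 3 2 by simp
  qed
  \<comment> \<open>If \<open>g\<close> is nontrivial on \<open>U\<close>, some \<open>y\<close> in
    \<open>U\<close> has a nonzero displacement \<open>d\<close> that \<open>g\<close> fixes. The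
    transvection along \<open>y\<close> then forces \<open>d\<close> to be orthogonal to every
    vector.\<close>
  have quad_fix: "ac g u = u" if g: "g \<in> S" and u: "u \<in> U" and quad: "\<And>a. a \<in> A \<Longrightarrow>
      g \<otimes>\<^bsub>G\<^esub> (inv\<^bsub>G\<^esub> a \<otimes>\<^bsub>G\<^esub> (g \<otimes>\<^bsub>G\<^esub> a \<otimes>\<^bsub>G\<^esub> inv\<^bsub>G\<^esub> g)) =
      (inv\<^bsub>G\<^esub> a \<otimes>\<^bsub>G\<^esub> (g \<otimes>\<^bsub>G\<^esub> a \<otimes>\<^bsub>G\<^esub> inv\<^bsub>G\<^esub> g)) \<otimes>\<^bsub>G\<^esub> g" for g u
  proof (rule ccontr)
    assume "ac g u \<noteq> u"
    note gc = Sc[OF g]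
    define U0 where "U0 = {u \<in> U. ac g u = u}"
    \<comment> \<open>A \<open>p\<close>-group that contains \<open>g\<close> and preserves
      \<open>U0\<close>, serving in place of the cyclic group generated by \<open>g\<close>.\<close>
    define C where "C = centralizer_in G S {g}"
    have C: "subgroup C G" unfolding C_def using G.centralizer_in_subgroup[OF S(1), of "{g}"] gc by blast
    have CS: "C \<subseteq> S" and gC: "g \<in> C" unfolding C_def centralizer_in_def using g by auto
    interpret GS: group "G\<lparr>carrier := S\<rparr>" using S(1) G.subgroup_imp_group by blast
    have "subgroup C (G\<lparr>carrier := S\<rparr>)" using G.subgroup_incl[OF C S(1) CS] .
    from GS.lagrange[OF this] have "card (rcosets\<^bsub>G\<lparr>carrier := S\<rparr>\<^esub> C) * card C = card S" by (simp add: order_def)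
    then have "card C dvd p ^ ks" using S(2) by (metis dvd_triv_right)
    then obtain k where k: "card C = p ^ k" using p(1) divides_primepow_nat by blast
    have U0a: "additive_subgroup U0"
      unfolding additive_subgroup_def
    proof (intro conjI ballI)
      show "U0 \<subseteq> W" unfolding U0_def using Ua(1) by blast
      show "0 \<in> U0" unfolding U0_def using Ua(2) by simp
      fix a b assume "a \<in> U0" "b \<in> U0"
      then have ab: "a \<in> U" "b \<in> U" "ac g a = a" "ac g b = b" unfolding U0_def by auto
      show "a - b \<in> U0" unfolding U0_def by (intro CollectI conjI Ua(3) ab(1,2)) (simp only: app_diff ab)
    qed
    have "\<exists>x\<in>U - U0. \<forall>s\<in>C. ac s x - x \<in> U0"
    proof (rule p_group_fixed_vector[OF p(1) qp C k U'(1) U0a])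
      show "U0 \<subset> U" using u \<open>ac g u \<noteq> u\<close> unfolding U0_def by blast
      show "ac s x \<in> U" if "s \<in> C" "x \<in> U" for s x using U'(4) CS that by blast
      fix s x assume s: "s \<in> C" and x: "x \<in> U0"
      have sg: "s \<otimes>\<^bsub>G\<^esub> g = g \<otimes>\<^bsub>G\<^esub> s" and sS: "s \<in> S" using s unfolding C_def centralizer_in_def by auto
      have "ac g (ac s x) = ac s (ac g x)" using ac_mult[OF Sc[OF sS] gc] ac_mult[OF gc Sc[OF sS]] sg by metis
      then show "ac s x \<in> U0" using x U'(4)[OF sS] unfolding U0_def by simp
    qed
    then obtain y where y: "y \<in> U" "ac g y \<noteq> y" "ac g y - y \<in> U0" using gC unfolding U0_def by blast
    define d where "d = ac g y - y"
    have dU: "d \<in> U" "ac g d = d" "d \<noteq> 0" using y unfolding d_def U0_def by auto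
    have gy: "ac g y = y + d" unfolding d_def by simp
    have giy: "ac (inv\<^bsub>G\<^esub> g) y = y - d"
    proof -
      have gyd: "ac g (y - d) = y" unfolding app_diff gy dU(2) by simp
      show ?thesis using ac_inv(2)[OF gc, of "y - d"] unfolding gyd .
    qed
    have yW: "y \<in> W" and dW: "d \<in> W" using Ua(1) y(1) dU(1) by auto
    obtain c :: 'a where c: "c \<noteq> 0" "c ^ q = - c" using exists_skew by blast
    obtain a where a: "a \<in> carrier G" "\<And>x. ac a x = x + (\<lambda>i. c * h y x * y i)"
      using exists_transvection[OF yW U'(3)[OF y(1) y(1)] c(2)] by blast
    have aA: "a \<in> A"
      unfolding A_def
    proof (intro CollectI conjI ballI a(1))
      show "ac a x - x \<in> U" for x unfolding a(2) using U'(2)[OF y(1), of "c * h y x"] by simp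
      show "ac a x = x" if "x \<in> perp U" for x
        using that y(1) unfolding a(2) perp_def by (simp add: fun_eq_iff)
    qed
    have ai: "ac (inv\<^bsub>G\<^esub> a) x = x - (\<lambda>i. c * h y x * y i)" for x
    proof -
      have aax: "ac a (x - (\<lambda>i. c * h y x * y i)) = x"
        unfolding a(2) h_diff h_scale U'(3)[OF y(1) y(1)] by (rule ext) simp
      show ?thesis using ac_inv(2)[OF a(1), of "x - (\<lambda>i. c * h y x * y i)"] unfolding aax .
    qed
    define b where "b = inv\<^bsub>G\<^esub> a \<otimes>\<^bsub>G\<^esub> (g \<otimes>\<^bsub>G\<^esub> a \<otimes>\<^bsub>G\<^esub> inv\<^bsub>G\<^esub> g)"
    have bc: "b \<in> carrier G" unfolding b_def using a(1) gc G.m_closed G.inv_closed by metis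
    \<comment> \<open>Conjugation by \<open>g\<close> turns the transvection along \<open>y\<close>
      into the one along \<open>y + d\<close>; \<open>U\<close> being isotropic, the inverse of the
      first does not interfere with it.\<close>
    have bx: "ac b x = x + (\<lambda>i. c * h (y + d) x * (y + d) i) - (\<lambda>i. c * h y x * y i)" for x
    proof -
      have "ac b x = ac (inv\<^bsub>G\<^esub> a) (ac g (ac a (ac (inv\<^bsub>G\<^esub> g) x)))"
        unfolding b_def using a(1) gc by (simp add: ac_mult)
      also have "ac g (ac a (ac (inv\<^bsub>G\<^esub> g) x)) = x + (\<lambda>i. c * h (y + d) x * (y + d) i)"
        unfolding a(2) app_add app_scale ac_inv(1)[OF gc] gy
        using h_ac_inv[OF G.inv_closed[OF gc], of y x] G.inv_inv[OF gc] gy by (simp)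
      finally show ?thesis
        unfolding ai h_add h_scale U'(3)[OF y(1) y(1)] U'(3)[OF y(1) dU(1)] by (simp only: add_0_right mult_zero_right)
    qed
    have comm: "ac g (ac b x) = ac b (ac g x)" for x
      using quad[OF aA] ac_mult[OF gc bc] ac_mult[OF bc gc] unfolding b_def[symmetric] by metis
    \<comment> \<open>What survives when coordinate \<open>i\<close> of the two sides of
      \<open>comm\<close> is compared; every term containing \<open>y\<close> cancels.\<close>
    have "2 * c * h d x * d i = 0" for x i
    proof -
      have 1: "h (y + d) (ac g x) = h y x" "h y (ac g x) = h y x - h d x"
      proof -
        have "ac (inv\<^bsub>G\<^esub> g) d = d" using ac_inv(2)[OF gc, of d] unfolding dU(2) .
        then show "h (y + d) (ac g x) = h y x" "h y (ac g x) = h y x - h d x"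
          unfolding h_ac_inv[OF gc] app_add giy by (simp_all add: h_add h_diff)
      qed
      have "ac b (ac g x) i = ac g x i + c * h y x * (y i + d i) - c * (h y x - h d x) * y i"
        unfolding bx 1 by simp
      moreover have "ac g (ac b x) i = ac g x i + c * (h y x + h d x) * (y i + d i + d i) - c * h y x * (y i + d i)"
        unfolding bx app_add app_diff app_scale gy dU(2) h_add by simp
      ultimately have "c * (h y x + h d x) * (y i + d i + d i) - c * h y x * (y i + d i)
        = c * h y x * (y i + d i) - c * (h y x - h d x) * y i"
        using comm[of x] by simp
      then show ?thesis by (simp add: algebra_simps)
    qed
    moreover have "(2::'a) \<noteq> 0"
    proof
      assume "(2::'a) = 0"
      then have "CHAR('a) dvd 2" using of_nat_eq_0_iff_char_dvd[where ?'a = 'a, of 2] by simp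
      moreover have "CHAR('a) dvd p" using char0 of_nat_eq_0_iff_char_dvd[where ?'a = 'a, of p] by simp
      then have "CHAR('a) = p" using p(1) char primes_dvd_imp_eq by blast
      ultimately show False using p(2) by (auto dest: dvd_imp_le)
    qed
    moreover obtain i where "d i \<noteq> 0" using dU(3) by (auto simp: fun_eq_iff)
    ultimately have "h d x = 0" for x using c(1) by (metis mult_eq_0_iff)
    then have "d = 0" using h_nondegenerate[OF dW] h_zero_sym by blast
    then show False using dU(3) by simp
  qed
  define Q where "Q = centralizer_in G S A"
  have QI: "g \<in> Q" if "g \<in> S" "\<And>u. u \<in> U \<Longrightarrow> ac g u = u" for g
    unfolding Q_def centralizer_in_def using that fix_comm[OF that] by blast
  \<comment> \<open>An element centralising \<open>A\<close> has trivial commutators with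
    \<open>A\<close>, so the quadratic condition holds for it and \<open>quad_fix\<close>
    applies.\<close>
  have Qfix: "ac g u = u" if g: "g \<in> Q" and u: "u \<in> U" for g u
  proof (rule quad_fix[OF _ u])
    show gS: "g \<in> S" using g unfolding Q_def centralizer_in_def by blast
    fix a assume a: "a \<in> A"
    have ga: "g \<otimes>\<^bsub>G\<^esub> a = a \<otimes>\<^bsub>G\<^esub> g" using g a unfolding Q_def centralizer_in_def by blast
    have "g \<otimes>\<^bsub>G\<^esub> a \<otimes>\<^bsub>G\<^esub> inv\<^bsub>G\<^esub> g = a" unfolding ga using Sc[OF gS] Ac[OF a] by (simp add: G.word_simps)
    then show "g \<otimes>\<^bsub>G\<^esub> (inv\<^bsub>G\<^esub> a \<otimes>\<^bsub>G\<^esub> (g \<otimes>\<^bsub>G\<^esub> a \<otimes>\<^bsub>G\<^esub> inv\<^bsub>G\<^esub> g)) =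
      (inv\<^bsub>G\<^esub> a \<otimes>\<^bsub>G\<^esub> (g \<otimes>\<^bsub>G\<^esub> a \<otimes>\<^bsub>G\<^esub> inv\<^bsub>G\<^esub> g)) \<otimes>\<^bsub>G\<^esub> g"
      using Sc[OF gS] Ac[OF a] by (simp)
  qed
  have "thompson_subgroup G p S \<subseteq> Q"
    unfolding Q_def
  proof (rule G.thompson_subgroup_le_centralizer[OF finite_G p(1) S elA An])
    fix g assume g: "g \<in> S" and "\<And>a. a \<in> A \<Longrightarrow>
      g \<otimes>\<^bsub>G\<^esub> (inv\<^bsub>G\<^esub> a \<otimes>\<^bsub>G\<^esub> (g \<otimes>\<^bsub>G\<^esub> a \<otimes>\<^bsub>G\<^esub> inv\<^bsub>G\<^esub> g)) =
      (inv\<^bsub>G\<^esub> a \<otimes>\<^bsub>G\<^esub> (g \<otimes>\<^bsub>G\<^esub> a \<otimes>\<^bsub>G\<^esub> inv\<^bsub>G\<^esub> g)) \<otimes>\<^bsub>G\<^esub> g"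
    then have "ac g u = u" if "u \<in> U" for u using quad_fix[OF g that] by blast
    then show "g \<in> centralizer_in G S A" using QI[OF g] unfolding Q_def by blast
  qed
  moreover have "Q \<subseteq> oliver_subgroup G p S"
  proof (rule G.oliver_subgroup_contains[OF finite_G S(1) p2])
    show Qsub: "subgroup Q G" unfolding Q_def using G.centralizer_in_subgroup[OF S(1) subgroup.subset[OF Asub]] .
    show QS: "Q \<subseteq> S" unfolding Q_def centralizer_in_def by blast
    show Qn: "s \<otimes>\<^bsub>G\<^esub> k \<otimes>\<^bsub>G\<^esub> inv\<^bsub>G\<^esub> s \<in> Q" if "s \<in> S" "k \<in> Q" for s k
      using G.centralizer_in_normalized[OF S(1) Asub An] that unfolding Q_def by blast
    \<comment> \<open>Successive commutators with \<open>Q\<close> lead from \<open>S\<close> into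
      \<open>Q\<close>, then into \<open>A\<close>, then to 1. Three of them are available because
      \<open>p \<ge> 5\<close>.\<close>
    have 1: "iter_comm G S Q 1 \<subseteq> Q"
      using G.comm_sub_subset[OF Qsub] G.commutator_in_normalized(1)[OF S(1) Qsub QS Qn] by simp
    have "commutator G g k \<in> A" if g: "g \<in> Q" and k: "k \<in> Q" for g k
    proof -
      have gS: "g \<in> S" and kS: "k \<in> S" using g k QS by auto
      note gc = Sc[OF gS] and kc = Sc[OF kS]
      have cmc: "commutator G g k \<in> carrier G"
        unfolding commutator_def using gc kc G.m_closed G.inv_closed by metis
      have move: "ac r x - x \<in> perp U" if r: "r \<in> Q" and x: "x \<in> W" for r x
      proof -
        have rc: "r \<in> carrier G" using r QS Sc by blast
        have "h u (ac r x - x) = 0" if u: "u \<in> U" for u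
        proof -
          have "ac (inv\<^bsub>G\<^esub> r) u = u" using Qfix[OF r u] ac_inv(2)[OF rc, of u] by simp
          then show ?thesis using h_ac_inv[OF rc] by (simp add: h_diff)
        qed
        then show ?thesis unfolding perp_def using supp_fun_closed(3)[OF ac_W[OF x] x] by blast
      qed
      \<comment> \<open>Written with displacements: for members of \<open>Q\<close> these send
        \<open>W\<close> into \<open>perp U\<close>, \<open>perp U\<close> into \<open>U\<close>,
        and \<open>U\<close> to 0. Two in a row therefore send \<open>W\<close> into
        \<open>U\<close> and kill \<open>perp U\<close>, which is membership in
        \<open>A\<close>.\<close>
      have diff: "ac g (ac k x) - ac k (ac g x) = (ac g (ac k x - x) - (ac k x - x)) - (ac k (ac g x - x) - (ac g x - x))" for x
        by (simp add: app_diff algebra_simps)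
      have fixU: "ac (inv\<^bsub>G\<^esub> (k \<otimes>\<^bsub>G\<^esub> g)) u = u" if "u \<in> U" for u
        using Qfix[OF subgroup.m_inv_closed[OF Qsub subgroup.m_closed[OF Qsub k g]] that] .
      have cm: "ac (commutator G g k) x - x = ac (inv\<^bsub>G\<^esub> (k \<otimes>\<^bsub>G\<^esub> g)) (ac g (ac k x) - ac k (ac g x))" for x
      proof -
        have "commutator G g k = inv\<^bsub>G\<^esub> (k \<otimes>\<^bsub>G\<^esub> g) \<otimes>\<^bsub>G\<^esub> (g \<otimes>\<^bsub>G\<^esub> k)"
          unfolding commutator_def using gc kc by (simp add: G.word_simps)
        then have "ac (commutator G g k) x = ac (inv\<^bsub>G\<^esub> (k \<otimes>\<^bsub>G\<^esub> g)) (ac g (ac k x))"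
          using gc kc by (simp add: ac_mult)
        moreover have "ac (inv\<^bsub>G\<^esub> (k \<otimes>\<^bsub>G\<^esub> g)) (ac k (ac g x)) = x"
          using ac_inv(2)[OF G.m_closed[OF kc gc], of x] ac_mult[OF kc gc] by simp
        ultimately show ?thesis unfolding app_diff by (simp only:)
      qed
      have "ac (commutator G g k) x - x \<in> U" if x: "x \<in> W" for x
      proof -
        have "ac g (ac k x) - ac k (ac g x) \<in> U"
          unfolding diff using stab[OF gS move[OF k x]] stab[OF kS move[OF g x]] Ua(3) by blast
        then show ?thesis unfolding cm using fixU by (simp only:)
      qed
      moreover have "ac (commutator G g k) x = x" if x: "x \<in> perp U" for x
      proof -
        have "ac g (ac k x) - ac k (ac g x) = 0"
          unfolding diff using Qfix[OF g stab[OF kS x]] Qfix[OF k stab[OF gS x]] by simp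
        then have "ac (commutator G g k) x - x = 0" unfolding cm by (simp only: app_zero)
        then show ?thesis by (simp only: right_minus_eq)
      qed
      ultimately show ?thesis unfolding A_def using cmc by blast
    qed
    then have "comm_sub G (iter_comm G S Q 1) Q \<subseteq> A"
      using 1 by (intro G.comm_sub_subset[OF Asub]) blast
    then have 2: "iter_comm G S Q 2 \<subseteq> A" by (simp add: numeral_2_eq_2)
    have "commutator G a g \<in> {\<one>\<^bsub>G\<^esub>}" if a: "a \<in> A" and g: "g \<in> Q" for a g
    proof -
      have gc: "g \<in> carrier G" using g QS Sc by blast
      have "a \<otimes>\<^bsub>G\<^esub> g = g \<otimes>\<^bsub>G\<^esub> a" using a g unfolding Q_def centralizer_in_def by auto
      then have "inv\<^bsub>G\<^esub> a \<otimes>\<^bsub>G\<^esub> inv\<^bsub>G\<^esub> g \<otimes>\<^bsub>G\<^esub> (a \<otimes>\<^bsub>G\<^esub> g) = inv\<^bsub>G\<^esub> a \<otimes>\<^bsub>G\<^esub> inv\<^bsub>G\<^esub> g \<otimes>\<^bsub>G\<^esub> (g \<otimes>\<^bsub>G\<^esub> a)" by simp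
      then show ?thesis unfolding commutator_def using gc Ac[OF a] by (simp add: G.word_simps)
    qed
    then have "comm_sub G (iter_comm G S Q 2) Q \<subseteq> {\<one>\<^bsub>G\<^esub>}"
      using 2 by (intro G.comm_sub_subset[OF G.triv_subgroup]) blast
    then have "iter_comm G S Q 3 \<subseteq> {\<one>\<^bsub>G\<^esub>}" by (simp add: numeral_3_eq_3 numeral_2_eq_2)
    then show "iter_comm G S Q (p - 1) \<subseteq> {\<one>\<^bsub>G\<^esub>}"
      by (rule G.iter_comm_trivial_mono[OF subgroup.subset[OF Qsub]]) (use p(2) in simp)
  qed
  ultimately show ?thesis by blast
qed

end

theorem theorem1p2:
  fixes n p q :: nat and S :: "'a::{field,finite} mat set"
  assumes "n \<ge> 1" and "Factorial_Ring.prime p" and "p \<ge> 5" and "prime_power q"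
    and "card (UNIV :: 'a set) = q ^ 2"
    and "sylow_subgroup (unitary_group q n :: 'a mat monoid) p S"
  shows "thompson_subgroup (unitary_group q n :: 'a mat monoid) p S
           \<subseteq> oliver_subgroup (unitary_group q n :: 'a mat monoid) p S"
proof -
  interpret unitary_space q n "TYPE('a)" by unfold_locales (use assms in simp_all)
  show ?thesis
  proof (cases "of_nat p = (0::'a)")
    case True
    \<comment> \<open>\<open>q\<close> is a power of the characteristic, which in this case is
      \<open>p\<close>; this supplies the exponent in \<open>q = p ^ l\<close>.\<close>
    obtain l where l: "Factorial_Ring.prime CHAR('a)" "q = CHAR('a) ^ l" using char by blast
    have "CHAR('a) dvd p" using True of_nat_eq_0_iff_char_dvd[where ?'a = 'a, of p] by simp
    then have "CHAR('a) = p" using l(1) assms(2) primes_dvd_imp_eq by blast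
    then show ?thesis using thompson_le_oliver_defining[OF assms(2,3) True _ assms(6)] l(2) by simp
  next
    case False
    then show ?thesis using thompson_le_oliver_coprime[OF assms(2) _ _ assms(6)] assms(3) by simp
  qed
qed

end
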